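(* Let $k$ be a field, let $n\ge 2$, let $Q=k[x_{i,j}\mid 1\le i\le n,\ 1\le j\le n+1]$ (standard graded), and let $R=Q/I_n$, where $I_n$ is the ideal of maximal minors of the generic $n\times(n+1)$ matrix $X=(x_{i,j})$. With the notation of the context ($\mathcal A$ the minimal graded $Q$-free resolution of $R$ with its dg algebra structure, $\mathcal U$ the minimal graded $Q$-free resolution of $\operatorname{coker}J^T_R$ with its dg $\mathcal A$-module structure, $B=(B_r,d_r)$ the associated relative bar resolution), the minimal graded $R$-free resolution of $\operatorname{Der}_{R\mid k}$ is the truncated relative bar resolution $\cdots\to B_4\to B_3\to B_2\to \operatorname{Der}_{R\mid k}\to 0$, that is, $$\cdots\longrightarrow R^{n(n+1)(n+2)}\xrightarrow{\begin{bmatrix} M_{1,1} & -M_{2,0}\\ \mathrm{id}\otimes J^T_R & \varphi_2\otimes \mathrm{id}\end{bmatrix}}R^{2n(n+1)}\xrightarrow{\begin{bmatrix}\partial_2 & M_{1,0}\end{bmatrix}}\operatorname{Der}_{R\mid k}\longrightarrow 0,$$ where $\operatorname{Der}_{R\mid k}$ is identified with $\ker(J^T_R)\subseteq R^{n(n+1)}$.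
   Context: Minors. For lists $\alpha,\beta$ of positive integers, $X_\alpha^\beta$ is the matrix obtained from $X$ by deleting the columns with labels in $\alpha$ and the rows with labels in $\beta$. $F_r=\det X_r$ for $1\le r\le n+1$ (delete column $r$), and $I_n=(F_1,\dots,F_{n+1})$. Derivations. $\operatorname{Der}_{R\mid k}$ is the $R$-module of $k$-linear maps $\delta:R\to R$ with $\delta(ab)=\delta(a)b+a\delta(b)$. $J^T_Q$ is the $(n+1)\times n(n+1)$ matrix with rows indexed by $F_1,\dots,F_{n+1}$ and columns indexed by the variables $x_{j,l}$ in the order $x_{1,1},x_{1,2},\dots,x_{1,n+1},x_{2,1},\dots,x_{n,n+1}$, with $(i,(j,l))$-entry $\partial F_i/\partial x_{j,l}$; $J^T_R=J^T_Q\otimes_Q R$. $\operatorname{Der}_{R\mid k}$ is isomorphic to $\ker(J^T_R:R^{n(n+1)}\to R^{n+1})$, the coordinate vector $(\alpha_{j,l})$ corresponding to the derivation induced by $\sum\alpha_{j,l}\,\partial/\partial x_{j,l}$. The dg algebra $\mathcal A$ (Hilbert-Burch complex): $0\to Q^n\xrightarrow{\varphi_2}Q^{n+1}\xrightarrow{\varphi_1}Q\to0$ with bases $\{T_i\}_{i=1}^n$ of $\mathcal A_2$, $\{e_i\}_{i=1}^{n+1}$ of $\mathcal A_1$, $\{1\}$ of $\mathcal A_0$; $\varphi_1(e_i)=(-1)^{i+1}F_i$, $\varphi_2=X^T$, i.e. $\varphi_2(T_i)=\sum_{\ell=1}^{n+1}x_{i,\ell}e_\ell$. Multiplication: $e_ie_j=-e_je_i=\sum_{k=1}^n(-1)^{i+j+k}\det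 X^k_{i,j}\,T_k$ for $i<j$, $e_ie_i=0$, $e_iT_j=0$, $T_iT_j=0$. The dg $\mathcal A$-module $\mathcal U$: $0\to Q^{(n-1)(n+1)}\xrightarrow{\partial_2}Q^{n(n+1)}\xrightarrow{J^T_Q}Q^{n+1}\to0$ with bases $\{a_i\}_{1\le i\le n+1}$ of $\mathcal U_0$, $\{b_{j,l}\}_{1\le j\le n,1\le l\le n+1}$ of $\mathcal U_1$, $\{c_{i,j}\}_{1\le i,j\le n,(i,j)\ne(1,1)}$ of $\mathcal U_2$, convention $c_{1,1}=0$; $\partial(b_{i,j})=\sum_{\ell=1}^{n+1}\frac{\partial F_\ell}{\partial x_{i,j}}a_\ell$ and $\partial_2(c_{i,j})=\sum_{\ell=1}^{n+1}x_{i,\ell}b_{j,\ell}-\delta_{i,j}\sum_{l=1}^{n+1}x_{1,l}b_{1,l}$ ($\delta_{i,j}$ the Kronecker delta). The action is: $e_ia_j=(-1)^j\sum_{k=1}^nx_{k,j}b_{k,i}$ for $i\ne j$; $e_ia_i=(-1)^{i+1}\big(\sum_{k\ne i}x_{1,k}b_{1,k}-\sum_{\ell\ne1}x_{\ell,i}b_{\ell,i}\big)$; $e_ib_{j,l}=(-1)^{i+1}\sum_{\ell=1}^n\frac{\partial F_i}{\partial x_{\ell,l}}c_{\ell,j}$; $T_ia_j=(-1)^j\sum_{k=1}^nx_{k,j}c_{i,k}$; $e_ic_{j,l}=T_ib_{j,l}=T_ic_{j,l}=0$. Relative bar resolution. For $r\ge0$, $B_r=\bigoplus R\otimes_Q\mathcal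 A_{i_1}\otimes_Q\cdots\otimes_Q\mathcal A_{i_p}\otimes_Q\mathcal U_j$, the sum over $p\ge0$, $i_1,\dots,i_p\ge1$, $j\ge0$ with $i_1+\dots+i_p+j+p=r$. Writing $[a_1|\cdots|a_p]u$ for $1\otimes a_1\otimes\cdots\otimes a_p\otimes u$ and $\varepsilon_m=\sum_{l\le m}(|a_l|+1)$, the differential $d$ is $$\sum_{m=1}^p(-1)^{\varepsilon_{m-1}}[a_1|\cdots|\partial a_m|\cdots|a_p]u+\sum_{m=1}^{p-1}(-1)^{\varepsilon_m}[a_1|\cdots|a_ma_{m+1}|\cdots|a_p]u+(-1)^{\varepsilon_p}[a_1|\cdots|a_{p-1}](a_pu)+(-1)^{\varepsilon_p}[a_1|\cdots|a_p]\partial u,$$ where $\partial a_m$ is read as $0$ if $|a_m|=1$, and the term with $a_pu$ is absent if $p=0$. $M_{i,j}$ is the matrix over $R$ of the multiplication map $R\otimes\mathcal A_i\otimes\mathcal U_j\to R\otimes\mathcal U_{i+j}$. In the display, $B_2=R\otimes(\mathcal U_2\oplus(\mathcal A_1\otimes\mathcal U_0))$, $B_3=R\otimes((\mathcal A_1\otimes\mathcal U_1)\oplus(\mathcal A_2\otimes\mathcal U_0))$, and all matrices are taken over $R$. A graded free resolution over $R$ is minimal if the matrices of its differentials have entries in the homogeneous maximal ideal of $R$. *)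

theory Defs
  imports
    "HOL-Library.Poly_Mapping"
    "HOL-Library.FuncSet"
    "HOL-Algebra.QuotRing"
    "HOL-Algebra.Module"
    "Jordan_Normal_Form.Determinant"
    "Jordan_Normal_Form.DL_Submatrix"
begin

section \<open>Free modules, matrices and minimal graded free resolutions\<close>

text \<open>The free module \<open>R\<^sup>S\<close> on a finite set \<open>S\<close>. The ring multiplication and unit that
  a \<^type>\<open>module\<close> record carries along are irrelevant and left unspecified.\<close>

definition free_module :: "('r, 'm) ring_scheme \<Rightarrow> 's set \<Rightarrow> ('r, 's \<Rightarrow> 'r) module"
  where "free_module R S =
    \<lparr>carrier = (S \<rightarrow>\<^sub>E carrier R), monoid.mult = undefined, one = undefined,
     zero = (\<lambda>s\<in>S. \<zero>\<^bsub>R\<^esub>),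
     add = (\<lambda>v w. \<lambda>s\<in>S. v s \<oplus>\<^bsub>R\<^esub> w s),
     module.smult = (\<lambda>r v. \<lambda>s\<in>S. r \<otimes>\<^bsub>R\<^esub> v s)\<rparr>"

definition unit_vector :: "('r, 'm) ring_scheme \<Rightarrow> 's set \<Rightarrow> 's \<Rightarrow> 's \<Rightarrow> 'r"
  where "unit_vector R S s = (\<lambda>t\<in>S. if t = s then \<one>\<^bsub>R\<^esub> else \<zero>\<^bsub>R\<^esub>)"

text \<open>Matrices are functions of a row index and a column index; columns correspond to the
  basis of the source.\<close>

definition matrix_map ::
  "('r, 'm) ring_scheme \<Rightarrow> 's set \<Rightarrow> 't set \<Rightarrow> ('t \<Rightarrow> 's \<Rightarrow> 'r) \<Rightarrow> ('s \<Rightarrow> 'r) \<Rightarrow> ('t \<Rightarrow> 'r)"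
  where "matrix_map R S T D v = (\<lambda>t\<in>T. \<Oplus>\<^bsub>R\<^esub>s\<in>S. D t s \<otimes>\<^bsub>R\<^esub> v s)"

definition linear_map ::
  "('r, 'm) ring_scheme \<Rightarrow> ('r, 'a, 'p) module_scheme \<Rightarrow> ('r, 'b, 'q) module_scheme \<Rightarrow> ('a \<Rightarrow> 'b) \<Rightarrow> bool"
  where "linear_map R M N f \<longleftrightarrow>
    f \<in> carrier M \<rightarrow> carrier N \<and>
    (\<forall>x\<in>carrier M. \<forall>y\<in>carrier M. f (x \<oplus>\<^bsub>M\<^esub> y) = f x \<oplus>\<^bsub>N\<^esub> f y) \<and>
    (\<forall>r\<in>carrier R. \<forall>x\<in>carrier M. f (r \<odot>\<^bsub>M\<^esub> x) = r \<odot>\<^bsub>N\<^esub> f x)"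

text \<open>\<open>RG d\<close> and \<open>MG d\<close> are the homogeneous components of degree \<open>d\<close> of \<open>R\<close> and \<open>M\<close>, and
  \<open>mm\<close> is the homogeneous maximal ideal of \<open>R\<close>. The complex has the free module on the finite set
  \<open>S i\<close> in homological degree \<open>i\<close>, where the basis vector \<open>s\<close> is homogeneous of degree \<open>dg i s\<close>;
  \<open>D i\<close> is the matrix of the differential from degree \<open>i + 1\<close> to degree \<open>i\<close>, and \<open>aug\<close> is the
  augmentation onto \<open>M\<close>. All maps are homogeneous of degree 0.\<close>

definition minimal_graded_free_resolution ::
  "('r, 'm) ring_scheme \<Rightarrow> (int \<Rightarrow> 'r set) \<Rightarrow> 'r set \<Rightarrow>
   ('r, 'a, 'p) module_scheme \<Rightarrow> (int \<Rightarrow> 'a set) \<Rightarrow>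
   (nat \<Rightarrow> 's set) \<Rightarrow> (nat \<Rightarrow> 's \<Rightarrow> int) \<Rightarrow> (nat \<Rightarrow> 's \<Rightarrow> 's \<Rightarrow> 'r) \<Rightarrow> (('s \<Rightarrow> 'r) \<Rightarrow> 'a) \<Rightarrow> bool"
  where "minimal_graded_free_resolution R RG mm M MG S dg D aug \<longleftrightarrow>
    cring R \<and> module R M \<and>
    (\<forall>i. finite (S i)) \<and>
    (\<forall>i. \<forall>t\<in>S i. \<forall>s\<in>S (Suc i). D i t s \<in> RG (dg (Suc i) s - dg i t)) \<and>
    (\<forall>i. \<forall>t\<in>S i. \<forall>s\<in>S (Suc i). D i t s \<in> mm) \<and>
    linear_map R (free_module R (S 0)) M aug \<and>
    (\<forall>s\<in>S 0. aug (unit_vector R (S 0) s) \<in> MG (dg 0 s)) \<and>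
    aug ` carrier (free_module R (S 0)) = carrier M \<and>
    a_kernel (free_module R (S 0)) M aug =
      matrix_map R (S (Suc 0)) (S 0) (D 0) ` carrier (free_module R (S (Suc 0))) \<and>
    (\<forall>i. a_kernel (free_module R (S (Suc i))) (free_module R (S i))
            (matrix_map R (S (Suc i)) (S i) (D i)) =
          matrix_map R (S (Suc (Suc i))) (S (Suc i)) (D (Suc i)) `
            carrier (free_module R (S (Suc (Suc i)))))"

definition block_matrix ::
  "('t \<Rightarrow> 's \<Rightarrow> 'r) \<Rightarrow> ('t \<Rightarrow> 's' \<Rightarrow> 'r) \<Rightarrow> ('t' \<Rightarrow> 's \<Rightarrow> 'r) \<Rightarrow> ('t' \<Rightarrow> 's' \<Rightarrow> 'r) \<Rightarrow>
   't + 't' \<Rightarrow> 's + 's' \<Rightarrow> 'r"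
  where "block_matrix A B C D = case_sum (\<lambda>t. case_sum (A t) (B t)) (\<lambda>t. case_sum (C t) (D t))"

definition block_row :: "('t \<Rightarrow> 's \<Rightarrow> 'r) \<Rightarrow> ('t \<Rightarrow> 's' \<Rightarrow> 'r) \<Rightarrow> 't \<Rightarrow> 's + 's' \<Rightarrow> 'r"
  where "block_row A B = (\<lambda>t. case_sum (A t) (B t))"

definition id_matrix :: "('r, 'm) ring_scheme \<Rightarrow> 's \<Rightarrow> 's \<Rightarrow> 'r"
  where "id_matrix R t s = (if t = s then \<one>\<^bsub>R\<^esub> else \<zero>\<^bsub>R\<^esub>)"

definition kronecker ::
  "('r, 'm) ring_scheme \<Rightarrow> ('t \<Rightarrow> 's \<Rightarrow> 'r) \<Rightarrow> ('t' \<Rightarrow> 's' \<Rightarrow> 'r) \<Rightarrow> 't \<times> 't' \<Rightarrow> 's \<times> 's' \<Rightarrow> 'r"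
  where "kronecker R A B = (\<lambda>(t, t') (s, s'). A t s \<otimes>\<^bsub>R\<^esub> B t' s')"


section \<open>The polynomial ring and its quotient by the maximal minors\<close>

text \<open>Polynomials over \<open>k\<close> in the variables \<open>xvar i j\<close> for arbitrary \<open>i, j\<close>. The ring \<open>Q\<close> consists
  of those that involve only the variables with \<open>1 \<le> i \<le> n\<close> and \<open>1 \<le> j \<le> n + 1\<close>.\<close>

type_synonym 'k qpoly = "(nat \<times> nat \<Rightarrow>\<^sub>0 nat) \<Rightarrow>\<^sub>0 'k"

definition vars :: "nat \<Rightarrow> (nat \<times> nat) set"
  where "vars n = {1..n} \<times> {1..n + 1}"

definition xvar :: "nat \<Rightarrow> nat \<Rightarrow> 'k::field qpoly"
  where "xvar i j = Poly_Mapping.single (Poly_Mapping.single (i, j) 1) 1"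

definition const :: "'k::field \<Rightarrow> 'k qpoly"
  where "const c = Poly_Mapping.single 0 c"

definition partial :: "nat \<times> nat \<Rightarrow> 'k::field qpoly \<Rightarrow> 'k qpoly"
  where "partial v p = (\<Sum>m\<in>Poly_Mapping.keys p.
    Poly_Mapping.single (m - Poly_Mapping.single v 1)
      (of_nat (Poly_Mapping.lookup m v) * Poly_Mapping.lookup p m))"

definition Q_ring :: "nat \<Rightarrow> 'k::field qpoly ring"
  where "Q_ring n =
    \<lparr>carrier = {p. \<forall>m\<in>Poly_Mapping.keys p. Poly_Mapping.keys m \<subseteq> vars n},
     monoid.mult = (*), one = 1, zero = 0, add = (+)\<rparr>"

definition homogeneous :: "int \<Rightarrow> 'k::field qpoly \<Rightarrow> bool"
  where "homogeneous d p \<longleftrightarrow> (\<forall>m\<in>Poly_Mapping.keys p.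
    int (\<Sum>v\<in>Poly_Mapping.keys m. Poly_Mapping.lookup m v) = d)"

text \<open>Matrices of \<^theory>\<open>Jordan_Normal_Form.Matrix\<close> are indexed from 0, whereas row and column
  labels below start at 1.\<close>

definition generic_matrix :: "nat \<Rightarrow> 'k::field qpoly mat"
  where "generic_matrix n = mat n (n + 1) (\<lambda>(i, j). xvar (Suc i) (Suc j))"

text \<open>\<open>det X\<^sub>\<alpha>\<^sup>\<beta>\<close>: the columns with label in \<open>\<alpha>\<close> and the rows with label in \<open>\<beta>\<close> are deleted.\<close>

definition minor :: "nat \<Rightarrow> nat set \<Rightarrow> nat set \<Rightarrow> 'k::field qpoly"
  where "minor n \<alpha> \<beta> = det (submatrix (generic_matrix n) {i. Suc i \<notin> \<beta>} {j. Suc j \<notin> \<alpha>})"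

definition Fmin :: "nat \<Rightarrow> nat \<Rightarrow> 'k::field qpoly"
  where "Fmin n r = minor n {r} {}"

definition I_ideal :: "nat \<Rightarrow> 'k::field qpoly set"
  where "I_ideal n = genideal (Q_ring n) (Fmin n ` {1..n + 1})"

definition R_ring :: "nat \<Rightarrow> 'k::field qpoly set ring"
  where "R_ring n = Q_ring n Quot I_ideal n"

definition cls :: "nat \<Rightarrow> 'k::field qpoly \<Rightarrow> 'k qpoly set"
  where "cls n p = I_ideal n +>\<^bsub>Q_ring n\<^esub> p"

definition R_grade :: "nat \<Rightarrow> int \<Rightarrow> 'k::field qpoly set set"
  where "R_grade n d = cls n ` {p \<in> carrier (Q_ring n). homogeneous d p}"

definition R_max_ideal :: "nat \<Rightarrow> 'k::field qpoly set set"
  where "R_max_ideal n = genideal (R_ring n) ((\<lambda>(i, j). cls n (xvar i j)) ` vars n)"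


section \<open>Derivations\<close>

definition Der :: "nat \<Rightarrow> ('k::field qpoly set, 'k qpoly set \<Rightarrow> 'k qpoly set) module"
  where "Der n = (let R = R_ring n in
    \<lparr>carrier = {\<delta> \<in> carrier R \<rightarrow>\<^sub>E carrier R.
       (\<forall>a\<in>carrier R. \<forall>b\<in>carrier R. \<delta> (a \<oplus>\<^bsub>R\<^esub> b) = \<delta> a \<oplus>\<^bsub>R\<^esub> \<delta> b) \<and>
       (\<forall>c. \<forall>a\<in>carrier R. \<delta> (cls n (const c) \<otimes>\<^bsub>R\<^esub> a) = cls n (const c) \<otimes>\<^bsub>R\<^esub> \<delta> a) \<and>
       (\<forall>a\<in>carrier R. \<forall>b\<in>carrier R.
          \<delta> (a \<otimes>\<^bsub>R\<^esub> b) = (\<delta> a \<otimes>\<^bsub>R\<^esub> b) \<oplus>\<^bsub>R\<^esub> (a \<otimes>\<^bsub>R\<^esub> \<delta> b))},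
     monoid.mult = undefined, one = undefined,
     zero = (\<lambda>a\<in>carrier R. \<zero>\<^bsub>R\<^esub>),
     add = (\<lambda>\<delta> \<epsilon>. \<lambda>a\<in>carrier R. \<delta> a \<oplus>\<^bsub>R\<^esub> \<epsilon> a),
     module.smult = (\<lambda>r \<delta>. \<lambda>a\<in>carrier R. r \<otimes>\<^bsub>R\<^esub> \<delta> a)\<rparr>)"

definition Der_grade :: "nat \<Rightarrow> int \<Rightarrow> ('k::field qpoly set \<Rightarrow> 'k qpoly set) set"
  where "Der_grade n d = {\<delta> \<in> carrier (Der n). \<forall>e. \<delta> ` R_grade n e \<subseteq> R_grade n (e + d)}"

text \<open>The transposed Jacobian matrix over \<open>R\<close>; rows are labelled by \<open>{1..n + 1}\<close>, columns
  by \<open>vars n\<close>.\<close>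

definition JT :: "nat \<Rightarrow> nat \<Rightarrow> nat \<times> nat \<Rightarrow> 'k::field qpoly set"
  where "JT n i v = cls n (partial v (Fmin n i))"

definition ker_JT :: "nat \<Rightarrow> ('k::field qpoly set, nat \<times> nat \<Rightarrow> 'k qpoly set) module"
  where "ker_JT n = (free_module (R_ring n) (vars n))
    \<lparr>carrier := a_kernel (free_module (R_ring n) (vars n)) (free_module (R_ring n) {1..n + 1})
       (matrix_map (R_ring n) (vars n) {1..n + 1} (JT n))\<rparr>"

text \<open>The map \<open>R \<rightarrow> R\<close> induced by \<open>\<Sum> \<alpha>\<^sub>v \<partial>/\<partial>x\<^sub>v\<close>. An element \<open>a\<close> of \<open>R\<close> is a coset, and the
  common value at all of its representatives \<open>p\<close> exists when \<open>\<alpha>\<close> lies in the kernel of the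
  transposed Jacobian.\<close>

definition induced_derivation ::
  "nat \<Rightarrow> (nat \<times> nat \<Rightarrow> 'k::field qpoly set) \<Rightarrow> 'k qpoly set \<Rightarrow> 'k qpoly set"
  where "induced_derivation n \<alpha> = (\<lambda>a\<in>carrier (R_ring n).
    THE b. \<forall>p\<in>a. b = (\<Oplus>\<^bsub>R_ring n\<^esub>v\<in>vars n. \<alpha> v \<otimes>\<^bsub>R_ring n\<^esub> cls n (partial v p)))"


section \<open>The algebra \<open>\<A>\<close> and the module \<open>\<U>\<close>\<close>

text \<open>Elements of the free \<open>Q\<close>-module on a set of generators are finitely supported functions
  from the generators to polynomials.\<close>

definition gen :: "'g \<Rightarrow> 'g \<Rightarrow>\<^sub>0 'k::field qpoly"
  where "gen g = Poly_Mapping.single g 1"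

definition scale :: "'k::field qpoly \<Rightarrow> ('g \<Rightarrow>\<^sub>0 'k qpoly) \<Rightarrow> ('g \<Rightarrow>\<^sub>0 'k qpoly)"  (infixr "\<cdot>" 75)
  where "q \<cdot> v = Poly_Mapping.map ((*) q) v"

definition relabel :: "('g \<Rightarrow> 'h) \<Rightarrow> ('g \<Rightarrow>\<^sub>0 'k::field qpoly) \<Rightarrow> ('h \<Rightarrow>\<^sub>0 'k qpoly)"
  where "relabel f v = (\<Sum>g\<in>Poly_Mapping.keys v. Poly_Mapping.lookup v g \<cdot> gen (f g))"

text \<open>Generators of positive degree of \<open>\<A>\<close>; the bar construction does not involve \<open>\<A>\<^sub>0\<close>.\<close>

datatype A_gen = eA (e_index: nat) | TA (T_index: nat)

datatype U_gen = aU (a_index: nat) | bU (b_index: "nat \<times> nat") | cU (c_index: "nat \<times> nat")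

primrec A_deg :: "A_gen \<Rightarrow> nat" where
  "A_deg (eA i) = 1"
| "A_deg (TA i) = 2"

primrec U_deg :: "U_gen \<Rightarrow> nat" where
  "U_deg (aU i) = 0"
| "U_deg (bU v) = 1"
| "U_deg (cU v) = 2"

definition A_basis :: "nat \<Rightarrow> nat \<Rightarrow> A_gen set"
  where "A_basis n d = {g \<in> eA ` {1..n + 1} \<union> TA ` {1..n}. A_deg g = d}"

definition U_basis :: "nat \<Rightarrow> nat \<Rightarrow> U_gen set"
  where "U_basis n d =
    {g \<in> aU ` {1..n + 1} \<union> bU ` vars n \<union> cU ` ({1..n} \<times> {1..n} - {(1, 1)}). U_deg g = d}"

text \<open>The element \<open>c\<^sub>i\<^sub>j\<close> of \<open>\<U>\<^sub>2\<close>, with the convention \<open>c\<^sub>1\<^sub>1 = 0\<close>.\<close>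

definition c_elem :: "nat \<Rightarrow> nat \<Rightarrow> U_gen \<Rightarrow>\<^sub>0 'k::field qpoly"
  where "c_elem i j = (if (i, j) = (1, 1) then 0 else gen (cU (i, j)))"

text \<open>The differential of \<open>\<A>\<close> as it enters the bar construction: the component
  \<open>\<A>\<^sub>1 \<rightarrow> \<A>\<^sub>0\<close>, which vanishes after tensoring with \<open>R\<close>, is replaced by 0.\<close>

primrec A_diff :: "nat \<Rightarrow> A_gen \<Rightarrow> A_gen \<Rightarrow>\<^sub>0 'k::field qpoly" where
  "A_diff n (eA i) = 0"
| "A_diff n (TA i) = (\<Sum>l=1..n+1. xvar i l \<cdot> gen (eA l))"

definition ee_product :: "nat \<Rightarrow> nat \<Rightarrow> nat \<Rightarrow> A_gen \<Rightarrow>\<^sub>0 'k::field qpoly"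
  where "ee_product n i j = (\<Sum>k=1..n. ((-1) ^ (i + j + k) * minor n {i, j} {k}) \<cdot> gen (TA k))"

fun A_mult :: "nat \<Rightarrow> A_gen \<Rightarrow> A_gen \<Rightarrow> A_gen \<Rightarrow>\<^sub>0 'k::field qpoly" where
  "A_mult n (eA i) (eA j) =
    (if i < j then ee_product n i j else if j < i then - ee_product n j i else 0)"
| "A_mult n _ _ = 0"

fun U_diff :: "nat \<Rightarrow> U_gen \<Rightarrow> U_gen \<Rightarrow>\<^sub>0 'k::field qpoly" where
  "U_diff n (aU i) = 0"
| "U_diff n (bU (i, j)) = (\<Sum>l=1..n+1. partial (i, j) (Fmin n l) \<cdot> gen (aU l))"
| "U_diff n (cU (i, j)) = (\<Sum>l=1..n+1. xvar i l \<cdot> gen (bU (j, l)))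
     - (if i = j then \<Sum>l=1..n+1. xvar 1 l \<cdot> gen (bU (1, l)) else 0)"

fun act :: "nat \<Rightarrow> A_gen \<Rightarrow> U_gen \<Rightarrow> U_gen \<Rightarrow>\<^sub>0 'k::field qpoly" where
  "act n (eA i) (aU j) =
    (if i \<noteq> j then (-1) ^ j \<cdot> (\<Sum>k=1..n. xvar k j \<cdot> gen (bU (k, i)))
     else (-1) ^ (i + 1) \<cdot>
       ((\<Sum>k\<in>{1..n+1} - {i}. xvar 1 k \<cdot> gen (bU (1, k))) -
        (\<Sum>l\<in>{1..n} - {1}. xvar l i \<cdot> gen (bU (l, i)))))"
| "act n (eA i) (bU (j, l)) = (-1) ^ (i + 1) \<cdot> (\<Sum>m=1..n. partial (m, l) (Fmin n i) \<cdot> c_elem m j)"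
| "act n (TA i) (aU j) = (-1) ^ j \<cdot> (\<Sum>k=1..n. xvar k j \<cdot> c_elem i k)"
| "act n _ _ = 0"


section \<open>The relative bar resolution\<close>

text \<open>The pair \<open>(as, u)\<close> stands for \<open>[a\<^sub>1|\<dots>|a\<^sub>p]u\<close>. The module \<open>B\<^sub>r\<close> is free over \<open>R\<close> on the set
  \<open>bar_basis n r\<close>.\<close>

type_synonym bar_word = "A_gen list \<times> U_gen"

definition bar_basis :: "nat \<Rightarrow> nat \<Rightarrow> bar_word set"
  where "bar_basis n r = {(as, u). set as \<subseteq> A_basis n 1 \<union> A_basis n 2 \<and>
    u \<in> U_basis n 0 \<union> U_basis n 1 \<union> U_basis n 2 \<and>
    (\<Sum>g\<leftarrow>as. A_deg g) + U_deg u + length as = r}"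

definition eps :: "A_gen list \<Rightarrow> nat \<Rightarrow> nat"
  where "eps as m = (\<Sum>g\<leftarrow>take m as. A_deg g + 1)"

text \<open>List positions start at 0, so \<open>as ! m\<close> is \<open>a\<^sub>m\<^sub>+\<^sub>1\<close>.\<close>

fun bar_diff :: "nat \<Rightarrow> bar_word \<Rightarrow> bar_word \<Rightarrow>\<^sub>0 'k::field qpoly" where
  "bar_diff n (as, u) =
    (\<Sum>m<length as. (-1) ^ eps as m \<cdot> relabel (\<lambda>g. (as[m := g], u)) (A_diff n (as ! m)))
  + (\<Sum>m<length as - 1. (-1) ^ eps as (Suc m) \<cdot>
       relabel (\<lambda>g. (take m as @ g # drop (m + 2) as, u)) (A_mult n (as ! m) (as ! Suc m)))
  + (if as = [] then 0
     else (-1) ^ eps as (length as) \<cdot> relabel (\<lambda>g. (butlast as, g)) (act n (last as) u))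
  + (-1) ^ eps as (length as) \<cdot> relabel (\<lambda>g. (as, g)) (U_diff n u)"

definition bar_matrix :: "nat \<Rightarrow> bar_word \<Rightarrow> bar_word \<Rightarrow> 'k::field qpoly set"
  where "bar_matrix n t s = cls n (Poly_Mapping.lookup (bar_diff n s) t)"

text \<open>Internal degrees. They are normalised so that \<open>bU v\<close> has the degree \<open>-1\<close> of the derivation
  \<open>\<partial>/\<partial>x\<^sub>v\<close>; the remaining ones are forced by homogeneity of the differentials and of the
  products.\<close>

primrec A_ideg :: "nat \<Rightarrow> A_gen \<Rightarrow> int" where
  "A_ideg n (eA i) = int n"
| "A_ideg n (TA i) = int n + 1"

primrec U_ideg :: "nat \<Rightarrow> U_gen \<Rightarrow> int" where
  "U_ideg n (aU i) = - int n"
| "U_ideg n (bU v) = -1"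
| "U_ideg n (cU v) = 0"

definition bar_ideg :: "nat \<Rightarrow> bar_word \<Rightarrow> int"
  where "bar_ideg n = (\<lambda>(as, u). (\<Sum>g\<leftarrow>as. A_ideg n g) + U_ideg n u)"

text \<open>The differential \<open>B\<^sub>2 \<rightarrow> B\<^sub>1\<close>, with \<open>B\<^sub>1 = R \<otimes> \<U>\<^sub>1\<close> with basis indexed by \<open>vars n\<close>, and its
  composition with the identification of the kernel of the transposed Jacobian with the
  derivations.\<close>

definition B2_to_coordinates ::
  "nat \<Rightarrow> (bar_word \<Rightarrow> 'k::field qpoly set) \<Rightarrow> nat \<times> nat \<Rightarrow> 'k qpoly set"
  where "B2_to_coordinates n w = (\<lambda>v\<in>vars n.
    matrix_map (R_ring n) (bar_basis n 2) (bar_basis n 1) (bar_matrix n) w ([], bU v))"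

definition B2_to_Der ::
  "nat \<Rightarrow> (bar_word \<Rightarrow> 'k::field qpoly set) \<Rightarrow> 'k qpoly set \<Rightarrow> 'k qpoly set"
  where "B2_to_Der n w = induced_derivation n (B2_to_coordinates n w)"


section \<open>The matrices at the end of the resolution\<close>

text \<open>The columns of \<open>M_matrix n\<close> are indexed by pairs of generators; \<open>M\<^sub>i\<^sub>,\<^sub>j\<close> is its restriction to
  the columns in \<open>A_basis n i \<times> U_basis n j\<close> and the rows in \<open>U_basis n (i + j)\<close>.\<close>

definition M_matrix :: "nat \<Rightarrow> U_gen \<Rightarrow> A_gen \<times> U_gen \<Rightarrow> 'k::field qpoly set"
  where "M_matrix n t = (\<lambda>(g, u). cls n (Poly_Mapping.lookup (act n g u) t))"

definition partial2_matrix :: "nat \<Rightarrow> U_gen \<Rightarrow> U_gen \<Rightarrow> 'k::field qpoly set"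
  where "partial2_matrix n t s = cls n (Poly_Mapping.lookup (U_diff n s) t)"

definition phi2_matrix :: "nat \<Rightarrow> A_gen \<Rightarrow> A_gen \<Rightarrow> 'k::field qpoly set"
  where "phi2_matrix n t s = cls n (xvar (T_index s) (e_index t))"

definition B2_index :: "nat \<Rightarrow> (U_gen + A_gen \<times> U_gen) set"
  where "B2_index n = Inl ` U_basis n 2 \<union> Inr ` (A_basis n 1 \<times> U_basis n 0)"

definition B3_index :: "nat \<Rightarrow> (A_gen \<times> U_gen + A_gen \<times> U_gen) set"
  where "B3_index n = Inl ` (A_basis n 1 \<times> U_basis n 1) \<union> Inr ` (A_basis n 2 \<times> U_basis n 0)"

definition B2_word :: "U_gen + A_gen \<times> U_gen \<Rightarrow> bar_word"
  where "B2_word = case_sum (\<lambda>u. ([], u)) (\<lambda>(g, u). ([g], u))"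

definition B3_word :: "A_gen \<times> U_gen + A_gen \<times> U_gen \<Rightarrow> bar_word"
  where "B3_word = case_sum (\<lambda>(g, u). ([g], u)) (\<lambda>(g, u). ([g], u))"

definition B2_display_matrix :: "nat \<Rightarrow> U_gen \<Rightarrow> U_gen + A_gen \<times> U_gen \<Rightarrow> 'k::field qpoly set"
  where "B2_display_matrix n = block_row (partial2_matrix n) (M_matrix n)"

definition B3_display_matrix ::
  "nat \<Rightarrow> U_gen + A_gen \<times> U_gen \<Rightarrow> A_gen \<times> U_gen + A_gen \<times> U_gen \<Rightarrow> 'k::field qpoly set"
  where "B3_display_matrix n = block_matrix
    (M_matrix n)
    (\<lambda>t s. \<ominus>\<^bsub>R_ring n\<^esub> M_matrix n t s)
    (kronecker (R_ring n) (id_matrix (R_ring n)) (\<lambda>t s. JT n (a_index t) (b_index s)))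
    (kronecker (R_ring n) (phi2_matrix n) (id_matrix (R_ring n)))"

end

theory Submission
  imports Defs
begin

text \<open>

The bar complex is a complex over \<open>R\<close> whose homology is that of \<open>\<U>\<close>, hence vanishes in positive
degrees. Its beginning \<open>B\<^sub>1 \<rightarrow> B\<^sub>0\<close> is the transposed Jacobian over \<open>R\<close>, so the part from \<open>B\<^sub>2\<close> on
resolves \<open>ker J\<^sup>T\<^sub>R\<close>, which is the module of derivations. Instead of comparing derived tensor products,
the exactness is proved here by computing with lifts to \<open>Q\<close>.

Everything about determinants is condensed in two families of polynomials, the signed minors
\<open>G\<^sub>i = (-1)\<^sup>i\<^sup>+\<^sup>1 F\<^sub>i\<close> and their derivatives \<open>H\<^sup>k\<^sub>i\<^sub>j = \<partial>G\<^sub>i/\<partial>x\<^sub>k\<^sub>j\<close>. Both are cofactors of the matrix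
\<open>X\<close> with a unit row on top, and the two relations \<open>A adj A = det A = adj A A\<close> (\<open>sum_H_row\<close>,
\<open>sum_H_column\<close>) yield the axioms of the dg algebra \<open>\<A>\<close> and of the dg module \<open>\<U>\<close> by pure linear
algebra. In particular multiplication by \<open>e\<^sub>i\<close> is a homotopy for multiplication by \<open>G\<^sub>i\<close>, so a
cycle of \<open>\<A>\<close> or \<open>\<U>\<close> becomes a boundary after multiplication by \<open>G\<^sub>1\<close> and by \<open>G\<^sub>n\<^sub>+\<^sub>1\<close>. Since these two
form a regular sequence (\<open>G_regular_sequence\<close>), the two preimages can be divided, and both complexes
are exact in positive degrees (\<open>Hilbert_Burch_exact\<close>, \<open>U_exact\<close>).

Over \<open>Q\<close> the bar differential, which omits \<open>\<partial>e\<^sub>i = G\<^sub>i\<close>, does not square to zero. Writing \<open>x\<^sup>g\<close> for the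
coefficient of the words with first letter \<open>g\<close>, one finds \<open>d\<^sup>2 x = \<Sum>\<^sub>k G\<^sub>k x\<^bsup>e\<^sub>k\<^esup>\<close>
(\<open>bar_d_square\<close>). If now \<open>d x = \<Sum>\<^sub>i G\<^sub>i y\<^sub>i\<close>, then \<open>\<Sum>\<^sub>k G\<^sub>k (x\<^bsup>e\<^sub>k\<^esup> - d y\<^sub>k) = 0\<close>, and
exactness of the Hilbert-Burch complex provides \<open>t\<^sub>j\<close> with \<open>x\<^bsup>e\<^sub>k\<^esup> - d y\<^sub>k = \<Sum>\<^sub>j x\<^sub>j\<^sub>k t\<^sub>j\<close>. The chain
\<open>v = \<Sum>\<^sub>i [e\<^sub>i|y\<^sub>i] + \<Sum>\<^sub>j [T\<^sub>j|t\<^sub>j]\<close> satisfies \<open>x - d v \<in> \<U>\<close> and \<open>d (x - d v) = 0\<close>, so that exactness of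
\<open>\<U>\<close> finishes the proof that \<open>x\<close> is a boundary (\<open>bar_acyclic\<close>). Reducing modulo the ideal of the
minors gives the exactness of the bar complex over \<open>R\<close>. All coefficients of the differential are
homogeneous without constant term because \<open>H\<^sup>k\<^sub>i\<^sub>j\<close> has degree \<open>n - 1 \<ge> 1\<close>, which is minimality.\<close>

abbreviation lookup :: "('a \<Rightarrow>\<^sub>0 'b::zero) \<Rightarrow> 'a \<Rightarrow> 'b" where "lookup \<equiv> Poly_Mapping.lookup"
abbreviation keys :: "('a \<Rightarrow>\<^sub>0 'b::zero) \<Rightarrow> 'a set" where "keys \<equiv> Poly_Mapping.keys"
abbreviation single :: "'a \<Rightarrow> 'b::zero \<Rightarrow> 'a \<Rightarrow>\<^sub>0 'b" where "single \<equiv> Poly_Mapping.single"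

type_synonym 'k U_chain = "U_gen \<Rightarrow>\<^sub>0 'k qpoly"
type_synonym 'k bar_chain = "bar_word \<Rightarrow>\<^sub>0 'k qpoly"
type_synonym 'k Der_module = "('k qpoly set, 'k qpoly set \<Rightarrow> 'k qpoly set) module"

section \<open>Polynomials with restricted variables\<close>

lemma poly_mapping_sum_singles:
  fixes p :: "'a \<Rightarrow>\<^sub>0 'b::comm_monoid_add"
  shows "p = (\<Sum>m\<in>keys p. single m (lookup p m))"
proof (rule poly_mapping_eqI)
  fix k
  show "lookup p k = lookup (\<Sum>m\<in>keys p. single m (lookup p m)) k"
    by (cases "k \<in> keys p")
       (auto simp: lookup_sum lookup_single when_def sum.delta in_keys_iff cong: if_cong)
qed

lemma poly_mapping_additive_induct [case_names zero single add]:
  fixes p :: "'a \<Rightarrow>\<^sub>0 'b::comm_monoid_add"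
  assumes "P 0" "\<And>m c. P (single m c)" "\<And>p q. P p \<Longrightarrow> P q \<Longrightarrow> P (p + q)"
  shows "P p"
proof -
  have "finite A \<Longrightarrow> P (\<Sum>m\<in>A. single m (lookup p m))" for A
    by (induction A rule: finite_induct) (auto simp: assms)
  from this[OF finite_keys[of p]] show ?thesis using poly_mapping_sum_singles[of p] by simp
qed

definition over_vars :: "(nat \<times> nat) set \<Rightarrow> 'k::field qpoly \<Rightarrow> bool"
  where "over_vars V p \<longleftrightarrow> (\<forall>m\<in>keys p. keys m \<subseteq> V)"

lemma carrier_Q_ring: "p \<in> carrier (Q_ring n) \<longleftrightarrow> over_vars (vars n) p"
  by (simp add: Q_ring_def over_vars_def)

lemma over_vars_mono: "over_vars V p \<Longrightarrow> V \<subseteq> W \<Longrightarrow> over_vars W p"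
  unfolding over_vars_def by blast

lemma over_vars_0 [simp]: "over_vars V 0"
  by (simp add: over_vars_def)

lemma over_vars_1 [simp]: "over_vars V 1"
  by (simp add: over_vars_def)

lemma over_vars_const [simp]: "over_vars V (const c)"
  by (simp add: over_vars_def const_def)

lemma over_vars_xvar [simp]: "(i, j) \<in> V \<Longrightarrow> over_vars V (xvar i j)"
  by (simp add: over_vars_def xvar_def)

lemma over_vars_add [simp]: "over_vars V p \<Longrightarrow> over_vars V q \<Longrightarrow> over_vars V (p + q)"
  unfolding over_vars_def using keys_add[of p q] by blast

lemma over_vars_uminus [simp]: "over_vars V (- p) \<longleftrightarrow> over_vars V p"
  by (simp add: over_vars_def)

lemma over_vars_diff [simp]: "over_vars V p \<Longrightarrow> over_vars V q \<Longrightarrow> over_vars V (p - q)"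
  using over_vars_add[of V p "- q"] by simp

lemma over_vars_mult [simp]:
  assumes "over_vars V p" "over_vars V q" shows "over_vars V (p * q)"
  unfolding over_vars_def
proof
  fix m assume "m \<in> keys (p * q)"
  then obtain a b where "m = a + b" "a \<in> keys p" "b \<in> keys q" using keys_mult[of p q] by blast
  then show "keys m \<subseteq> V" using assms keys_add[of a b] unfolding over_vars_def by blast
qed

lemma over_vars_sum: "(\<And>i. i \<in> A \<Longrightarrow> over_vars V (f i)) \<Longrightarrow> over_vars V (\<Sum>i\<in>A. f i)"
  by (induction A rule: infinite_finite_induct) auto

lemma over_vars_prod: "(\<And>i. i \<in> A \<Longrightarrow> over_vars V (f i)) \<Longrightarrow> over_vars V (\<Prod>i\<in>A. f i)"
  by (induction A rule: infinite_finite_induct) auto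

lemma over_vars_power [simp]: "over_vars V p \<Longrightarrow> over_vars V (p ^ k)"
  by (induction k) auto

lemma over_vars_signof: "over_vars V (signof p)"
  by (cases "sign p = 1") (auto simp: sign_def)

lemma over_vars_det:
  assumes A: "A \<in> carrier_mat m m" and *: "\<And>i j. i < m \<Longrightarrow> j < m \<Longrightarrow> over_vars V (A $$ (i, j))"
  shows "over_vars V (det A)"
  unfolding det_def'[OF A]
  by (intro over_vars_sum over_vars_mult over_vars_signof over_vars_prod *) (auto dest: permutes_in_image)


section \<open>Weights of monomials and homogeneity\<close>

definition weight :: "('v \<Rightarrow> nat) \<Rightarrow> ('v \<Rightarrow>\<^sub>0 nat) \<Rightarrow> nat"
  where "weight w m = (\<Sum>v\<in>keys m. lookup m v * w v)"

lemma weight_superset: "finite A \<Longrightarrow> keys m \<subseteq> A \<Longrightarrow> weight w m = (\<Sum>v\<in>A. lookup m v * w v)"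
  unfolding weight_def by (rule sum.mono_neutral_left) (auto simp: in_keys_iff)

lemma weight_add: "weight w (a + b) = weight w a + weight w b"
proof -
  let ?A = "keys a \<union> keys b"
  have "weight w (a + b) = (\<Sum>v\<in>?A. lookup (a + b) v * w v)"
    by (rule weight_superset) (auto simp: keys_add)
  moreover have "weight w a = (\<Sum>v\<in>?A. lookup a v * w v)" "weight w b = (\<Sum>v\<in>?A. lookup b v * w v)"
    by (auto intro!: weight_superset)
  ultimately show ?thesis by (simp add: lookup_add sum.distrib algebra_simps)
qed

lemma weight_0 [simp]: "weight w 0 = 0"
  by (simp add: weight_def)

lemma weight_single [simp]: "weight w (single v k) = k * w v"
  by (simp add: weight_def)

lemma weight_sum: "weight w (\<Sum>i\<in>A. f i) = (\<Sum>i\<in>A. weight w (f i))"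
  by (induction A rule: infinite_finite_induct) (auto simp: weight_add)

lemma homogeneous_weight: "homogeneous d p \<longleftrightarrow> (\<forall>m\<in>keys p. int (weight (\<lambda>_. 1) m) = d)"
  by (simp add: homogeneous_def weight_def)

lemma homogeneous_0 [simp]: "homogeneous d 0"
  by (simp add: homogeneous_def)

lemma homogeneous_1 [simp]: "homogeneous 0 1"
  by (simp add: homogeneous_def)

lemma homogeneous_xvar [simp]: "homogeneous 1 (xvar i j)"
  by (simp add: homogeneous_weight xvar_def)

lemma homogeneous_add [simp]: "homogeneous d p \<Longrightarrow> homogeneous d q \<Longrightarrow> homogeneous d (p + q)"
  unfolding homogeneous_def using keys_add[of p q] by blast

lemma homogeneous_uminus [simp]: "homogeneous d (- p) \<longleftrightarrow> homogeneous d p"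
  by (simp add: homogeneous_def)

lemma homogeneous_mult:
  assumes "homogeneous d p" "homogeneous e q" shows "homogeneous (d + e) (p * q)"
  unfolding homogeneous_weight
proof
  fix m assume "m \<in> keys (p * q)"
  then obtain a b where "m = a + b" "a \<in> keys p" "b \<in> keys q" using keys_mult[of p q] by blast
  then show "int (weight (\<lambda>_. 1) m) = d + e" using assms unfolding homogeneous_weight
    by (simp add: weight_add)
qed

lemma homogeneous_sum: "(\<And>i. i \<in> A \<Longrightarrow> homogeneous d (f i)) \<Longrightarrow> homogeneous d (\<Sum>i\<in>A. f i)"
  by (induction A rule: infinite_finite_induct) auto

lemma homogeneous_prod:
  "(\<And>i. i \<in> A \<Longrightarrow> homogeneous (d i) (f i)) \<Longrightarrow> homogeneous (\<Sum>i\<in>A. d i) (\<Prod>i\<in>A. f i)"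
  by (induction A rule: infinite_finite_induct) (auto intro: homogeneous_mult)

lemma homogeneous_signof: "homogeneous 0 (signof p)"
  by (cases "sign p = 1") (auto simp: sign_def)

lemma homogeneous_sign_mult: "homogeneous d p \<Longrightarrow> homogeneous d ((-1) ^ k * p)"
  by (cases "even k") auto

lemma homogeneous_det:
  assumes A: "A \<in> carrier_mat m m"
    and *: "\<And>i j. i < m \<Longrightarrow> j < m \<Longrightarrow> homogeneous (d i) (A $$ (i, j))"
  shows "homogeneous (\<Sum>i=0..<m. d i) (det A)"
  unfolding det_def'[OF A]
proof (rule homogeneous_sum)
  fix p assume "p \<in> {p. p permutes {0..<m}}"
  then have "homogeneous (\<Sum>i=0..<m. d i) (\<Prod>i = 0..<m. A $$ (i, p i))"
    by (intro homogeneous_prod *) (auto dest: permutes_in_image)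
  from homogeneous_mult[OF homogeneous_signof this]
  show "homogeneous (\<Sum>i=0..<m. d i) (signof p * (\<Prod>i = 0..<m. A $$ (i, p i)))" by simp
qed

lemma homogeneous_lookup_0: "homogeneous d p \<Longrightarrow> d \<noteq> 0 \<Longrightarrow> lookup p 0 = 0"
  unfolding homogeneous_weight by (metis in_keys_iff of_nat_0 weight_0)


section \<open>Partial derivatives\<close>

lemma lookup_partial:
  "lookup (partial v p) m = of_nat (lookup m v + 1) * lookup p (m + single v 1)"
proof -
  have *: "lookup (single (m' - single v 1) (of_nat (lookup m' v) * lookup p m')) m
     = (if m' = m + single v 1 then of_nat (lookup m v + 1) * lookup p m' else 0)" for m'
  proof (cases "lookup m' v = 0")
    case True
    then have "m' \<noteq> m + single v 1" by (auto simp: lookup_add)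
    with True show ?thesis by simp
  next
    case False
    have "m' - single v 1 = m \<longleftrightarrow> m' = m + single v 1"
    proof
      assume "m' - single v 1 = m"
      then have "lookup m' u = lookup (m + single v 1) u" for u
        using False by (auto simp: lookup_add lookup_minus lookup_single when_def)
      then show "m' = m + single v 1" by (rule poly_mapping_eqI)
    qed auto
    then show ?thesis by (auto simp: lookup_single when_def lookup_add)
  qed
  show ?thesis unfolding partial_def lookup_sum *
    by (auto simp: sum.delta'  in_keys_iff)
qed

lemma partial_add: "partial v (p + q) = partial v p + partial v q"
  by (rule poly_mapping_eqI) (simp only: lookup_partial lookup_add distrib_left)

lemma partial_0 [simp]: "partial v 0 = 0"
  by (simp add: partial_def)

lemma partial_uminus: "partial v (- p) = - partial v p"
  by (rule poly_mapping_eqI) (simp only: lookup_partial lookup_uminus mult_minus_right)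

lemma partial_diff: "partial v (p - q) = partial v p - partial v q"
  using partial_add[of v p "- q"] by (simp add: partial_uminus)

lemma partial_sum: "partial v (\<Sum>i\<in>A. f i) = (\<Sum>i\<in>A. partial v (f i))"
  by (induction A rule: infinite_finite_induct) (auto simp: partial_add)

lemma partial_single: "partial v (single m c) = single (m - single v 1) (of_nat (lookup m v) * c)"
  by (cases "c = 0") (simp_all add: partial_def)

lemma partial_const [simp]: "partial v (const c) = 0"
  by (simp add: const_def partial_single)

lemma partial_mult: "partial v (p * q) = partial v p * q + p * partial v q"
proof (induction p rule: poly_mapping_additive_induct)
  case (single a c)
  show ?case
  proof (induction q rule: poly_mapping_additive_induct)
    case (single b d)
    have 1: "single (a + b - single v 1) (of_nat (lookup a v) * c * d)
        = single ((a - single v 1) + b) (of_nat (lookup a v) * c * d)"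
    proof (cases "lookup a v = 0")
      case False
      have "a + b - single v 1 = (a - single v 1) + b"
        using False by (intro poly_mapping_eqI) (auto simp: lookup_add lookup_minus lookup_single when_def)
      then show ?thesis by simp
    qed simp
    have 2: "single (a + b - single v 1) (c * (of_nat (lookup b v) * d))
        = single (a + (b - single v 1)) (c * (of_nat (lookup b v) * d))"
    proof (cases "lookup b v = 0")
      case False
      have "a + b - single v 1 = a + (b - single v 1)"
        using False by (intro poly_mapping_eqI) (auto simp: lookup_add lookup_minus lookup_single when_def)
      then show ?thesis by simp
    qed simp
    show ?case unfolding mult_single partial_single 1[symmetric] 2[symmetric] single_add[symmetric]
      by (simp add: lookup_add algebra_simps)
  qed (simp_all add: partial_add algebra_simps)
qed (simp_all add: partial_add algebra_simps)

lemma partial_xvar: "partial v (xvar i j) = (if v = (i, j) then 1 else 0)"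
  by (auto simp: xvar_def partial_single lookup_single when_def)

lemma partial_eq_0:
  assumes "over_vars V p" "v \<notin> V" shows "partial v p = 0"
proof (rule poly_mapping_eqI)
  fix m :: "nat \<times> nat \<Rightarrow>\<^sub>0 nat"
  have "v \<in> keys (m + single v 1)" by (simp add: in_keys_iff lookup_add)
  then have "m + single v 1 \<notin> keys p" using assms unfolding over_vars_def by blast
  then show "lookup (partial v p) m = lookup 0 m" by (simp add: lookup_partial in_keys_iff)
qed

lemma over_vars_partial [simp]: "over_vars V p \<Longrightarrow> over_vars V (partial v p)"
  unfolding over_vars_def
proof
  fix m assume *: "\<forall>m\<in>keys p. keys m \<subseteq> V" and "m \<in> keys (partial v p)"
  then have "m + single v 1 \<in> keys p" by (auto simp: in_keys_iff lookup_partial)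
  with * have "keys (m + single v 1) \<subseteq> V" by blast
  moreover have "keys m \<subseteq> keys (m + single v 1)" by (auto simp: in_keys_iff lookup_add)
  ultimately show "keys m \<subseteq> V" by blast
qed

lemma homogeneous_partial: "homogeneous d p \<Longrightarrow> homogeneous (d - 1) (partial v p)"
  unfolding homogeneous_weight
proof
  fix m assume *: "\<forall>m\<in>keys p. int (weight (\<lambda>_. 1) m) = d" and "m \<in> keys (partial v p)"
  then have "m + single v 1 \<in> keys p" by (auto simp: in_keys_iff lookup_partial)
  with * show "int (weight (\<lambda>_. 1) m) = d - 1" by (force simp: weight_add)
qed


section \<open>The maximal minors and their derivatives\<close>

definition row_labels :: "nat \<Rightarrow> nat set" where "row_labels n = {1..n}"

definition col_labels :: "nat \<Rightarrow> nat set" where "col_labels n = {1..n+1}"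

lemma finite_row_labels [simp]: "finite (row_labels n)"
  by (simp add: row_labels_def)

lemma finite_col_labels [simp]: "finite (col_labels n)"
  by (simp add: col_labels_def)

lemma vars_eq: "vars n = row_labels n \<times> col_labels n"
  by (simp add: vars_def row_labels_def col_labels_def)

lemma mem_vars [simp]: "(i, j) \<in> vars n \<longleftrightarrow> i \<in> row_labels n \<and> j \<in> col_labels n"
  by (simp add: vars_eq)

text \<open>The generic matrix with the unit row \<open>e\<^sub>i\<close> put on top. Cofactors of this square matrix are
  the minors of \<open>X\<close> of size \<open>n\<close> and \<open>n - 1\<close>, with signs that make every formula below uniform in
  the indices.\<close>

definition bordered :: "nat \<Rightarrow> nat \<Rightarrow> 'k::field qpoly mat"
  where "bordered n i = mat (Suc n) (Suc n)
    (\<lambda>(r, c). if r = 0 then (if Suc c = i then 1 else 0) else xvar r (Suc c))"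

definition G :: "nat \<Rightarrow> nat \<Rightarrow> 'k::field qpoly"
  where "G n i = det (bordered n i)"

definition H :: "nat \<Rightarrow> nat \<Rightarrow> nat \<Rightarrow> nat \<Rightarrow> 'k::field qpoly"
  where "H n k i j = cofactor (bordered n i) k (j - 1)"

lemma bordered_carrier [simp]: "bordered n i \<in> carrier_mat (Suc n) (Suc n)"
  by (simp add: bordered_def)

lemma bordered_dim [simp]: "dim_row (bordered n i) = Suc n" "dim_col (bordered n i) = Suc n"
  by (simp_all add: bordered_def)

lemma bordered_top: "c < Suc n \<Longrightarrow> bordered n i $$ (0, c) = (if Suc c = i then 1 else 0)"
  by (simp add: bordered_def)

lemma bordered_row: "k \<in> row_labels n \<Longrightarrow> c < Suc n \<Longrightarrow> bordered n i $$ (k, c) = xvar k (Suc c)"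
  by (simp add: bordered_def row_labels_def)

lemma sum_lessThan_Suc_cols: "(\<Sum>c<Suc n. f c) = (\<Sum>j\<in>col_labels n. f (j - 1))"
  by (rule sum.reindex_bij_witness[of _ "\<lambda>j. j - 1" Suc]) (auto simp: col_labels_def)

lemma sum_lessThan_Suc_rows: "(\<Sum>r<Suc n. f r) = f 0 + (\<Sum>k\<in>row_labels n. f k)"
  for f :: "nat \<Rightarrow> 'a::comm_monoid_add"
proof -
  have "{..<Suc n} = insert 0 (row_labels n)" by (auto simp: row_labels_def)
  then show ?thesis by (simp add: row_labels_def)
qed

lemma row_times_cofactors:
  assumes "k < Suc n" "m < Suc n"
  shows "(\<Sum>j\<in>col_labels n. bordered n i $$ (m, j - 1) * H n k i j)
    = (if k = m then G n i else (0 :: 'k::field qpoly))"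
proof -
  let ?A = "bordered n i :: 'k qpoly mat"
  have "(?A * adj_mat ?A) $$ (m, k) = (\<Sum>c<Suc n. ?A $$ (m, c) * cofactor ?A k c)"
    using assms by (simp add: adj_mat_def scalar_prod_def atLeast0LessThan)
  also have "\<dots> = (\<Sum>j\<in>col_labels n. ?A $$ (m, j - 1) * H n k i j)"
    by (simp add: H_def sum_lessThan_Suc_cols del: sum.lessThan_Suc)
  finally have "(\<Sum>j\<in>col_labels n. ?A $$ (m, j - 1) * H n k i j) = (det ?A \<cdot>\<^sub>m 1\<^sub>m (Suc n)) $$ (m, k)"
    by (simp only: adj_mat(2)[OF bordered_carrier])
  then show ?thesis using assms by (auto simp: G_def)
qed

text \<open>The rows of \<open>A adj A = det A\<close> below the unit row: replacing row \<open>k\<close> by row \<open>m\<close> in the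
  determinant gives \<open>0\<close> unless \<open>k = m\<close>.\<close>

lemma sum_H_row:
  assumes "k \<in> row_labels n" "m \<in> row_labels n"
  shows "(\<Sum>j\<in>col_labels n. xvar m j * H n k i j) = (if k = m then G n i else (0 :: 'k::field qpoly))"
proof -
  have "(\<Sum>j\<in>col_labels n. xvar m j * H n k i j)
      = (\<Sum>j\<in>col_labels n. bordered n i $$ (m, j - 1) * (H n k i j :: 'k qpoly))"
    by (rule sum.cong[OF refl]) (use assms in \<open>auto simp: bordered_row col_labels_def\<close>)
  also have "\<dots> = (if k = m then G n i else 0)"
    by (rule row_times_cofactors) (use assms in \<open>auto simp: row_labels_def\<close>)
  finally show ?thesis .
qed

lemma H_diag:
  assumes "k \<in> row_labels n" "i \<in> col_labels n"
  shows "H n k i i = (0 :: 'k::field qpoly)"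
proof -
  have "(\<Sum>j\<in>col_labels n. bordered n i $$ (0, j - 1) * (H n k i j :: 'k qpoly)) = 0"
    using assms row_times_cofactors[of k n 0 i] by (auto simp: row_labels_def)
  moreover have "(\<Sum>j\<in>col_labels n. bordered n i $$ (0, j - 1) * (H n k i j :: 'k qpoly))
      = (\<Sum>j\<in>col_labels n. if j = i then H n k i j else 0)"
    by (rule sum.cong[OF refl]) (use assms in \<open>auto simp: bordered_top col_labels_def\<close>)
  ultimately show ?thesis using assms by simp
qed

lemma G_cofactor:
  assumes "i \<in> col_labels n"
  shows "cofactor (bordered n j) 0 (i - 1) = (G n i :: 'k::field qpoly)"
proof -
  let ?A = "bordered n i :: 'k qpoly mat"
  have "G n i = (\<Sum>c<Suc n. ?A $$ (0, c) * cofactor ?A 0 c)"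
    unfolding G_def by (rule laplace_expansion_row) simp_all
  also have "\<dots> = (\<Sum>k\<in>col_labels n. if k = i then cofactor ?A 0 (i - 1) else 0)"
    unfolding sum_lessThan_Suc_cols by (rule sum.cong) (auto simp: bordered_top col_labels_def)
  also have "\<dots> = cofactor ?A 0 (i - 1)" using assms by simp
  also have "mat_delete ?A 0 (i - 1) = mat_delete (bordered n j) 0 (i - 1)"
    by (rule eq_matI) (auto simp: mat_delete_def bordered_def)
  then have "cofactor ?A 0 (i - 1) = cofactor (bordered n j) 0 (i - 1)"
    by (simp add: cofactor_def)
  finally show ?thesis by simp
qed

text \<open>This is \<open>adj A A = det A\<close>, with the contribution of the unit row moved to the other side. It
  says that \<open>e\<^sub>i e\<^sub>j = \<Sum>\<^sub>k H\<^sup>k\<^sub>i\<^sub>j T\<^sub>k\<close> has the boundary \<open>G\<^sub>i e\<^sub>j - G\<^sub>j e\<^sub>i\<close> required by the Leibniz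
  rule.\<close>

lemma sum_H_column:
  assumes "i \<in> col_labels n" "j \<in> col_labels n" "q \<in> col_labels n"
  shows "(\<Sum>k\<in>row_labels n. H n k i j * xvar k q)
    = (if j = q then G n i else 0) - (if i = q then G n j else (0 :: 'k::field qpoly))"
proof -
  let ?A = "bordered n i :: 'k qpoly mat"
  have lt: "j - 1 < Suc n" "q - 1 < Suc n" and eq: "j - 1 = q - 1 \<longleftrightarrow> j = q" "Suc (q - 1) = q"
    using assms by (auto simp: col_labels_def)
  have "(adj_mat ?A * ?A) $$ (j - 1, q - 1)
      = (\<Sum>r<Suc n. cofactor ?A r (j - 1) * ?A $$ (r, q - 1))"
    using lt by (simp add: adj_mat_def scalar_prod_def atLeast0LessThan)
  also have "\<dots> = cofactor ?A 0 (j - 1) * ?A $$ (0, q - 1)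
      + (\<Sum>k\<in>row_labels n. cofactor ?A k (j - 1) * ?A $$ (k, q - 1))"
    by (rule sum_lessThan_Suc_rows)
  also have "(\<Sum>k\<in>row_labels n. cofactor ?A k (j - 1) * ?A $$ (k, q - 1))
      = (\<Sum>k\<in>row_labels n. H n k i j * xvar k q)"
    using lt eq by (intro sum.cong refl) (simp add: H_def bordered_row)
  also have "cofactor ?A 0 (j - 1) * ?A $$ (0, q - 1) = (if i = q then G n j else 0)"
    using lt eq unfolding G_cofactor[OF assms(2)] by (auto simp: bordered_top)
  also have "(adj_mat ?A * ?A) $$ (j - 1, q - 1) = (if j = q then G n i else 0)"
    unfolding adj_mat(3)[OF bordered_carrier] using lt eq by (auto simp: G_def)
  finally show ?thesis by (simp add: algebra_simps)
qed

lemma over_vars_H_row: "over_vars (vars n - {k} \<times> UNIV) (H n k i j :: 'k::field qpoly)"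
proof -
  let ?A = "mat_delete (bordered n i) k (j - 1) :: 'k qpoly mat"
  have A: "?A \<in> carrier_mat n n" by (simp add: mat_delete_def)
  have "over_vars (vars n - {k} \<times> UNIV) (det ?A)"
    by (rule over_vars_det[OF A])
       (auto simp: mat_delete_def bordered_def row_labels_def col_labels_def intro!: over_vars_xvar)
  then show ?thesis unfolding H_def cofactor_def by simp
qed

lemma over_vars_H [simp]: "over_vars (vars n) (H n k i j)"
  by (rule over_vars_mono[OF over_vars_H_row]) blast

lemma over_vars_G [simp]: "over_vars (vars n) (G n i)"
  unfolding G_def
  by (rule over_vars_det[OF bordered_carrier]) (auto simp: bordered_def row_labels_def col_labels_def)

lemma homogeneous_H:
  assumes "k \<in> row_labels n" shows "homogeneous (int n - 1) (H n k i j :: 'k::field qpoly)"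
proof -
  let ?A = "mat_delete (bordered n i) k (j - 1) :: 'k qpoly mat"
  have A: "?A \<in> carrier_mat n n" by (simp add: mat_delete_def)
  have "homogeneous (\<Sum>r=0..<n. if r = 0 then 0 else 1) (det ?A)"
    by (rule homogeneous_det[OF A])
       (use assms in \<open>auto simp: mat_delete_def bordered_def row_labels_def\<close>)
  moreover have "(\<Sum>r=0..<n. if r = 0 then 0 else 1) = int n - 1" using assms
    by (cases n) (auto simp: row_labels_def sum.atLeast0_lessThan_Suc_shift simp del: sum.op_ivl_Suc)
  ultimately show ?thesis unfolding H_def cofactor_def by (simp add: homogeneous_sign_mult)
qed

text \<open>Expanding \<open>G\<^sub>i\<close> along row \<open>k\<close> isolates the variables of that row, because the cofactors
  \<open>H\<^sup>k\<^sub>i\<^sub>j\<close> do not involve them.\<close>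

lemma partial_G:
  assumes "k \<in> row_labels n" "j \<in> col_labels n"
  shows "partial (k, j) (G n i) = (H n k i j :: 'k::field qpoly)"
proof -
  have "partial (k, j) (G n i) = partial (k, j) (\<Sum>q\<in>col_labels n. xvar k q * (H n k i q :: 'k qpoly))"
    using assms by (simp add: sum_H_row)
  also have "\<dots> = (\<Sum>q\<in>col_labels n. if q = j then H n k i q else 0)"
    unfolding partial_sum
  proof (rule sum.cong[OF refl])
    fix q
    have "partial (k, j) (H n k i q :: 'k qpoly) = 0" by (rule partial_eq_0[OF over_vars_H_row]) simp
    then show "partial (k, j) (xvar k q * (H n k i q :: 'k qpoly)) = (if q = j then H n k i q else 0)"
      by (simp add: partial_mult partial_xvar)
  qed
  finally show ?thesis using assms by simp
qed

lemma pick_delete_one: "pick {c. c \<noteq> a} r = insert_index a r"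
proof -
  let ?S = "{c. c \<noteq> a}"
  have "{x \<in> ?S. x < insert_index a r} = (if r < a then {..<r} else {..<Suc r} - {a})"
    by (auto simp: insert_index_def)
  then have "card {x \<in> ?S. x < insert_index a r} = r" by auto
  then show ?thesis using pick_card_in_set[of "insert_index a r" ?S] by simp
qed

lemma pick_delete_two:
  assumes "a < b" shows "pick {c. c \<noteq> a \<and> c \<noteq> b} r = insert_index b (insert_index a r)"
proof -
  let ?S = "{c. c \<noteq> a \<and> c \<noteq> b}" and ?t = "insert_index b (insert_index a r)"
  have "{x \<in> ?S. x < ?t} =
    (if r < a then {..<r} else if Suc r < b then {..<Suc r} - {a} else {..<Suc (Suc r)} - {a, b})"
    using assms by (auto simp: insert_index_def)
  then have "card {x \<in> ?S. x < ?t} = r" using assms by (auto simp: card_Diff_subset)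
  then show ?thesis using pick_card_in_set[of ?t ?S] assms by (auto simp: insert_index_def split: if_splits)
qed

lemma Fmin_G:
  assumes "i \<in> col_labels n"
  shows "Fmin n i = (-1) ^ (i + 1) * (G n i :: 'k::field qpoly)"
proof -
  obtain a where a: "i = Suc a" "a < Suc n" using assms by (cases i) (auto simp: col_labels_def)
  let ?A = "bordered n i :: 'k qpoly mat"
  have "G n i = (-1) ^ a * det (mat_delete ?A 0 a)"
    using G_cofactor[OF assms, of i, where ?'k = 'k, symmetric] a by (simp add: cofactor_def)
  moreover have "submatrix (generic_matrix n) UNIV {c. c \<noteq> a} = mat_delete ?A 0 a" (is "?L = ?R")
  proof -
    have "{j. j < Suc n \<and> j \<noteq> a} = {..<Suc n} - {a}" by auto
    then have c: "card {j. j < Suc n \<and> j \<noteq> a} = n" using a by simp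
    show ?thesis
    proof (rule eq_matI)
      fix r s assume "r < dim_row ?R" "s < dim_col ?R"
      then have rs: "r < n" "s < n" by simp_all
      have "?L $$ (r, s) = generic_matrix n $$ (pick UNIV r, pick {c. c \<noteq> a} s)"
        by (rule submatrix_index) (use rs c in \<open>simp_all add: generic_matrix_def\<close>)
      also have "\<dots> = xvar (Suc r) (Suc (insert_index a s))"
        using rs by (simp add: pick_UNIV pick_delete_one generic_matrix_def insert_index_def)
      also have "\<dots> = ?A $$ (insert_index 0 r, insert_index a s)"
        using rs by (simp add: bordered_def insert_index_def)
      also have "\<dots> = ?R $$ (r, s)"
        by (rule mat_delete_index[OF bordered_carrier]) (use rs a in auto)
      finally show "?L $$ (r, s) = ?R $$ (r, s)" .
    qed (use c in \<open>simp_all add: dim_submatrix generic_matrix_def\<close>)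
  qed
  ultimately have "G n i = (-1) ^ a * (Fmin n i :: 'k qpoly)"
    using a by (simp add: Fmin_def minor_def)
  then show ?thesis using a by (simp add: mult.assoc[symmetric] power_add[symmetric])
qed

text \<open>Deleting row \<open>k\<close> and column \<open>j\<close> of the bordered matrix leaves a unit row on top, along which a
  second expansion deletes column \<open>i\<close>. The structure constants of \<open>\<A>\<close> are therefore the \<open>H\<^sup>k\<^sub>i\<^sub>j\<close>.\<close>

lemma minor_H:
  assumes ij: "i \<in> col_labels n" "j \<in> col_labels n" "i < j" and k: "k \<in> row_labels n"
  shows "(-1) ^ (i + j + k) * minor n {i, j} {k} = (H n k i j :: 'k::field qpoly)"
proof -
  obtain a b c m where abc: "i = Suc a" "j = Suc b" "k = Suc c" "n = Suc m" "a < b" "b < Suc n" "c < n"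
    using assms by (cases i; cases j; cases k; cases n) (auto simp: col_labels_def row_labels_def)
  let ?A = "bordered n i :: 'k qpoly mat"
  let ?B = "mat_delete ?A k b"
  have B: "?B \<in> carrier_mat n n" by (simp add: mat_delete_def)
  have "det ?B = (\<Sum>s<n. ?B $$ (0, s) * cofactor ?B 0 s)"
    by (rule laplace_expansion_row[OF B]) (use abc in auto)
  also have "\<dots> = (\<Sum>s<n. if s = a then cofactor ?B 0 a else 0)"
    by (rule sum.cong[OF refl]) (use abc in \<open>auto simp: mat_delete_def bordered_def\<close>)
  also have "\<dots> = cofactor ?B 0 a" using abc by simp
  also have "\<dots> = (-1) ^ a * det (mat_delete ?B 0 a)" by (simp add: cofactor_def)
  finally have "H n k i j = (-1) ^ (k + b) * ((-1) ^ a * det (mat_delete ?B 0 a))"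
    using abc by (simp add: H_def cofactor_def)
  then have H: "H n k i j = (-1) ^ (i + j + k) * det (mat_delete ?B 0 a)"
    using abc by (simp add: mult.assoc[symmetric] power_add)
  have "submatrix (generic_matrix n) {r. r \<noteq> c} {s. s \<noteq> a \<and> s \<noteq> b} = mat_delete ?B 0 a" (is "?L = ?R")
  proof -
    have "{s. s < Suc n \<and> s \<noteq> a \<and> s \<noteq> b} = {..<Suc n} - {a, b}" by auto
    then have card2: "card {s. s < Suc n \<and> s \<noteq> a \<and> s \<noteq> b} = m" using abc by (simp add: card_Diff_subset)
    have "{r. r < n \<and> r \<noteq> c} = {..<n} - {c}" by auto
    then have card1: "card {r. r < n \<and> r \<noteq> c} = m" using abc by simp
    show ?thesis
    proof (rule eq_matI)
      fix r s assume "r < dim_row ?R" "s < dim_col ?R"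
      then have rs: "r < m" "s < m" using abc by (simp_all add: mat_delete_def)
      have "?L $$ (r, s) = generic_matrix n $$ (pick {r. r \<noteq> c} r, pick {s. s \<noteq> a \<and> s \<noteq> b} s)"
        by (rule submatrix_index) (use rs card1 card2 in \<open>simp_all add: generic_matrix_def\<close>)
      also have "\<dots> = xvar (Suc (insert_index c r)) (Suc (insert_index b (insert_index a s)))"
        using rs abc by (simp add: pick_delete_one pick_delete_two generic_matrix_def insert_index_def)
      also have "\<dots> = ?A $$ (insert_index k (insert_index 0 r), insert_index b (insert_index a s))"
        using rs abc by (simp add: bordered_def insert_index_def)
      also have "\<dots> = ?B $$ (insert_index 0 r, insert_index a s)"
        by (rule mat_delete_index[OF bordered_carrier])
           (use rs abc in \<open>simp_all add: insert_index_def\<close>)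
      also have "\<dots> = ?R $$ (r, s)"
        by (rule mat_delete_index) (use rs abc B in simp_all)
      finally show "?L $$ (r, s) = ?R $$ (r, s)" .
    qed (use card1 card2 abc in \<open>simp_all add: dim_submatrix generic_matrix_def\<close>)
  qed
  moreover have "{r. Suc r \<notin> {k}} = {r. r \<noteq> c}" "{s. Suc s \<notin> {i, j}} = {s. s \<noteq> a \<and> s \<noteq> b}"
    using abc by auto
  ultimately show ?thesis by (simp add: minor_def H)
qed


section \<open>Two maximal minors form a regular sequence\<close>

text \<open>A substitute for monic polynomials with respect to a monomial order: the weight is only a
  partial comparison of monomials, but its values are natural numbers, which makes induction on it
  immediate.\<close>

definition dominant :: "('v \<Rightarrow> nat) \<Rightarrow> ('v \<Rightarrow>\<^sub>0 nat) \<Rightarrow> (('v \<Rightarrow>\<^sub>0 nat) \<Rightarrow>\<^sub>0 'k::field) \<Rightarrow> bool"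
  where "dominant w a f \<longleftrightarrow> lookup f a = 1 \<and> (\<forall>m\<in>keys f. m \<noteq> a \<longrightarrow> weight w m < weight w a)"

lemma keys_diff_subset: "keys (p - q) \<subseteq> keys p \<union> keys (q :: 'a \<Rightarrow>\<^sub>0 'b::ab_group_add)"
  using keys_add[of p "- q"] by simp

lemma lookup_single_times:
  fixes u :: "('v \<Rightarrow>\<^sub>0 nat) \<Rightarrow>\<^sub>0 'k::comm_ring_1"
  shows "lookup (single a c * u) (a + m) = c * lookup u m"
proof (induction u rule: poly_mapping_additive_induct)
  case (single b d)
  then show ?case by (simp add: mult_single lookup_single when_def)
qed (simp_all add: lookup_add distrib_left)

lemma dominant_split:
  assumes "dominant w a f"
  obtains f' where "f = single a 1 + f'" "\<And>m. m \<in> keys f' \<Longrightarrow> weight w m < weight w a"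
proof
  define f' where "f' = f - single a 1"
  show "f = single a 1 + f'" by (simp add: f'_def)
  have "lookup f' a = 0" using assms by (simp add: f'_def lookup_minus dominant_def)
  moreover have "keys f' \<subseteq> keys f \<union> {a}"
    using keys_diff_subset[of f "single a 1"] by (auto simp: f'_def split: if_splits)
  ultimately show "weight w m < weight w a" if "m \<in> keys f'" for m
    using assms that by (auto simp: dominant_def in_keys_iff)
qed

lemma lookup_dominant_mult:
  assumes f: "dominant w a f" and u: "\<And>m. m \<in> keys u \<Longrightarrow> weight w m \<le> N"
    and m: "weight w m = N"
  shows "lookup (f * u) (a + m) = lookup u m"
proof -
  obtain f' where f': "f = single a 1 + f'" "\<And>m. m \<in> keys f' \<Longrightarrow> weight w m < weight w a"
    using dominant_split[OF f] by blast
  have "a + m \<notin> keys (f' * u)"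
  proof
    assume "a + m \<in> keys (f' * u)"
    then obtain x y where "a + m = x + y" "x \<in> keys f'" "y \<in> keys u" using keys_mult[of f' u] by blast
    then show False using f'(2)[of x] u[of y] m weight_add[of w a m] weight_add[of w x y] by simp
  qed
  then show ?thesis unfolding f'(1) distrib_right lookup_add
    by (simp add: lookup_single_times in_keys_iff)
qed

lemma dominant_mult_keys:
  assumes f: "dominant w a f" and u: "\<And>m. m \<in> keys u \<Longrightarrow> weight w m \<le> N"
    and t: "t \<in> keys (f * u)"
  shows "weight w t \<le> weight w a + N" "weight w t = weight w a + N \<Longrightarrow> \<exists>m. t = a + m"
proof -
  obtain x y where xy: "t = x + y" "x \<in> keys f" "y \<in> keys u" using t keys_mult[of f u] by blast
  have "weight w x \<le> weight w a" using f xy by (fastforce simp: dominant_def)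
  then show "weight w t \<le> weight w a + N" using u[OF xy(3)] by (simp add: xy(1) weight_add)
  show "\<exists>m. t = a + m" if "weight w t = weight w a + N"
  proof -
    have "\<not> weight w x < weight w a" using that u[OF xy(3)] by (simp add: xy(1) weight_add)
    then have "x = a" using f xy(2) by (auto simp: dominant_def)
    then show ?thesis using xy by blast
  qed
qed

text \<open>A monomial of maximal weight in \<open>u\<close>, multiplied by the dominant monomial, cannot cancel.\<close>

lemma dominant_nonzerodivisor:
  assumes f: "dominant w a f" and u: "u \<noteq> 0"
  obtains m where "m \<in> keys u" "\<And>m'. m' \<in> keys u \<Longrightarrow> weight w m' \<le> weight w m" "a + m \<in> keys (f * u)"
proof -
  have ne: "keys u \<noteq> {}" using u by simp
  obtain m where m: "m \<in> keys u" "weight w m = Max (weight w ` keys u)"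
    using Max_in[of "weight w ` keys u"] ne by (auto simp del: Max_in)
  have le: "weight w m' \<le> weight w m" if "m' \<in> keys u" for m' using that by (simp add: m(2))
  have "lookup (f * u) (a + m) = lookup u m" by (rule lookup_dominant_mult[OF f le]) simp_all
  then have "a + m \<in> keys (f * u)" using m(1) by (simp add: in_keys_iff)
  then show ?thesis using that m(1) le by blast
qed

text \<open>If \<open>f u = g c\<close>, then the monomials of top weight in \<open>c\<close> are divisible by the dominant monomial
  of \<open>f\<close>, because the latter is coprime to the dominant monomial of \<open>g\<close>. Subtracting a multiple
  of \<open>f\<close> therefore lowers the weight of \<open>c\<close>.\<close>

lemma dominant_coprime_dvd:
  assumes f: "dominant w a f" "over_vars V f" and g: "dominant w b g"
    and ab: "keys a \<inter> keys b = {}"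
    and c: "over_vars V c" and eq: "f * u = g * c"
  shows "\<exists>h. over_vars V h \<and> c = f * h"
proof -
  obtain f' where f': "f = single a 1 + f'" "\<And>m. m \<in> keys f' \<Longrightarrow> weight w m < weight w a"
    using dominant_split[OF f(1)] by blast
  have "\<exists>h. over_vars V h \<and> c = f * h"
    if "over_vars V c" "f * u = g * c" "\<And>m. m \<in> keys c \<Longrightarrow> weight w m < N" for N u c
    using that
  proof (induction N arbitrary: u c)
    case 0
    then have "keys c = {}" by (intro equals0I) blast
    then have "over_vars V 0 \<and> c = f * 0" by simp
    then show ?case by blast
  next
    case (Suc N)
    define T where "T = {m \<in> keys c. weight w m = N}"
    have finT: "finite T" by (simp add: T_def)
    have le: "weight w m \<le> N" if "m \<in> keys c" for m using Suc.prems(3)[OF that] by simp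
    have div: "a + (m - a) = m" if m: "m \<in> T" for m
    proof -
      have mN: "weight w m = N" "m \<in> keys c" using m by (auto simp: T_def)
      have "lookup (g * c) (b + m) = lookup c m" by (rule lookup_dominant_mult[OF g le mN(1)])
      then have t: "b + m \<in> keys (f * u)" using mN(2) unfolding Suc.prems(2) by (simp add: in_keys_iff)
      then have "u \<noteq> 0" by auto
      then obtain s where s: "\<And>m'. m' \<in> keys u \<Longrightarrow> weight w m' \<le> weight w s" "a + s \<in> keys (f * u)"
        using dominant_nonzerodivisor[OF f(1)] by blast
      have "weight w (b + m) \<le> weight w a + weight w s"
        by (rule dominant_mult_keys(1)[OF f(1) s(1) t])
      moreover have "weight w (a + s) \<le> weight w b + N"
        by (rule dominant_mult_keys(1)[OF g le]) (use s(2) Suc.prems(2) in simp_all)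
      ultimately have "weight w (b + m) = weight w a + weight w s" by (simp add: weight_add mN)
      from dominant_mult_keys(2)[OF f(1) s(1) t this] obtain m' where "b + m = a + m'" by blast
      then have sum: "lookup b v + lookup m v = lookup a v + lookup m' v" for v
        by (simp only: lookup_add[symmetric])
      have disj: "lookup a v = 0 \<or> lookup b v = 0" for v
        using ab by (auto simp: in_keys_iff)
      have "lookup a v \<le> lookup m v" for v
        using sum[of v] disj[of v] by linarith
      then show ?thesis by (intro poly_mapping_eqI) (simp add: lookup_add lookup_minus)
    qed
    define h where "h = (\<Sum>m\<in>T. single (m - a) (lookup c m))"
    define c' where "c' = c - f * h"
    have hV: "over_vars V h" unfolding h_def
    proof (rule over_vars_sum)
      fix m assume "m \<in> T"
      then have "keys m \<subseteq> V" using Suc.prems(1) by (auto simp: T_def over_vars_def)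
      moreover have "keys (m - a) \<subseteq> keys m" by (auto simp: in_keys_iff lookup_minus)
      ultimately show "over_vars V (single (m - a) (lookup c m))" by (auto simp: over_vars_def)
    qed
    have "single a 1 * h = (\<Sum>m\<in>T. single m (lookup c m))"
      unfolding h_def sum_distrib_left by (rule sum.cong[OF refl]) (simp add: mult_single div)
    then have c'_eq: "c' = (c - (\<Sum>m\<in>T. single m (lookup c m))) - f' * h"
      by (simp add: c'_def f'(1) distrib_right)
    have top: "lookup (\<Sum>m\<in>T. single m (lookup c m)) k = (if k \<in> T then lookup c k else 0)" for k
      using finT by (simp add: lookup_sum lookup_single when_def)
    have lt: "weight w m < N" if "m \<in> keys c'" for m
    proof -
      have "m \<in> keys (c - (\<Sum>m\<in>T. single m (lookup c m))) \<or> m \<in> keys (f' * h)"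
        using subsetD[OF keys_diff_subset that[unfolded c'_eq]] by (simp only: Un_iff)
      then show ?thesis
      proof
        assume "m \<in> keys (c - (\<Sum>m\<in>T. single m (lookup c m)))"
        then have "m \<in> keys c" "m \<notin> T" by (auto simp: in_keys_iff lookup_minus top split: if_splits)
        then show ?thesis using le[of m] by (auto simp: T_def)
      next
        assume "m \<in> keys (f' * h)"
        then obtain x y where xy: "m = x + y" "x \<in> keys f'" "y \<in> keys h" using keys_mult[of f' h] by blast
        from xy(3) obtain m' where m': "m' \<in> T" "y = m' - a"
          using keys_sum[of "\<lambda>m. single (m - a) (lookup c m)" T] unfolding h_def
          by (fastforce split: if_splits)
        have "weight w a + weight w y = N"
          using arg_cong[OF div[OF m'(1)], of "weight w"] m' by (simp add: weight_add T_def)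
        then show ?thesis using f'(2)[OF xy(2)] by (simp add: xy(1) weight_add)
      qed
    qed
    have "f * (u - g * h) = g * c'" using Suc.prems(2) by (simp add: c'_def algebra_simps)
    then obtain h' where "over_vars V h'" "c' = f * h'"
      using Suc.IH[of c' "u - g * h"] lt Suc.prems(1) f(2) hV by (auto simp: c'_def)
    then have "over_vars V (h + h') \<and> c = f * (h + h')"
      using hV by (auto simp: c'_def algebra_simps)
    then show ?case by blast
  qed
  from this[OF c eq, of "Suc (Max (weight w ` keys c))"] show ?thesis
    by (simp add: le_imp_less_Suc)
qed

lemma prod_xvar:
  "finite A \<Longrightarrow> (\<Prod>r\<in>A. xvar (f r) (g r)) = (single (\<Sum>r\<in>A. single (f r, g r) 1) 1 :: 'k::field qpoly)"
proof (induction A rule: finite_induct)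
  case (insert r A)
  then show ?case by (simp add: xvar_def mult_single)
qed simp

lemma permutation_weight:
  fixes p :: "nat \<Rightarrow> nat"
  assumes p: "p permutes {0..<n}" "p \<noteq> id"
  shows "(\<Sum>r=0..<n. Suc r * (p r + s)) < (\<Sum>r=0..<n. Suc r * (r + s))"
proof -
  have perm: "(\<Sum>r=0..<n. h (p r)) = (\<Sum>r=0..<n. h r)" for h :: "nat \<Rightarrow> int"
    by (rule sum.permute[OF p(1), unfolded comp_def, symmetric])
  obtain r0 where r0: "p r0 \<noteq> r0" using p(2) by (auto simp: fun_eq_iff)
  then have "r0 \<in> {0..<n}" using p(1) by (meson permutes_not_in)
  \<comment> \<open>Both sums of squares agree, so the mixed sum is smaller by half of this positive number.\<close>
  have "0 < (\<Sum>r=0..<n. (int r - int (p r))\<^sup>2)"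
    by (rule sum_pos2[OF _ \<open>r0 \<in> {0..<n}\<close>]) (use r0 in auto)
  also have "\<dots> = (\<Sum>r=0..<n. (int r)\<^sup>2) + (\<Sum>r=0..<n. (int (p r))\<^sup>2) - 2 * (\<Sum>r=0..<n. int r * int (p r))"
    by (simp add: power2_diff sum.distrib sum_subtractf sum_distrib_left mult.assoc)
  also have "\<dots> = 2 * (\<Sum>r=0..<n. (int r)\<^sup>2) - 2 * (\<Sum>r=0..<n. int r * int (p r))"
    by (simp add: perm[of "\<lambda>x. (int x)\<^sup>2"])
  finally have "(\<Sum>r=0..<n. int r * int (p r)) < (\<Sum>r=0..<n. (int r)\<^sup>2)" by simp
  then have "int (\<Sum>r=0..<n. Suc r * (p r + s)) < int (\<Sum>r=0..<n. Suc r * (r + s))"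
    using perm[of int] by (simp add: algebra_simps sum.distrib power2_eq_square)
  then show ?thesis by (simp only: of_nat_less_iff)
qed

text \<open>For the weight \<open>i j\<close> of \<open>x\<^sub>i\<^sub>j\<close>, the diagonal term of a minor on consecutive columns is dominant
  by the rearrangement inequality.\<close>

lemma dominant_minor:
  "dominant (\<lambda>(i, j). i * j) (\<Sum>r=0..<n. single (Suc r, r + s) 1)
    (det (mat n n (\<lambda>(r, c). xvar (Suc r) (c + s))) :: 'k::field qpoly)"
proof -
  let ?w = "\<lambda>(i, j). i * j :: nat"
  let ?P = "{p. p permutes {0..<n}}"
  define M :: "'k qpoly mat" where "M = mat n n (\<lambda>(r, c). xvar (Suc r) (c + s))"
  define mon :: "(nat \<Rightarrow> nat) \<Rightarrow> (nat \<times> nat \<Rightarrow>\<^sub>0 nat)"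
    where "mon p = (\<Sum>r=0..<n. single (Suc r, p r + s) 1)" for p
  have weight: "weight ?w (mon p) = (\<Sum>r=0..<n. Suc r * (p r + s))" for p
    by (simp add: mon_def weight_sum)
  have lt: "weight ?w (mon p) < weight ?w (mon id)" if "p \<in> ?P - {id}" for p
    unfolding weight id_apply by (rule permutation_weight) (use that in auto)
  have fin: "finite ?P" by (simp add: finite_permutations)
  have M: "M \<in> carrier_mat n n" by (simp add: M_def)
  have "det M = (\<Sum>p\<in>?P. signof p * single (mon p) 1)"
    unfolding det_def'[OF M]
  proof (rule sum.cong[OF refl])
    fix p assume "p \<in> ?P"
    then have "(\<Prod>i=0..<n. M $$ (i, p i)) = (\<Prod>i=0..<n. xvar (Suc i) (p i + s))"
      by (intro prod.cong refl) (auto simp: M_def dest: permutes_in_image)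
    also have "\<dots> = single (mon p) 1" by (simp add: prod_xvar mon_def)
    finally show "signof p * (\<Prod>i=0..<n. M $$ (i, p i)) = signof p * single (mon p) 1" by simp
  qed
  also have "\<dots> = signof id * single (mon id) 1 + (\<Sum>p\<in>?P - {id}. signof p * single (mon p) 1)"
    by (rule sum.remove[OF fin]) (simp add: permutes_id)
  finally have det: "det M = single (mon id) 1 + (\<Sum>p\<in>?P - {id}. signof p * single (mon p) 1)"
    by (simp add: sign_id)
  have keys: "\<exists>p\<in>?P - {id}. m = mon p"
    if m: "m \<in> keys (\<Sum>p\<in>?P - {id}. signof p * single (mon p) 1 :: 'k qpoly)" for m
  proof -
    obtain p where "p \<in> ?P - {id}" "m \<in> keys (signof p * single (mon p) 1 :: 'k qpoly)"
      using m keys_sum[of "\<lambda>p. signof p * single (mon p) 1 :: 'k qpoly" "?P - {id}"] by blast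
    moreover have "keys (signof p * single (mon p) 1 :: 'k qpoly) \<subseteq> {mon p}" for p
      by (cases "sign p = 1") (auto simp: sign_def)
    ultimately show ?thesis by blast
  qed
  have notin: "mon id \<notin> keys (\<Sum>p\<in>?P - {id}. signof p * single (mon p) 1 :: 'k qpoly)"
  proof
    assume "mon id \<in> keys (\<Sum>p\<in>?P - {id}. signof p * single (mon p) 1 :: 'k qpoly)"
    then obtain p where p: "p \<in> ?P - {id}" "mon id = mon p" using keys by blast
    then show False using lt[OF p(1)] by simp
  qed
  have "dominant ?w (mon id) (det M)"
    unfolding dominant_def
  proof (intro conjI ballI impI)
    show "lookup (det M) (mon id) = 1" using notin by (simp add: det lookup_add in_keys_iff)
    fix m assume m: "m \<in> keys (det M)" "m \<noteq> mon id"
    then have "m \<in> keys (\<Sum>p\<in>?P - {id}. signof p * single (mon p) 1 :: 'k qpoly)"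
      unfolding det using keys_add[of "single (mon id) 1"
        "\<Sum>p\<in>?P - {id}. signof p * single (mon p) 1 :: 'k qpoly"] by (auto split: if_splits)
    then obtain p where "p \<in> ?P - {id}" "m = mon p" using keys by blast
    then show "weight ?w m < weight ?w (mon id)" using lt by blast
  qed
  then show ?thesis by (simp add: M_def mon_def)
qed

lemma G_first_minor: "G n 1 = det (mat n n (\<lambda>(r, c). xvar (Suc r) (c + 2)) :: 'k::field qpoly mat)"
proof -
  have "G n 1 = cofactor (bordered n 1 :: 'k qpoly mat) 0 0"
    using G_cofactor[of 1 n 1, where ?'k = 'k] by (simp add: col_labels_def)
  also have "mat_delete (bordered n 1) 0 0 = (mat n n (\<lambda>(r, c). xvar (Suc r) (c + 2)) :: 'k qpoly mat)"
    by (rule eq_matI) (auto simp: mat_delete_def bordered_def)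
  then have "cofactor (bordered n 1 :: 'k qpoly mat) 0 0
      = det (mat n n (\<lambda>(r, c). xvar (Suc r) (c + 2)))" by (simp add: cofactor_def)
  finally show ?thesis .
qed

lemma G_last_minor:
  "G n (n + 1) = (-1) ^ n * det (mat n n (\<lambda>(r, c). xvar (Suc r) (c + 1)) :: 'k::field qpoly mat)"
proof -
  have "G n (n + 1) = cofactor (bordered n 1 :: 'k qpoly mat) 0 n"
    using G_cofactor[of "n + 1" n 1, where ?'k = 'k] by (simp add: col_labels_def)
  also have "mat_delete (bordered n 1) 0 n = (mat n n (\<lambda>(r, c). xvar (Suc r) (c + 1)) :: 'k qpoly mat)"
    by (rule eq_matI) (auto simp: mat_delete_def bordered_def)
  then have "cofactor (bordered n 1 :: 'k qpoly mat) 0 n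
      = (-1) ^ n * det (mat n n (\<lambda>(r, c). xvar (Suc r) (c + 1)))" by (simp add: cofactor_def)
  finally show ?thesis .
qed

lemma G_last_nonzerodivisor:
  assumes "G n (n + 1) * u = (0 :: 'k::field qpoly)" shows "u = 0"
proof (rule ccontr)
  assume "u \<noteq> 0"
  have "det (mat n n (\<lambda>(r, c). xvar (Suc r) (c + 1)) :: 'k qpoly mat) * u = 0"
    using assms unfolding G_last_minor by (cases "even n") simp_all
  note zero = this
  show False
    by (rule dominant_nonzerodivisor[OF dominant_minor[where n = n and s = 1] \<open>u \<noteq> 0\<close>])
       (simp only: zero keys_zero empty_iff)
qed

lemma G_regular_sequence:
  assumes eq: "G n (n + 1) * u = G n 1 * (c :: 'k::field qpoly)" and c: "over_vars (vars n) c"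
  shows "\<exists>h. over_vars (vars n) h \<and> c = G n (n + 1) * h"
proof -
  let ?f = "det (mat n n (\<lambda>(r, c). xvar (Suc r) (c + 1))) :: 'k qpoly"
  let ?a = "\<lambda>s. \<Sum>r=0..<n. single (Suc r, r + s) 1 :: nat \<times> nat \<Rightarrow>\<^sub>0 nat"
  have keys: "keys (?a s) \<subseteq> {(Suc r, r + s) | r. r < n}" for s
    using keys_sum[of "\<lambda>r. single (Suc r, r + s) (1::nat)" "{0..<n}"] by fastforce
  have "over_vars (vars n) ?f"
    by (rule over_vars_det[where m = n]) (auto simp: row_labels_def col_labels_def)
  moreover have "keys (?a 1) \<inter> keys (?a 2) = {}" using keys[of 1] keys[of 2] by fastforce
  moreover have "?f * ((-1) ^ n * u) = det (mat n n (\<lambda>(r, c). xvar (Suc r) (c + 2))) * c"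
    using eq unfolding G_first_minor G_last_minor by (simp add: algebra_simps)
  ultimately obtain h where h: "over_vars (vars n) h" "c = ?f * h"
    using dominant_coprime_dvd[OF dominant_minor _ dominant_minor _ c, of n 1 2 n] by blast
  have "c = G n (n + 1) * ((-1) ^ n * h)"
    unfolding G_last_minor h(2) by (simp add: algebra_simps power_mult_distrib[symmetric])
  moreover have "over_vars (vars n) ((-1) ^ n * h)" using h by simp
  ultimately show ?thesis by blast
qed


section \<open>Chains and their linear maps\<close>

lemma lookup_scale [simp]: "lookup (q \<cdot> x) g = q * lookup x g"
  unfolding scale_def by (simp add: map.rep_eq when_def)

lemma lookup_gen: "lookup (gen g) h = (if g = h then 1 else 0)"
  by (simp add: gen_def lookup_single when_def)

lemma keys_gen [simp]: "keys (gen g :: 'g \<Rightarrow>\<^sub>0 'k::field qpoly) = {g}"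
  by (simp add: gen_def)

lemma keys_scale: "keys (q \<cdot> x) \<subseteq> keys x"
  by (auto simp: in_keys_iff)

lemma scale_add_right: "q \<cdot> (x + y) = q \<cdot> x + q \<cdot> y"
  by (rule poly_mapping_eqI) (simp add: lookup_add distrib_left)

lemma scale_add_left: "(q + r) \<cdot> x = q \<cdot> x + r \<cdot> x"
  by (rule poly_mapping_eqI) (simp add: lookup_add distrib_right)

lemma scale_diff_right: "q \<cdot> (x - y) = q \<cdot> x - q \<cdot> y"
  by (rule poly_mapping_eqI) (simp add: lookup_minus right_diff_distrib)

lemma scale_diff_left: "(q - r) \<cdot> x = q \<cdot> x - r \<cdot> x"
  by (rule poly_mapping_eqI) (simp add: lookup_minus left_diff_distrib)

lemma scale_uminus_left [simp]: "(- q) \<cdot> x = - (q \<cdot> x)"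
  by (rule poly_mapping_eqI) simp

lemma scale_uminus_right [simp]: "q \<cdot> (- x) = - (q \<cdot> x)"
  by (rule poly_mapping_eqI) simp

lemma scale_scale: "q \<cdot> r \<cdot> x = (q * r) \<cdot> x"
  by (rule poly_mapping_eqI) (simp add: mult.assoc)

lemma scale_one [simp]: "1 \<cdot> x = x"
  by (rule poly_mapping_eqI) simp

lemma scale_zero_left [simp]: "0 \<cdot> x = 0"
  by (rule poly_mapping_eqI) simp

lemma scale_zero_right [simp]: "q \<cdot> 0 = 0"
  by (rule poly_mapping_eqI) simp

lemma scale_sum_right: "q \<cdot> (\<Sum>i\<in>A. f i) = (\<Sum>i\<in>A. q \<cdot> f i)"
  by (rule poly_mapping_eqI) (simp add: lookup_sum sum_distrib_left)

lemma scale_sum_left: "(\<Sum>i\<in>A. q i) \<cdot> x = (\<Sum>i\<in>A. q i \<cdot> x)"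
  by (rule poly_mapping_eqI) (simp add: lookup_sum sum_distrib_right)

definition lin :: "('g \<Rightarrow> 'h \<Rightarrow>\<^sub>0 'k::field qpoly) \<Rightarrow> ('g \<Rightarrow>\<^sub>0 'k qpoly) \<Rightarrow> 'h \<Rightarrow>\<^sub>0 'k qpoly"
  where "lin f x = (\<Sum>g\<in>keys x. lookup x g \<cdot> f g)"

lemma lin_superset: "finite A \<Longrightarrow> keys x \<subseteq> A \<Longrightarrow> lin f x = (\<Sum>g\<in>A. lookup x g \<cdot> f g)"
  unfolding lin_def by (rule sum.mono_neutral_left) (auto simp: in_keys_iff)

lemma lin_add: "lin f (x + y) = lin f x + lin f y"
proof -
  let ?A = "keys x \<union> keys y"
  have "lin f (x + y) = (\<Sum>g\<in>?A. lookup (x + y) g \<cdot> f g)"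
    by (rule lin_superset) (auto simp: keys_add)
  moreover have "lin f x = (\<Sum>g\<in>?A. lookup x g \<cdot> f g)" "lin f y = (\<Sum>g\<in>?A. lookup y g \<cdot> f g)"
    by (auto intro!: lin_superset)
  ultimately show ?thesis by (simp add: lookup_add scale_add_left sum.distrib)
qed

lemma lin_scale: "lin f (q \<cdot> x) = q \<cdot> lin f x"
proof -
  have "lin f (q \<cdot> x) = (\<Sum>g\<in>keys x. lookup (q \<cdot> x) g \<cdot> f g)"
    by (rule lin_superset) (auto simp: keys_scale)
  then show ?thesis by (simp add: lin_def scale_sum_right scale_scale)
qed

lemma lin_0 [simp]: "lin f 0 = 0"
  by (simp add: lin_def)

lemma lin_uminus: "lin f (- x) = - lin f x"
  using lin_scale[of f "-1" x] by simp

lemma lin_diff: "lin f (x - y) = lin f x - lin f y"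
  using lin_add[of f x "- y"] by (simp add: lin_uminus)

lemma lin_sum: "lin f (\<Sum>i\<in>A. x i) = (\<Sum>i\<in>A. lin f (x i))"
  by (induction A rule: infinite_finite_induct) (auto simp: lin_add)

lemma lin_gen [simp]: "lin f (gen g) = f g"
  by (simp add: lin_def lookup_gen)

lemma lookup_lin: "lookup (lin f x) t = (\<Sum>g\<in>keys x. lookup x g * lookup (f g) t)"
  by (simp add: lin_def lookup_sum)

lemma lin_lin: "lin f (lin g x) = lin (\<lambda>w. lin f (g w)) x"
  unfolding lin_def[of g] lin_sum lin_scale by (simp add: lin_def)

lemma lin_cong: "(\<And>g. g \<in> keys x \<Longrightarrow> f g = f' g) \<Longrightarrow> lin f x = lin f' x"
  by (simp add: lin_def)

lemma lin_fun_add: "lin (\<lambda>g. f g + f' g) x = lin f x + lin f' x"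
  by (simp add: lin_def scale_add_right sum.distrib)

lemma lin_fun_diff: "lin (\<lambda>g. f g - f' g) x = lin f x - lin f' x"
  by (simp add: lin_def scale_diff_right sum_subtractf)

lemma lin_fun_zero [simp]: "lin (\<lambda>g. 0) x = 0"
  by (simp add: lin_def)

lemma lin_fun_scale: "lin (\<lambda>g. q \<cdot> f g) x = q \<cdot> lin f x"
  by (simp add: lin_def scale_sum_right scale_scale mult.commute)

lemma lin_fun_sum: "lin (\<lambda>g. \<Sum>i\<in>A. f i g) x = (\<Sum>i\<in>A. lin (f i) x)"
  by (induction A rule: infinite_finite_induct) (auto simp: lin_fun_add)

lemma lin_gen_id [simp]: "lin gen x = x"
proof (rule poly_mapping_eqI)
  fix t show "lookup (lin gen x) t = lookup x t"
    by (cases "t \<in> keys x") (auto simp: lookup_lin lookup_gen in_keys_iff if_distrib cong: if_cong)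
qed

lemma relabel_lin: "relabel f = lin (\<lambda>g. gen (f g))"
  by (rule ext) (simp add: relabel_def lin_def)

lemmas lin_simps = lin_add lin_diff lin_uminus lin_scale lin_sum

definition chain :: "nat \<Rightarrow> 'g set \<Rightarrow> ('g \<Rightarrow>\<^sub>0 'k::field qpoly) \<Rightarrow> bool"
  where "chain n S x \<longleftrightarrow> keys x \<subseteq> S \<and> (\<forall>g. over_vars (vars n) (lookup x g))"

lemma chain_0 [simp]: "chain n S 0"
  by (simp add: chain_def)

lemma chain_gen [simp]: "g \<in> S \<Longrightarrow> chain n S (gen g)"
  by (simp add: chain_def lookup_gen)

lemma chain_add [simp]: "chain n S x \<Longrightarrow> chain n S y \<Longrightarrow> chain n S (x + y)"
  unfolding chain_def using keys_add[of x y] by (auto simp: lookup_add)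

lemma chain_uminus [simp]: "chain n S (- x) \<longleftrightarrow> chain n S x"
  by (simp add: chain_def)

lemma chain_diff [simp]: "chain n S x \<Longrightarrow> chain n S y \<Longrightarrow> chain n S (x - y)"
  using chain_add[of n S x "- y"] by simp

lemma chain_scale [simp]: "over_vars (vars n) q \<Longrightarrow> chain n S x \<Longrightarrow> chain n S (q \<cdot> x)"
  unfolding chain_def using keys_scale[of q x] by auto

lemma chain_sum: "(\<And>i. i \<in> A \<Longrightarrow> chain n S (x i)) \<Longrightarrow> chain n S (\<Sum>i\<in>A. x i)"
  by (induction A rule: infinite_finite_induct) auto

lemma chain_lin: "chain n S x \<Longrightarrow> (\<And>g. g \<in> S \<Longrightarrow> chain n T (f g)) \<Longrightarrow> chain n T (lin f x)"
  unfolding lin_def by (rule chain_sum, rule chain_scale) (auto simp: chain_def)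

lemma chain_mono: "chain n S x \<Longrightarrow> S \<subseteq> T \<Longrightarrow> chain n T x"
  by (auto simp: chain_def)

lemma chain_over_vars: "chain n S x \<Longrightarrow> over_vars (vars n) (lookup x g)"
  by (simp add: chain_def)

lemma chain_empty: "chain n {} x \<longleftrightarrow> x = 0"
proof
  assume "chain n {} x"
  then have "lookup x g = 0" for g by (auto simp: chain_def in_keys_iff)
  then show "x = 0" by (intro poly_mapping_eqI) simp
qed simp

lemma chain_of_lookups:
  assumes "finite K" "K \<subseteq> S" "\<And>w. over_vars (vars n) (f w)"
  shows "chain n S (\<Sum>w\<in>K. f w \<cdot> gen w)"
  by (intro chain_sum chain_scale chain_gen) (use assms in auto)

lemma lookup_sum_gen: "finite K \<Longrightarrow> lookup (\<Sum>w\<in>K. f w \<cdot> gen w) g = (if g \<in> K then f g else 0)"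
  by (simp add: lookup_sum lookup_gen if_distrib cong: if_cong)


section \<open>Exactness of the Hilbert-Burch complex\<close>

text \<open>Contracting a relation between the rows with \<open>H\<^sup>k\<close> returns \<open>G t\<^sub>k\<close>, and some \<open>G\<close> is not a
  zero divisor. Hence \<open>\<phi>\<^sub>2 = X\<^sup>T\<close> is injective.\<close>

lemma rows_independent:
  fixes t :: "nat \<Rightarrow> 'k::field qpoly"
  assumes t: "\<And>q. q \<in> col_labels n \<Longrightarrow> (\<Sum>k\<in>row_labels n. xvar k q * t k) = 0" and k: "k \<in> row_labels n"
  shows "t k = 0"
proof -
  let ?H = "\<lambda>q. H n k (n + 1) q :: 'k qpoly"
  have "(\<Sum>q\<in>col_labels n. ?H q * (\<Sum>m\<in>row_labels n. xvar m q * t m))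
      = (\<Sum>m\<in>row_labels n. (\<Sum>q\<in>col_labels n. xvar m q * ?H q) * t m)"
    unfolding sum_distrib_left sum_distrib_right by (subst sum.swap) (simp add: ac_simps)
  also have "\<dots> = (\<Sum>m\<in>row_labels n. if m = k then G n (n + 1) * t m else 0)"
    by (rule sum.cong[OF refl]) (use k in \<open>auto simp: sum_H_row\<close>)
  also have "\<dots> = G n (n + 1) * t k" using k by simp
  finally have "G n (n + 1) * t k = 0" using t by simp
  then show ?thesis by (rule G_last_nonzerodivisor)
qed

text \<open>By \<open>sum_H_column\<close> the vector \<open>H\<^sub>j\<^sub>i + H\<^sub>i\<^sub>j\<close> is in the kernel of \<open>X\<^sup>T\<close>.\<close>

lemma H_antisym:
  assumes "i \<in> col_labels n" "j \<in> col_labels n" "k \<in> row_labels n"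
  shows "H n k j i = - (H n k i j :: 'k::field qpoly)"
proof -
  have "H n k j i + H n k i j = (0 :: 'k qpoly)"
  proof (rule rows_independent[where t = "\<lambda>k. H n k j i + H n k i j", OF _ assms(3)])
    fix q assume q: "q \<in> col_labels n"
    have "(\<Sum>k\<in>row_labels n. xvar k q * (H n k j i + H n k i j))
       = (\<Sum>k\<in>row_labels n. H n k j i * xvar k q) + (\<Sum>k\<in>row_labels n. H n k i j * (xvar k q :: 'k qpoly))"
      by (simp add: distrib_left sum.distrib mult.commute)
    also have "\<dots> = 0"
      unfolding sum_H_column[OF assms(1,2) q] sum_H_column[OF assms(2,1) q] by simp
    finally show "(\<Sum>k\<in>row_labels n. xvar k q * (H n k j i + H n k i j)) = (0 :: 'k qpoly)" .
  qed
  then show ?thesis by (simp add: eq_neg_iff_add_eq_0)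
qed

lemma sum_H_row_antisym:
  assumes "k \<in> row_labels n" "m \<in> row_labels n" "i \<in> col_labels n"
  shows "(\<Sum>j\<in>col_labels n. xvar m j * H n k j i) = (if k = m then - G n i else (0 :: 'k::field qpoly))"
proof -
  have "(\<Sum>j\<in>col_labels n. xvar m j * H n k j i) = - (\<Sum>j\<in>col_labels n. xvar m j * (H n k i j :: 'k qpoly))"
    unfolding sum_negf[symmetric] by (rule sum.cong[OF refl]) (use assms in \<open>simp add: H_antisym[of i n]\<close>)
  then show ?thesis using assms by (simp add: sum_H_row)
qed

text \<open>Contracting with the \<open>H\<close>'s expresses \<open>G\<^sub>i y\<close> as a combination of the rows for every \<open>i\<close>. The
  combinations for \<open>G\<^sub>1\<close> and \<open>G\<^sub>n\<^sub>+\<^sub>1\<close> are proportional, so regularity allows the division.\<close>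

lemma Hilbert_Burch_exact:
  fixes y :: "nat \<Rightarrow> 'k::field qpoly"
  assumes y: "\<And>i. i \<in> col_labels n \<Longrightarrow> over_vars (vars n) (y i)"
    and eq: "(\<Sum>i\<in>col_labels n. G n i * y i) = 0"
  shows "\<exists>t. (\<forall>k. over_vars (vars n) (t k)) \<and>
    (\<forall>q\<in>col_labels n. y q = (\<Sum>k\<in>row_labels n. xvar k q * t k))"
proof -
  define c where "c i k = (\<Sum>j\<in>col_labels n. y j * H n k i j)" for i k
  have one: "1 \<in> col_labels n" "n + 1 \<in> col_labels n" by (simp_all add: col_labels_def)
  have c: "(\<Sum>k\<in>row_labels n. xvar k q * c i k) = G n i * y q"
    if i: "i \<in> col_labels n" and q: "q \<in> col_labels n" for i q
  proof -
    have "(\<Sum>k\<in>row_labels n. xvar k q * c i k)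
        = (\<Sum>j\<in>col_labels n. y j * (\<Sum>k\<in>row_labels n. H n k i j * xvar k q))"
      unfolding c_def sum_distrib_left by (subst sum.swap) (simp add: ac_simps)
    also have "\<dots> = (\<Sum>j\<in>col_labels n. (if j = q then y j * G n i else 0) - (if i = q then y j * G n j else 0))"
      by (rule sum.cong[OF refl]) (simp add: sum_H_column[OF i _ q] right_diff_distrib)
    also have "\<dots> = y q * G n i" using q eq by (cases "i = q") (simp_all add: sum_subtractf mult.commute)
    finally show ?thesis by (simp add: mult.commute)
  qed
  have proportional: "G n (n + 1) * c 1 k = G n 1 * c (n + 1) k" if k: "k \<in> row_labels n" for k
  proof -
    have "G n (n + 1) * c 1 k - G n 1 * c (n + 1) k = 0"
    proof (rule rows_independent[where t = "\<lambda>k. G n (n + 1) * c 1 k - G n 1 * c (n + 1) k", OF _ k])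
      fix q assume q: "q \<in> col_labels n"
      have "(\<Sum>k\<in>row_labels n. xvar k q * (G n (n + 1) * c 1 k - G n 1 * c (n + 1) k))
        = G n (n + 1) * (\<Sum>k\<in>row_labels n. xvar k q * c 1 k)
          - G n 1 * (\<Sum>k\<in>row_labels n. xvar k q * c (n + 1) k)"
        by (simp add: sum_distrib_left right_diff_distrib sum_subtractf ac_simps)
      also have "\<dots> = 0" unfolding c[OF one(1) q] c[OF one(2) q] by (simp add: ac_simps)
      finally show "(\<Sum>k\<in>row_labels n. xvar k q * (G n (n + 1) * c 1 k - G n 1 * c (n + 1) k)) = 0" .
    qed
    then show ?thesis by simp
  qed
  have "over_vars (vars n) (c i k)" for i k
    unfolding c_def by (intro over_vars_sum over_vars_mult y over_vars_H)
  then have "\<forall>k. \<exists>h. k \<in> row_labels n \<longrightarrow> over_vars (vars n) h \<and> c (n + 1) k = G n (n + 1) * h"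
    using G_regular_sequence[OF proportional] by blast
  then obtain h where h: "\<And>k. k \<in> row_labels n \<Longrightarrow> over_vars (vars n) (h k) \<and> c (n + 1) k = G n (n + 1) * h k"
    by metis
  define t where "t k = (if k \<in> row_labels n then h k else 0)" for k
  have "y q = (\<Sum>k\<in>row_labels n. xvar k q * t k)" if q: "q \<in> col_labels n" for q
  proof -
    have "G n (n + 1) * (\<Sum>k\<in>row_labels n. xvar k q * t k) = (\<Sum>k\<in>row_labels n. xvar k q * c (n + 1) k)"
      unfolding sum_distrib_left by (rule sum.cong[OF refl]) (use h in \<open>simp add: t_def ac_simps\<close>)
    then have "G n (n + 1) * (y q - (\<Sum>k\<in>row_labels n. xvar k q * t k)) = 0"
      unfolding c[OF one(2) q] by (simp add: right_diff_distrib)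
    from G_last_nonzerodivisor[OF this] show ?thesis by simp
  qed
  moreover have "over_vars (vars n) (t k)" for k using h by (simp add: t_def)
  ultimately show ?thesis by blast
qed

lemma rows_independent_chain:
  fixes t :: "nat \<Rightarrow> 'g \<Rightarrow>\<^sub>0 'k::field qpoly"
  assumes t: "\<And>q. q \<in> col_labels n \<Longrightarrow> (\<Sum>k\<in>row_labels n. xvar k q \<cdot> t k) = 0" and k: "k \<in> row_labels n"
  shows "t k = 0"
proof (rule poly_mapping_eqI)
  fix g
  have "lookup (t k) g = 0"
  proof (rule rows_independent[where t = "\<lambda>k. lookup (t k) g", OF _ k])
    fix q assume "q \<in> col_labels n"
    from arg_cong[OF t[OF this], of "\<lambda>x. lookup x g"]
    show "(\<Sum>k\<in>row_labels n. xvar k q * lookup (t k) g) = 0" by (simp add: lookup_sum)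
  qed
  then show "lookup (t k) g = lookup 0 g" by simp
qed

lemma Hilbert_Burch_exact_chain:
  fixes y :: "nat \<Rightarrow> 'g \<Rightarrow>\<^sub>0 'k::field qpoly"
  assumes y: "\<And>i. i \<in> col_labels n \<Longrightarrow> chain n S (y i)"
    and eq: "(\<Sum>i\<in>col_labels n. G n i \<cdot> y i) = 0"
  shows "\<exists>t. (\<forall>k. chain n S (t k)) \<and>
    (\<forall>q\<in>col_labels n. y q = (\<Sum>k\<in>row_labels n. xvar k q \<cdot> t k))"
proof -
  define K where "K = (\<Union>i\<in>col_labels n. keys (y i))"
  have K: "finite K" "K \<subseteq> S" using y by (auto simp: K_def chain_def)
  have "\<exists>t. (\<forall>k. over_vars (vars n) (t k)) \<and>
    (\<forall>q\<in>col_labels n. lookup (y q) g = (\<Sum>k\<in>row_labels n. xvar k q * t k))" for g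
  proof (rule Hilbert_Burch_exact)
    show "over_vars (vars n) (lookup (y i) g)" if "i \<in> col_labels n" for i
      using y[OF that] by (rule chain_over_vars)
    show "(\<Sum>i\<in>col_labels n. G n i * lookup (y i) g) = 0"
      using arg_cong[OF eq, of "\<lambda>x. lookup x g"] by (simp add: lookup_sum)
  qed
  then obtain t where t: "\<And>g k. over_vars (vars n) (t g k)"
    "\<And>g q. q \<in> col_labels n \<Longrightarrow> lookup (y q) g = (\<Sum>k\<in>row_labels n. xvar k q * t g k)"
    by metis
  define s where "s k = (\<Sum>g\<in>K. t g k \<cdot> gen g)" for k
  have "chain n S (s k)" for k unfolding s_def by (rule chain_of_lookups[OF K t(1)])
  moreover have s: "lookup (s k) g = (if g \<in> K then t g k else 0)" for k g
    unfolding s_def by (rule lookup_sum_gen[OF K(1)])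
  have "y q = (\<Sum>k\<in>row_labels n. xvar k q \<cdot> s k)" if q: "q \<in> col_labels n" for q
  proof (rule poly_mapping_eqI)
    fix g
    show "lookup (y q) g = lookup (\<Sum>k\<in>row_labels n. xvar k q \<cdot> s k) g"
    proof (cases "g \<in> K")
      case True
      then show ?thesis by (simp add: lookup_sum s t(2)[OF q])
    next
      case False
      then have "lookup (y q) g = 0" using q by (auto simp: K_def in_keys_iff)
      with False show ?thesis by (simp add: lookup_sum s)
    qed
  qed
  ultimately show ?thesis by blast
qed


section \<open>The module \<open>\<U>\<close>\<close>

lemma U_basis_0: "U_basis n 0 = aU ` col_labels n"
  by (auto simp: U_basis_def col_labels_def)

lemma U_basis_1: "U_basis n 1 = bU ` vars n"
  by (auto simp: U_basis_def)

lemma U_basis_2: "U_basis n 2 = cU ` (row_labels n \<times> row_labels n - {(1, 1)})"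
  by (auto simp: U_basis_def row_labels_def)

lemma U_basis_ge_3: "3 \<le> d \<Longrightarrow> U_basis n d = {}"
  by (auto simp: U_basis_def)

lemma A_basis_1: "A_basis n 1 = eA ` col_labels n"
  by (auto simp: A_basis_def col_labels_def)

lemma A_basis_2: "A_basis n 2 = TA ` row_labels n"
  by (auto simp: A_basis_def row_labels_def)

definition U_gens :: "nat \<Rightarrow> U_gen set"
  where "U_gens n = U_basis n 0 \<union> U_basis n 1 \<union> U_basis n 2"

definition A_gens :: "nat \<Rightarrow> A_gen set"
  where "A_gens n = A_basis n 1 \<union> A_basis n 2"

lemma eA_in_A_gens [simp]: "eA i \<in> A_gens n \<longleftrightarrow> i \<in> col_labels n"
  by (auto simp: A_gens_def A_basis_1 A_basis_2 simp del: One_nat_def)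

lemma TA_in_A_gens [simp]: "TA i \<in> A_gens n \<longleftrightarrow> i \<in> row_labels n"
  by (auto simp: A_gens_def A_basis_1 A_basis_2 simp del: One_nat_def)

lemma U_gens_cases [consumes 1, case_names a b c]:
  assumes "g \<in> U_gens n"
  obtains (a) j where "g = aU j" "j \<in> col_labels n"
    | (b) k l where "g = bU (k, l)" "k \<in> row_labels n" "l \<in> col_labels n"
    | (c) i j where "g = cU (i, j)" "(i, j) \<noteq> (1, 1)" "i \<in> row_labels n" "j \<in> row_labels n"
  using assms unfolding U_gens_def U_basis_0 U_basis_1 U_basis_2 vars_eq by blast

abbreviation dU :: "nat \<Rightarrow> 'k::field U_chain \<Rightarrow> 'k U_chain"
  where "dU n \<equiv> lin (U_diff n)"

abbreviation act_lin :: "nat \<Rightarrow> A_gen \<Rightarrow> 'k::field U_chain \<Rightarrow> 'k U_chain"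
  where "act_lin n g \<equiv> lin (act n g)"

text \<open>The Euler vector field of the first row, which every diagonal \<open>c\<^sub>i\<^sub>i\<close> is corrected by.\<close>

definition rho :: "nat \<Rightarrow> 'k::field U_chain"
  where "rho n = (\<Sum>l\<in>col_labels n. xvar 1 l \<cdot> gen (bU (1, l)))"

lemma sum_scale_swap:
  "(\<Sum>l\<in>A. x l \<cdot> (\<Sum>q\<in>B. h l q \<cdot> e q)) = (\<Sum>q\<in>B. (\<Sum>l\<in>A. x l * h l q) \<cdot> e q)"
  unfolding scale_sum_right scale_sum_left scale_scale by (rule sum.swap)

lemma scale_if_zero: "(if b then q else 0) \<cdot> x = (if b then q \<cdot> x else 0)"
  by simp

lemma sum_delta_scale:
  "finite A \<Longrightarrow> a \<in> A \<Longrightarrow> (\<Sum>q\<in>A. (if q = a then f q else 0) \<cdot> e q) = f a \<cdot> e a"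
  by (simp add: scale_if_zero)

lemma sum_delta_scale':
  "finite A \<Longrightarrow> a \<in> A \<Longrightarrow> (\<Sum>q\<in>A. (if a = q then f q else 0) \<cdot> e q) = f a \<cdot> e a"
  by (simp add: scale_if_zero)

lemma partial_sign_mult: "partial v ((-1) ^ m * p) = (-1) ^ m * partial v p"
  by (cases "even m") (simp_all add: partial_uminus)

lemma partial_Fmin:
  assumes "k \<in> row_labels n" "j \<in> col_labels n" "q \<in> col_labels n"
  shows "partial (k, j) (Fmin n q) = (-1) ^ (q + 1) * (H n k q j :: 'k::field qpoly)"
  unfolding Fmin_G[OF assms(3)] partial_sign_mult partial_G[OF assms(1,2)] ..

lemma sign_square: "(-1) ^ i * ((-1) ^ i * p) = (p :: 'k::field qpoly)"
  by (cases "even i") simp_all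

lemma U_diff_b:
  assumes "k \<in> row_labels n" "j \<in> col_labels n"
  shows "U_diff n (bU (k, j)) = (\<Sum>q\<in>col_labels n. ((-1) ^ (q + 1) * H n k q j) \<cdot> gen (aU q))"
  unfolding U_diff.simps col_labels_def[symmetric]
  by (rule sum.cong[OF refl]) (simp only: partial_Fmin[OF assms])

lemma dU_c:
  "dU n (c_elem i j) = (\<Sum>l\<in>col_labels n. xvar i l \<cdot> gen (bU (j, l))) - (if i = j then rho n else 0)"
  unfolding c_elem_def rho_def col_labels_def by simp

text \<open>The two cases of the definition merge into one formula: for \<open>i = j\<close> the summands \<open>x\<^sub>1\<^sub>i b\<^sub>1\<^sub>i\<close>
  that are left out on both sides cancel.\<close>

lemma act_ea:
  assumes "i \<in> col_labels n" "j \<in> col_labels n" "1 \<le> n"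
  shows "act n (eA i) (aU j) = (-1) ^ j \<cdot>
    ((\<Sum>k\<in>row_labels n. xvar k j \<cdot> gen (bU (k, i))) - (if i = j then rho n else 0))"
proof (cases "i = j")
  case False
  then show ?thesis by (simp add: row_labels_def)
next
  case True
  have 1: "1 \<in> row_labels n" using assms by (simp add: row_labels_def)
  have "act n (eA i) (aU j) = (-1) ^ (i + 1) \<cdot>
       ((\<Sum>k\<in>col_labels n - {i}. xvar 1 k \<cdot> gen (bU (1, k))) -
        (\<Sum>l\<in>row_labels n - {1}. xvar l i \<cdot> gen (bU (l, i))))"
    using True by (simp add: row_labels_def col_labels_def)
  also have "\<dots> = (-1) ^ (i + 1) \<cdot> (rho n - (\<Sum>l\<in>row_labels n. xvar l i \<cdot> gen (bU (l, i))))"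
    using assms(1) 1 by (simp add: sum_diff1 rho_def)
  also have "\<dots> = (-1) ^ i \<cdot> ((\<Sum>l\<in>row_labels n. xvar l i \<cdot> gen (bU (l, i))) - rho n)"
    by (simp add: scale_diff_right)
  finally show ?thesis using True by simp
qed

lemma act_eb:
  assumes "i \<in> col_labels n" "l \<in> col_labels n"
  shows "act n (eA i) (bU (j, l)) = (\<Sum>m\<in>row_labels n. H n m i l \<cdot> c_elem m j)"
proof -
  have "act n (eA i) (bU (j, l)) =
      (\<Sum>m\<in>row_labels n. ((-1) ^ (i + 1) * partial (m, l) (Fmin n i)) \<cdot> c_elem m j)"
    unfolding act.simps row_labels_def[symmetric] scale_sum_right scale_scale ..
  also have "\<dots> = (\<Sum>m\<in>row_labels n. H n m i l \<cdot> c_elem m j)"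
    by (rule sum.cong[OF refl]) (simp only: partial_Fmin[OF _ assms(2,1)] sign_square)
  finally show ?thesis .
qed

lemma act_Ta:
  "act n (TA i) (aU j) = (-1) ^ j \<cdot> (\<Sum>k\<in>row_labels n. xvar k j \<cdot> c_elem i k)"
  by (simp add: row_labels_def)

lemma act_lin_c [simp]: "act_lin n g (c_elem i j) = 0"
  by (cases g) (auto simp: c_elem_def)

lemma dU_rho:
  assumes "1 \<le> n"
  shows "dU n (rho n) = (\<Sum>q\<in>col_labels n. ((-1) ^ (q + 1) * G n q) \<cdot> gen (aU q) :: 'k::field U_chain)"
proof -
  have 1: "1 \<in> row_labels n" using assms by (simp add: row_labels_def)
  have "dU n (rho n) = (\<Sum>l\<in>col_labels n. xvar 1 l \<cdot>
      (\<Sum>q\<in>col_labels n. ((-1) ^ (q + 1) * H n 1 q l) \<cdot> (gen (aU q) :: 'k U_chain)))"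
    unfolding rho_def lin_simps lin_gen by (rule sum.cong[OF refl]) (simp only: U_diff_b[OF 1])
  also have "\<dots> = (\<Sum>q\<in>col_labels n. ((-1) ^ (q + 1) * (\<Sum>l\<in>col_labels n. xvar 1 l * H n 1 q l)) \<cdot> gen (aU q))"
    unfolding sum_scale_swap sum_distrib_left by (simp only: mult.left_commute)
  finally show ?thesis unfolding sum_H_row[OF 1 1] by simp
qed

lemma dU_dU_c:
  assumes "i \<in> row_labels n" "j \<in> row_labels n"
  shows "dU n (dU n (c_elem i j)) = (0 :: 'k::field U_chain)"
proof -
  have n: "1 \<le> n" using assms by (auto simp: row_labels_def)
  have "dU n (\<Sum>l\<in>col_labels n. xvar i l \<cdot> gen (bU (j, l))) = (\<Sum>l\<in>col_labels n. xvar i l \<cdot>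
      (\<Sum>q\<in>col_labels n. ((-1) ^ (q + 1) * H n j q l) \<cdot> (gen (aU q) :: 'k U_chain)))"
    unfolding lin_simps lin_gen by (rule sum.cong[OF refl]) (simp only: U_diff_b[OF assms(2)])
  also have "\<dots> = (\<Sum>q\<in>col_labels n. ((-1) ^ (q + 1) * (\<Sum>l\<in>col_labels n. xvar i l * H n j q l)) \<cdot> gen (aU q))"
    unfolding sum_scale_swap sum_distrib_left by (simp only: mult.left_commute)
  also have "\<dots> = (if i = j then dU n (rho n) else 0)"
    unfolding sum_H_row[OF assms(2,1)] dU_rho[OF n] by simp
  finally show ?thesis unfolding dU_c lin_diff by simp
qed

lemma e_leibniz_a:
  assumes i: "i \<in> col_labels n" and j: "j \<in> col_labels n" and n: "1 \<le> n"
  shows "dU n (act n (eA i) (aU j)) = (G n i \<cdot> gen (aU j) :: 'k::field U_chain)"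
proof -
  let ?a = "\<lambda>q. gen (aU q) :: 'k U_chain"
  have "dU n (\<Sum>k\<in>row_labels n. xvar k j \<cdot> gen (bU (k, i)))
      = (\<Sum>k\<in>row_labels n. xvar k j \<cdot> (\<Sum>q\<in>col_labels n. ((-1) ^ (q + 1) * H n k q i) \<cdot> ?a q))"
    unfolding lin_simps lin_gen by (rule sum.cong[OF refl]) (simp only: U_diff_b[OF _ i])
  also have "\<dots> = (\<Sum>q\<in>col_labels n. ((-1) ^ (q + 1) * (\<Sum>k\<in>row_labels n. H n k q i * xvar k j)) \<cdot> ?a q)"
    unfolding sum_scale_swap sum_distrib_left by (simp only: ac_simps)
  also have "\<dots> = (\<Sum>q\<in>col_labels n. ((-1) ^ (q + 1) * (if i = j then G n q else 0)) \<cdot> ?a q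
      - (if q = j then (-1) ^ (q + 1) * G n i else 0) \<cdot> ?a q)"
    by (rule sum.cong[OF refl]) (simp add: sum_H_column[OF _ i j] right_diff_distrib scale_diff_left)
  also have "\<dots> = (if i = j then dU n (rho n) else 0) + (-1) ^ j \<cdot> G n i \<cdot> ?a j"
    unfolding sum_subtractf sum_delta_scale[OF finite_col_labels j] dU_rho[OF n]
    by (simp add: scale_scale)
  finally have "dU n (act n (eA i) (aU j)) = (-1) ^ j \<cdot> (-1) ^ j \<cdot> G n i \<cdot> ?a j"
    unfolding act_ea[OF i j n] lin_scale lin_diff by simp
  then show ?thesis unfolding scale_scale sign_square .
qed

lemma e_leibniz_b:
  assumes i: "i \<in> col_labels n" and k: "k \<in> row_labels n" and l: "l \<in> col_labels n"
  shows "dU n (act n (eA i) (bU (k, l))) + act_lin n (eA i) (U_diff n (bU (k, l)))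
    = (G n i \<cdot> gen (bU (k, l)) :: 'k::field U_chain)"
proof -
  have n: "1 \<le> n" using k by (auto simp: row_labels_def)
  let ?b = "\<lambda>k q. gen (bU (k, q)) :: 'k U_chain"
  have "dU n (act n (eA i) (bU (k, l)))
      = (\<Sum>m\<in>row_labels n. H n m i l \<cdot> (\<Sum>q\<in>col_labels n. xvar m q \<cdot> ?b k q))
        - (\<Sum>m\<in>row_labels n. (if m = k then H n m i l else 0) \<cdot> rho n)"
    unfolding act_eb[OF i l] lin_simps dU_c sum_subtractf[symmetric]
    by (rule sum.cong[OF refl]) (simp add: scale_diff_right)
  also have "(\<Sum>m\<in>row_labels n. (if m = k then H n m i l else 0) \<cdot> rho n) = (H n k i l \<cdot> rho n :: 'k U_chain)"
    by (rule sum_delta_scale[OF finite_row_labels k])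
  also have "(\<Sum>m\<in>row_labels n. H n m i l \<cdot> (\<Sum>q\<in>col_labels n. xvar m q \<cdot> ?b k q))
      = (\<Sum>q\<in>col_labels n. (if q = l then G n i else 0) \<cdot> ?b k q - (if q = i then G n l else 0) \<cdot> ?b k q)"
    unfolding sum_scale_swap
    by (rule sum.cong[OF refl]) (simp add: sum_H_column[OF i l] scale_diff_left eq_commute)
  also have "\<dots> = G n i \<cdot> ?b k l - G n l \<cdot> ?b k i"
    unfolding sum_subtractf sum_delta_scale[OF finite_col_labels l] sum_delta_scale[OF finite_col_labels i] ..
  finally have 1: "dU n (act n (eA i) (bU (k, l))) = G n i \<cdot> ?b k l - G n l \<cdot> ?b k i - H n k i l \<cdot> rho n" .
  have "act_lin n (eA i) (U_diff n (bU (k, l)))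
      = (\<Sum>q\<in>col_labels n. ((-1) ^ (q + 1) * H n k q l) \<cdot> act n (eA i) (aU q))"
    unfolding U_diff_b[OF k l] lin_simps lin_gen ..
  also have "\<dots> = (\<Sum>q\<in>col_labels n. (- H n k q l) \<cdot> (\<Sum>m\<in>row_labels n. xvar m q \<cdot> ?b m i)
        + (if q = i then H n k q l else 0) \<cdot> rho n)"
  proof (rule sum.cong[OF refl])
    fix q assume q: "q \<in> col_labels n"
    have "((-1) ^ (q + 1) * H n k q l) \<cdot> act n (eA i) (aU q)
        = (- ((-1) ^ q * ((-1) ^ q * H n k q l))) \<cdot>
          ((\<Sum>m\<in>row_labels n. xvar m q \<cdot> ?b m i) - (if i = q then rho n else 0))"
      unfolding act_ea[OF i q n] scale_scale by (simp add: ac_simps)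
    then show "((-1) ^ (q + 1) * H n k q l) \<cdot> act n (eA i) (aU q)
        = (- H n k q l) \<cdot> (\<Sum>m\<in>row_labels n. xvar m q \<cdot> ?b m i) + (if q = i then H n k q l else 0) \<cdot> rho n"
      unfolding sign_square by (simp add: scale_diff_right)
  qed
  also have "\<dots> = (\<Sum>m\<in>row_labels n. (\<Sum>q\<in>col_labels n. - H n k q l * xvar m q) \<cdot> ?b m i) + H n k i l \<cdot> rho n"
    unfolding sum.distrib sum_scale_swap sum_delta_scale[OF finite_col_labels i] ..
  also have "(\<Sum>m\<in>row_labels n. (\<Sum>q\<in>col_labels n. - H n k q l * xvar m q) \<cdot> ?b m i)
      = (\<Sum>m\<in>row_labels n. (if k = m then G n l else 0) \<cdot> ?b m i)"
  proof (rule sum.cong[OF refl])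
    fix m assume m: "m \<in> row_labels n"
    have "(\<Sum>q\<in>col_labels n. - H n k q l * xvar m q) = - (\<Sum>q\<in>col_labels n. xvar m q * (H n k q l :: 'k qpoly))"
      by (simp add: sum_negf mult.commute)
    then show "(\<Sum>q\<in>col_labels n. - H n k q l * xvar m q) \<cdot> ?b m i = (if k = m then G n l else 0) \<cdot> ?b m i"
      unfolding sum_H_row_antisym[OF k m l] by simp
  qed
  also have "\<dots> = G n l \<cdot> ?b k i" by (rule sum_delta_scale'[OF finite_row_labels k])
  finally show ?thesis unfolding 1 by simp
qed

text \<open>The contraction that makes \<open>e\<^sub>i\<close> a homotopy on \<open>\<U>\<^sub>2\<close>. For \<open>m = k = 1\<close> it gives
  \<open>e\<^sub>i \<rho> = G\<^sub>i c\<^sub>1\<^sub>1 = 0\<close>.\<close>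

lemma act_e_row:
  assumes "i \<in> col_labels n" "m \<in> row_labels n"
  shows "act_lin n (eA i) (\<Sum>l\<in>col_labels n. xvar m l \<cdot> gen (bU (k, l))) = (G n i \<cdot> c_elem m k :: 'k::field U_chain)"
proof -
  have "act_lin n (eA i) (\<Sum>l\<in>col_labels n. xvar m l \<cdot> gen (bU (k, l)))
      = (\<Sum>l\<in>col_labels n. xvar m l \<cdot> (\<Sum>p\<in>row_labels n. H n p i l \<cdot> (c_elem p k :: 'k U_chain)))"
    unfolding lin_simps lin_gen by (rule sum.cong[OF refl]) (simp only: act_eb[OF assms(1)])
  also have "\<dots> = (\<Sum>p\<in>row_labels n. (if p = m then G n i else 0) \<cdot> c_elem p k)"
    unfolding sum_scale_swap by (rule sum.cong[OF refl]) (simp only: sum_H_row[OF _ assms(2)])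
  finally show ?thesis unfolding sum_delta_scale[OF finite_row_labels assms(2)] .
qed

lemma act_e_rho:
  assumes "i \<in> col_labels n" "1 \<le> n" shows "act_lin n (eA i) (rho n) = (0 :: 'k::field U_chain)"
  unfolding rho_def by (subst act_e_row) (use assms in \<open>auto simp: row_labels_def c_elem_def\<close>)

lemma e_leibniz_c:
  assumes "i \<in> col_labels n" "m \<in> row_labels n"
  shows "act_lin n (eA i) (dU n (c_elem m k)) = (G n i \<cdot> c_elem m k :: 'k::field U_chain)"
proof -
  have n: "1 \<le> n" using assms by (auto simp: row_labels_def)
  show ?thesis
    unfolding dU_c lin_diff act_e_row[OF assms] using act_e_rho[OF assms(1) n, where ?'k = 'k] by simp
qed

lemma T_leibniz_a:
  assumes i: "i \<in> row_labels n" and j: "j \<in> col_labels n"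
  shows "(\<Sum>l\<in>col_labels n. xvar i l \<cdot> act n (eA l) (aU j)) = (dU n (act n (TA i) (aU j)) :: 'k::field U_chain)"
proof -
  have n: "1 \<le> n" using i by (auto simp: row_labels_def)
  let ?b = "\<lambda>k q. gen (bU (k, q)) :: 'k U_chain"
  let ?S = "\<Sum>l\<in>col_labels n. \<Sum>k\<in>row_labels n. (xvar i l * xvar k j) \<cdot> ?b k l"
  have "(\<Sum>l\<in>col_labels n. xvar i l \<cdot> act n (eA l) (aU j))
      = (\<Sum>l\<in>col_labels n. (-1) ^ j \<cdot> ((\<Sum>k\<in>row_labels n. (xvar i l * xvar k j) \<cdot> ?b k l)
          - (if l = j then xvar i l else 0) \<cdot> rho n))"
  proof (rule sum.cong[OF refl])
    fix l assume l: "l \<in> col_labels n"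
    have "xvar i l \<cdot> act n (eA l) (aU j) = (-1) ^ j \<cdot> xvar i l \<cdot>
        ((\<Sum>k\<in>row_labels n. xvar k j \<cdot> ?b k l) - (if l = j then rho n else 0))"
      unfolding act_ea[OF l j n] scale_scale by (simp add: mult.commute)
    also have "xvar i l \<cdot> ((\<Sum>k\<in>row_labels n. xvar k j \<cdot> ?b k l) - (if l = j then rho n else 0))
        = (\<Sum>k\<in>row_labels n. (xvar i l * xvar k j) \<cdot> ?b k l) - (if l = j then xvar i l else 0) \<cdot> rho n"
      by (simp add: scale_diff_right scale_sum_right scale_scale)
    finally show "xvar i l \<cdot> act n (eA l) (aU j) = (-1) ^ j \<cdot>
        ((\<Sum>k\<in>row_labels n. (xvar i l * xvar k j) \<cdot> ?b k l) - (if l = j then xvar i l else 0) \<cdot> rho n)" .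
  qed
  also have "\<dots> = (-1) ^ j \<cdot> (?S - xvar i j \<cdot> rho n)"
    unfolding scale_sum_right[symmetric] sum_subtractf sum_delta_scale[OF finite_col_labels j] ..
  finally have 1: "(\<Sum>l\<in>col_labels n. xvar i l \<cdot> act n (eA l) (aU j)) = (-1) ^ j \<cdot> (?S - xvar i j \<cdot> rho n)" .
  have "dU n (\<Sum>k\<in>row_labels n. xvar k j \<cdot> c_elem i k)
      = (\<Sum>k\<in>row_labels n. (\<Sum>l\<in>col_labels n. (xvar i l * xvar k j) \<cdot> ?b k l) - (if k = i then xvar k j else 0) \<cdot> rho n)"
    unfolding lin_simps dU_c
    by (rule sum.cong[OF refl]) (simp add: scale_diff_right scale_sum_right scale_scale mult.commute)
  also have "\<dots> = ?S - xvar i j \<cdot> rho n"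
    unfolding sum_subtractf sum_delta_scale[OF finite_row_labels i] by (subst sum.swap) (rule refl)
  finally show ?thesis unfolding 1 act_Ta lin_scale by simp
qed

lemma T_leibniz_b:
  assumes i: "i \<in> row_labels n" and k: "k \<in> row_labels n" and l: "l \<in> col_labels n"
  shows "(\<Sum>q\<in>col_labels n. xvar i q \<cdot> act n (eA q) (bU (k, l)))
    + act_lin n (TA i) (U_diff n (bU (k, l))) = (0 :: 'k::field U_chain)"
proof -
  have "(\<Sum>q\<in>col_labels n. xvar i q \<cdot> act n (eA q) (bU (k, l)))
      = (\<Sum>q\<in>col_labels n. xvar i q \<cdot> (\<Sum>m\<in>row_labels n. H n m q l \<cdot> (c_elem m k :: 'k U_chain)))"
    by (rule sum.cong[OF refl]) (simp only: act_eb[OF _ l])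
  also have "\<dots> = (\<Sum>m\<in>row_labels n. (if m = i then - G n l else 0) \<cdot> c_elem m k)"
    unfolding sum_scale_swap by (rule sum.cong[OF refl]) (simp only: sum_H_row_antisym[OF _ i l])
  also have "\<dots> = - (G n l \<cdot> c_elem i k)" unfolding sum_delta_scale[OF finite_row_labels i] by simp
  finally have 1: "(\<Sum>q\<in>col_labels n. xvar i q \<cdot> act n (eA q) (bU (k, l))) = - (G n l \<cdot> (c_elem i k :: 'k U_chain))" .
  have "act_lin n (TA i) (U_diff n (bU (k, l)))
      = (\<Sum>q\<in>col_labels n. (- ((-1) ^ q * ((-1) ^ q * H n k q l))) \<cdot> (\<Sum>m\<in>row_labels n. xvar m q \<cdot> (c_elem i m :: 'k U_chain)))"
    unfolding U_diff_b[OF k l] lin_simps lin_gen act_Ta scale_scale by (simp add: ac_simps)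
  also have "\<dots> = (\<Sum>m\<in>row_labels n. (if k = m then G n l else 0) \<cdot> c_elem i m)"
    unfolding sign_square sum_scale_swap
  proof (rule sum.cong[OF refl])
    fix m assume m: "m \<in> row_labels n"
    have "(\<Sum>q\<in>col_labels n. - H n k q l * xvar m q) = - (\<Sum>q\<in>col_labels n. xvar m q * (H n k q l :: 'k qpoly))"
      by (simp add: sum_negf mult.commute)
    then show "(\<Sum>q\<in>col_labels n. - H n k q l * xvar m q) \<cdot> c_elem i m = (if k = m then G n l else 0) \<cdot> (c_elem i m :: 'k U_chain)"
      unfolding sum_H_row_antisym[OF k m l] by simp
  qed
  also have "\<dots> = G n l \<cdot> c_elem i k" by (rule sum_delta_scale'[OF finite_row_labels k])
  finally show ?thesis unfolding 1 by simp
qed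

lemma e_assoc_a:
  assumes i: "i \<in> col_labels n" and j: "j \<in> col_labels n" and k: "k \<in> col_labels n" and n: "1 \<le> n"
  shows "act_lin n (eA i) (act n (eA j) (aU k))
    = (\<Sum>m\<in>row_labels n. H n m i j \<cdot> act n (TA m) (aU k) :: 'k::field U_chain)"
proof -
  have "act_lin n (eA i) (act n (eA j) (aU k))
      = (-1) ^ k \<cdot> (\<Sum>p\<in>row_labels n. xvar p k \<cdot> (\<Sum>m\<in>row_labels n. H n m i j \<cdot> (c_elem m p :: 'k U_chain)))"
    unfolding act_ea[OF j k n] lin_simps lin_gen act_eb[OF i j] using act_e_rho[OF i n, where ?'k = 'k] by simp
  also have "\<dots> = (\<Sum>p\<in>row_labels n. \<Sum>m\<in>row_labels n. ((-1) ^ k * xvar p k * H n m i j) \<cdot> c_elem m p)"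
    by (simp add: scale_sum_right scale_scale mult.assoc)
  also have "\<dots> = (\<Sum>m\<in>row_labels n. \<Sum>p\<in>row_labels n. ((-1) ^ k * xvar p k * H n m i j) \<cdot> c_elem m p)"
    by (rule sum.swap)
  also have "\<dots> = (\<Sum>m\<in>row_labels n. H n m i j \<cdot> act n (TA m) (aU k))"
    unfolding act_Ta scale_sum_right scale_scale by (simp only: ac_simps)
  finally show ?thesis .
qed

lemma gen_c: "(i, j) \<noteq> (1, 1) \<Longrightarrow> gen (cU (i, j)) = c_elem i j"
  unfolding c_elem_def by (simp only: if_False)

lemma U_diff_c: "(i, j) \<noteq> (1, 1) \<Longrightarrow> U_diff n (cU (i, j)) = dU n (c_elem i j)"
  unfolding c_elem_def by (simp only: if_False lin_gen)

text \<open>The axioms of a dg module over \<open>\<A>\<close>, where \<open>\<partial> e\<^sub>i = G\<^sub>i\<close>.\<close>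

lemma U_diff_square:
  assumes "g \<in> U_gens n" shows "dU n (U_diff n g) = (0 :: 'k::field U_chain)"
  using assms
proof (cases rule: U_gens_cases)
  case (b k l)
  show ?thesis unfolding b(1) U_diff_b[OF b(2,3)] lin_simps lin_gen by simp
next
  case (c i j)
  show ?thesis unfolding c(1) U_diff_c[OF c(2)] by (rule dU_dU_c[OF c(3,4)])
qed simp

lemma e_leibniz:
  assumes "g \<in> U_gens n" "i \<in> col_labels n" "1 \<le> n"
  shows "dU n (act n (eA i) g) + act_lin n (eA i) (U_diff n g) = (G n i \<cdot> gen g :: 'k::field U_chain)"
  using assms(1)
proof (cases rule: U_gens_cases)
  case (a j)
  show ?thesis unfolding a(1) e_leibniz_a[OF assms(2) a(2) assms(3)] by simp
next
  case (b k l)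
  show ?thesis unfolding b(1) by (rule e_leibniz_b[OF assms(2) b(2,3)])
next
  case (c m k)
  show ?thesis unfolding c(1) U_diff_c[OF c(2)] e_leibniz_c[OF assms(2) c(3)] gen_c[OF c(2)] by simp
qed

lemma T_leibniz:
  assumes "g \<in> U_gens n" "i \<in> row_labels n"
  shows "(\<Sum>l\<in>col_labels n. xvar i l \<cdot> act n (eA l) g) - dU n (act n (TA i) g) + act_lin n (TA i) (U_diff n g)
    = (0 :: 'k::field U_chain)"
  using assms(1)
proof (cases rule: U_gens_cases)
  case (a j)
  show ?thesis unfolding a(1) T_leibniz_a[OF assms(2) a(2)] by simp
next
  case (b k l)
  show ?thesis unfolding b(1) using T_leibniz_b[OF assms(2) b(2,3)] by simp
next
  case (c m k)
  have "act_lin n (TA i) (dU n (c_elem m k)) = (0 :: 'k U_chain)"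
    unfolding dU_c rho_def by (simp add: lin_simps)
  then show ?thesis unfolding c(1) U_diff_c[OF c(2)] by simp
qed

lemma e_assoc:
  assumes "g \<in> U_gens n" "i \<in> col_labels n" "j \<in> col_labels n" "1 \<le> n"
  shows "act_lin n (eA i) (act n (eA j) g) = (\<Sum>m\<in>row_labels n. H n m i j \<cdot> act n (TA m) g :: 'k::field U_chain)"
  using assms(1)
proof (cases rule: U_gens_cases)
  case (a k)
  show ?thesis unfolding a(1) by (rule e_assoc_a[OF assms(2,3) a(2) assms(4)])
next
  case (b k l)
  show ?thesis unfolding b(1) act_eb[OF assms(3) b(3)] by (simp add: lin_simps)
next
  case (c m k)
  show ?thesis unfolding c(1) by simp
qed

lemma act_T_zero:
  assumes "g \<in> U_gens n" "A \<in> A_gens n" "1 \<le> n"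
  shows "act_lin n A (act n (TA j) g) = (0 :: 'k::field U_chain)"
    "act_lin n (TA j) (act n A g) = (0 :: 'k::field U_chain)"
proof -
  have 1: "act_lin n A (act n (TA j) g) = (0 :: 'k U_chain)" for A j
    using assms(1)
  proof (cases rule: U_gens_cases)
    case (a k)
    show ?thesis unfolding a(1) act_Ta by (simp add: lin_simps)
  qed simp_all
  then show "act_lin n A (act n (TA j) g) = (0 :: 'k U_chain)" .
  show "act_lin n (TA j) (act n A g) = (0 :: 'k U_chain)"
  proof (cases A)
    case (eA i)
    then have i: "i \<in> col_labels n" using assms(2) by simp
    show ?thesis using assms(1)
    proof (cases rule: U_gens_cases)
      case (a k)
      show ?thesis unfolding a(1) eA act_ea[OF i a(2) assms(3)] rho_def by (simp add: lin_simps)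
    next
      case (b k l)
      show ?thesis unfolding b(1) eA act_eb[OF i b(3)] by (simp add: lin_simps)
    qed simp
  next
    case (TA i)
    show ?thesis unfolding TA by (rule 1)
  qed
qed


section \<open>Gradings\<close>

text \<open>Chains whose coefficients are homogeneous of prescribed degrees and have no constant term: the
  columns of the matrices of a minimal graded complex.\<close>

definition graded_chain :: "nat \<Rightarrow> 'g set \<Rightarrow> ('g \<Rightarrow> int) \<Rightarrow> ('g \<Rightarrow>\<^sub>0 'k::field qpoly) \<Rightarrow> bool"
  where "graded_chain n S \<delta> x \<longleftrightarrow> chain n S x \<and>
    (\<forall>g. homogeneous (\<delta> g) (lookup x g) \<and> lookup (lookup x g) 0 = 0)"

lemma graded_chain_chain: "graded_chain n S \<delta> x \<Longrightarrow> chain n S x"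
  by (simp add: graded_chain_def)

lemma graded_chain_0 [simp]: "graded_chain n S \<delta> 0"
  by (simp add: graded_chain_def)

lemma graded_chain_add [simp]:
  "graded_chain n S \<delta> x \<Longrightarrow> graded_chain n S \<delta> y \<Longrightarrow> graded_chain n S \<delta> (x + y)"
  by (simp add: graded_chain_def lookup_add)

lemma graded_chain_uminus [simp]: "graded_chain n S \<delta> (- x) \<longleftrightarrow> graded_chain n S \<delta> x"
  by (simp add: graded_chain_def)

lemma graded_chain_diff [simp]:
  "graded_chain n S \<delta> x \<Longrightarrow> graded_chain n S \<delta> y \<Longrightarrow> graded_chain n S \<delta> (x - y)"
  using graded_chain_add[of n S \<delta> x "- y"] by simp

lemma graded_chain_sum:
  "(\<And>i. i \<in> A \<Longrightarrow> graded_chain n S \<delta> (x i)) \<Longrightarrow> graded_chain n S \<delta> (\<Sum>i\<in>A. x i)"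
  by (induction A rule: infinite_finite_induct) auto

lemma graded_chain_sign: "graded_chain n S \<delta> x \<Longrightarrow> graded_chain n S \<delta> ((-1) ^ k \<cdot> x)"
  by (cases "even k") simp_all

lemma graded_chain_gen:
  assumes "g \<in> S" "over_vars (vars n) q" "homogeneous (\<delta> g) q" "lookup q 0 = 0"
  shows "graded_chain n S \<delta> (q \<cdot> gen g)"
  using assms by (simp add: graded_chain_def lookup_gen)

lemma graded_chain_relabel:
  assumes x: "graded_chain n S \<delta> x" and f: "\<And>g. g \<in> S \<Longrightarrow> f g \<in> T \<and> \<delta>' (f g) = \<delta> g"
  shows "graded_chain n T \<delta>' (relabel f x)"
  unfolding relabel_def
proof (intro graded_chain_sum graded_chain_gen)
  fix g assume "g \<in> keys x"
  then have g: "g \<in> S" using x by (auto simp: graded_chain_def chain_def)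
  show "f g \<in> T" using f[OF g] by simp
  show "over_vars (vars n) (lookup x g)" "homogeneous (\<delta>' (f g)) (lookup x g)" "lookup (lookup x g) 0 = 0"
    using x f[OF g] by (auto simp: graded_chain_def chain_def)
qed

lemma lookup_xvar_0 [simp]: "lookup (xvar i j) 0 = 0"
  by (rule homogeneous_lookup_0[OF homogeneous_xvar]) simp

lemma lookup_H_0:
  assumes "2 \<le> n" "k \<in> row_labels n" shows "lookup (H n k i j) 0 = 0"
  by (rule homogeneous_lookup_0[OF homogeneous_H[OF assms(2)]]) (use assms in simp)

lemma lookup_sign_mult_0: "lookup p 0 = 0 \<Longrightarrow> lookup ((-1) ^ k * p) 0 = 0"
  for p :: "'k::field qpoly"
  by (cases "even k") simp_all

lemma U_gens_aU [simp]: "aU j \<in> U_gens n \<longleftrightarrow> j \<in> col_labels n"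
  by (auto simp: U_gens_def U_basis_0 U_basis_1 U_basis_2 simp del: One_nat_def)

lemma U_gens_bU [simp]: "bU (k, l) \<in> U_gens n \<longleftrightarrow> k \<in> row_labels n \<and> l \<in> col_labels n"
  by (auto simp: U_gens_def U_basis_0 U_basis_1 U_basis_2 simp del: One_nat_def)

lemma U_gens_cU [simp]: "cU (i, j) \<in> U_gens n \<longleftrightarrow> i \<in> row_labels n \<and> j \<in> row_labels n \<and> (i, j) \<noteq> (1, 1)"
  by (auto simp: U_gens_def U_basis_0 U_basis_1 U_basis_2 simp del: One_nat_def)

lemma U_basis_eq: "U_basis n d = {g \<in> U_gens n. U_deg g = d}"
  unfolding U_gens_def U_basis_def by auto

lemma A_basis_eq: "d \<in> {1, 2} \<Longrightarrow> A_basis n d = {g \<in> A_gens n. A_deg g = d}"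
  unfolding A_gens_def A_basis_def by auto

lemma graded_chain_c_elem:
  assumes "i \<in> row_labels n" "j \<in> row_labels n" "{g \<in> U_gens n. U_deg g = 2} \<subseteq> S"
    "over_vars (vars n) q" "homogeneous (\<delta> (cU (i, j))) q" "lookup q 0 = 0"
  shows "graded_chain n S \<delta> (q \<cdot> c_elem i j)"
proof (cases "(i, j) = (1, 1)")
  case False
  then have "cU (i, j) \<in> S" using assms by auto
  then show ?thesis using assms False by (simp add: gen_c[OF False, symmetric] graded_chain_gen del: One_nat_def)
qed (simp add: c_elem_def)

lemma graded_rho:
  assumes "1 \<le> n" "bU ` vars n \<subseteq> S" "\<And>v. \<delta> (bU v) = 1"
  shows "graded_chain n S \<delta> (rho n)"
  unfolding rho_def
  by (intro graded_chain_sum graded_chain_gen) (use assms in \<open>auto simp: row_labels_def\<close>)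

lemma graded_act:
  fixes n :: nat
  assumes n: "2 \<le> n" and A: "A \<in> A_gens n" and g: "g \<in> U_gens n"
  shows "graded_chain n {h \<in> U_gens n. U_deg h = A_deg A + U_deg g}
    (\<lambda>h. A_ideg n A + U_ideg n g - U_ideg n h) (act n A g :: 'k::field U_chain)"
proof (cases A)
  case (eA i)
  then have i: "i \<in> col_labels n" using A by simp
  show ?thesis using g
  proof (cases rule: U_gens_cases)
    case (a j)
    show ?thesis unfolding a(1) eA act_ea[OF i a(2) order.trans[OF one_le_numeral n]]
      by (intro graded_chain_sign graded_chain_diff graded_chain_sum graded_chain_gen)
         (use i a n in \<open>auto intro!: graded_rho\<close>)
  next
    case (b k l)
    show ?thesis unfolding b(1) eA act_eb[OF i b(3)]
      by (intro graded_chain_sum graded_chain_c_elem)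
         (use b n homogeneous_H in \<open>auto simp: lookup_H_0\<close>)
  qed simp
next
  case (TA i)
  then have i: "i \<in> row_labels n" using A by simp
  show ?thesis using g
  proof (cases rule: U_gens_cases)
    case (a j)
    show ?thesis unfolding a(1) TA act_Ta
      by (intro graded_chain_sign graded_chain_sum graded_chain_c_elem) (use i a in auto)
  next
    case (b k l)
    then show ?thesis unfolding TA by simp
  qed simp
qed

lemma graded_U_diff:
  fixes n :: nat
  assumes n: "2 \<le> n" and g: "g \<in> U_gens n"
  shows "graded_chain n {h \<in> U_gens n. U_deg h + 1 = U_deg g}
    (\<lambda>h. U_ideg n g - U_ideg n h) (U_diff n g :: 'k::field U_chain)"
  using g
proof (cases rule: U_gens_cases)
  case (b k l)
  show ?thesis unfolding b(1) U_diff_b[OF b(2,3)]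
    by (intro graded_chain_sum graded_chain_gen)
       (use b n in \<open>auto intro!: homogeneous_sign_mult homogeneous_H lookup_sign_mult_0 lookup_H_0 simp del: power_Suc\<close>)
next
  case (c i j)
  show ?thesis unfolding c(1) U_diff_c[OF c(2)] dU_c
    by (intro graded_chain_diff graded_chain_sum graded_chain_gen)
       (use c n in \<open>auto intro!: graded_rho\<close>)
qed simp

lemma A_mult_ee:
  assumes i: "i \<in> col_labels n" and j: "j \<in> col_labels n"
  shows "A_mult n (eA i) (eA j) = (\<Sum>m\<in>row_labels n. H n m i j \<cdot> gen (TA m) :: A_gen \<Rightarrow>\<^sub>0 'k::field qpoly)"
proof -
  have ee: "ee_product n p q = (\<Sum>m\<in>row_labels n. H n m p q \<cdot> gen (TA m) :: A_gen \<Rightarrow>\<^sub>0 'k qpoly)"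
    if "p \<in> col_labels n" "q \<in> col_labels n" "p < q" for p q
    unfolding ee_product_def row_labels_def[symmetric]
    by (rule sum.cong[OF refl]) (simp only: minor_H[OF that])
  consider "i < j" | "j < i" | "i = j" by linarith
  then show ?thesis
  proof cases
    case 2
    have "- (\<Sum>m\<in>row_labels n. H n m j i \<cdot> gen (TA m))
        = (\<Sum>m\<in>row_labels n. H n m i j \<cdot> gen (TA m) :: A_gen \<Rightarrow>\<^sub>0 'k qpoly)"
      unfolding sum_negf[symmetric] by (rule sum.cong[OF refl]) (simp add: H_antisym[OF i j])
    then show ?thesis using 2 ee[OF j i 2] by simp
  next
    case 3
    have "(\<Sum>m\<in>row_labels n. H n m i j \<cdot> gen (TA m) :: A_gen \<Rightarrow>\<^sub>0 'k qpoly) = 0"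
      by (rule sum.neutral) (use 3 i in \<open>simp add: H_diag\<close>)
    then show ?thesis using 3 by simp
  qed (simp add: ee[OF i j])
qed

lemma A_diff_T: "A_diff n (TA i) = (\<Sum>l\<in>col_labels n. xvar i l \<cdot> gen (eA l))"
  by (simp add: col_labels_def)

lemma graded_A_mult:
  fixes n :: nat
  assumes n: "2 \<le> n" and A: "A \<in> A_gens n" "B \<in> A_gens n"
  shows "graded_chain n {h \<in> A_gens n. A_deg h = A_deg A + A_deg B}
    (\<lambda>h. A_ideg n A + A_ideg n B - A_ideg n h) (A_mult n A B :: A_gen \<Rightarrow>\<^sub>0 'k::field qpoly)"
proof (cases A; cases B)
  fix i j assume e: "A = eA i" "B = eA j"
  then have ij: "i \<in> col_labels n" "j \<in> col_labels n" using A by simp_all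
  show ?thesis unfolding e A_mult_ee[OF ij]
    by (intro graded_chain_sum graded_chain_gen)
       (use n homogeneous_H in \<open>auto simp: lookup_H_0\<close>)
qed simp_all

lemma graded_A_diff:
  assumes A: "A \<in> A_gens n"
  shows "graded_chain n {h \<in> A_gens n. A_deg h + 1 = A_deg A}
    (\<lambda>h. A_ideg n A - A_ideg n h) (A_diff n A :: A_gen \<Rightarrow>\<^sub>0 'k::field qpoly)"
proof (cases A)
  case (TA i)
  then show ?thesis using A unfolding TA A_diff_T
    by (intro graded_chain_sum graded_chain_gen) auto
qed simp


section \<open>Exactness of \<open>\<U>\<close> in positive degrees\<close>

lemma e_homotopy:
  assumes u: "chain n (U_gens n) u" and i: "i \<in> col_labels n" and n: "1 \<le> n"
  shows "dU n (act_lin n (eA i) u) + act_lin n (eA i) (dU n u) = (G n i \<cdot> u :: 'k::field U_chain)"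
proof -
  have "dU n (act_lin n (eA i) u) + act_lin n (eA i) (dU n u)
      = lin (\<lambda>g. dU n (act n (eA i) g) + act_lin n (eA i) (U_diff n g)) u"
    by (simp add: lin_lin lin_fun_add)
  also have "\<dots> = lin (\<lambda>g. G n i \<cdot> gen g) u"
    by (rule lin_cong, rule e_leibniz) (use u i n in \<open>auto simp: chain_def\<close>)
  finally show ?thesis by (simp add: lin_fun_scale)
qed

lemma scale_G_last_cancel:
  assumes "G n (n + 1) \<cdot> x = (0 :: 'g \<Rightarrow>\<^sub>0 'k::field qpoly)" shows "x = 0"
proof (rule poly_mapping_eqI)
  fix g
  have "G n (n + 1) * lookup x g = 0" using arg_cong[OF assms, of "\<lambda>y. lookup y g"] by simp
  then show "lookup x g = lookup 0 g" using G_last_nonzerodivisor by simp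
qed

lemma last_col [simp]: "n + 1 \<in> col_labels n" "1 \<in> col_labels n"
  by (simp_all add: col_labels_def)

lemma U_basis_subset: "U_basis n d \<subseteq> U_gens n"
  by (auto simp: U_basis_eq)

text \<open>The products \<open>e\<^sub>i u\<close> vanish for degree reasons, so the homotopy formula reads
  \<open>e\<^sub>i (\<partial> u) = G\<^sub>i u\<close>.\<close>

lemma U_exact_2:
  assumes u: "chain n (U_basis n 2) u" and d: "dU n u = (0 :: 'k::field U_chain)" and n: "1 \<le> n"
  shows "u = 0"
proof -
  have "act_lin n (eA (n + 1)) u = lin (\<lambda>g. 0) u"
    by (rule lin_cong) (use u in \<open>auto simp: chain_def U_basis_2\<close>)
  then have "G n (n + 1) \<cdot> u = 0"
    using e_homotopy[OF chain_mono[OF u U_basis_subset] last_col(1) n] d by simp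
  then show ?thesis by (rule scale_G_last_cancel)
qed

text \<open>As for the Hilbert-Burch complex: a cycle is a boundary after multiplication by \<open>G\<^sub>1\<close> and by
  \<open>G\<^sub>n\<^sub>+\<^sub>1\<close>, and regularity divides the two preimages.\<close>

lemma U_exact_1:
  assumes u: "chain n (U_basis n 1) u" and d: "dU n u = (0 :: 'k::field U_chain)" and n: "2 \<le> n"
  shows "\<exists>c. chain n (U_basis n 2) c \<and> dU n c = u"
proof -
  have n1: "1 \<le> n" using n by simp
  define c where "c i = act_lin n (eA i) u" for i
  have cc: "chain n (U_basis n 2) (c i)" if i: "i \<in> col_labels n" for i
    unfolding c_def
  proof (rule chain_lin[OF u])
    fix g assume g: "g \<in> U_basis n 1"
    show "chain n (U_basis n 2) (act n (eA i) g :: 'k U_chain)"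
      using graded_chain_chain[OF graded_act[OF n, of "eA i" g]] i g
      by (simp add: U_basis_eq numeral_2_eq_2)
  qed
  have dc: "dU n (c i) = G n i \<cdot> u" if "i \<in> col_labels n" for i
    using e_homotopy[OF chain_mono[OF u U_basis_subset] that n1] d by (simp add: c_def)
  have "G n (n + 1) \<cdot> c 1 - G n 1 \<cdot> c (n + 1) = 0"
  proof (rule U_exact_2[OF _ _ n1])
    show "chain n (U_basis n 2) (G n (n + 1) \<cdot> c 1 - G n 1 \<cdot> c (n + 1))"
      by (intro chain_diff chain_scale over_vars_G cc last_col)
    show "dU n (G n (n + 1) \<cdot> c 1 - G n 1 \<cdot> c (n + 1)) = 0"
      unfolding lin_simps dc[OF last_col(1)] dc[OF last_col(2)] scale_scale by (simp add: mult.commute)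
  qed
  then have "lookup (G n (n + 1) \<cdot> c 1) g = lookup (G n 1 \<cdot> c (n + 1)) g" for g by simp
  then have "G n (n + 1) * lookup (c 1) g = G n 1 * lookup (c (n + 1)) g" for g
    by (simp only: lookup_scale)
  from G_regular_sequence[OF this chain_over_vars[OF cc[OF last_col(1)]]]
  obtain h where h: "\<And>g. over_vars (vars n) (h g)" "\<And>g. lookup (c (n + 1)) g = G n (n + 1) * h g"
    by metis
  define z where "z = (\<Sum>g\<in>keys (c (n + 1)). h g \<cdot> gen g)"
  have z: "chain n (U_basis n 2) z"
    unfolding z_def
    by (rule chain_of_lookups[OF finite_keys _ h(1)]) (use cc[OF last_col(1)] in \<open>simp add: chain_def\<close>)
  have "c (n + 1) = G n (n + 1) \<cdot> z"
  proof (rule poly_mapping_eqI)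
    fix g
    have z: "lookup z g = (if g \<in> keys (c (n + 1)) then h g else 0)"
      unfolding z_def by (rule lookup_sum_gen[OF finite_keys])
    show "lookup (c (n + 1)) g = lookup (G n (n + 1) \<cdot> z) g"
    proof (cases "g \<in> keys (c (n + 1))")
      case True
      then show ?thesis by (simp only: lookup_scale z h(2) if_True)
    next
      case False
      then have "lookup (c (n + 1)) g = 0" by (simp only: in_keys_iff not_not)
      with False show ?thesis by (simp only: lookup_scale z if_False mult_zero_right)
    qed
  qed
  then have "G n (n + 1) \<cdot> (dU n z - u) = 0"
    using dc[OF last_col(1)] by (simp add: scale_diff_right lin_scale)
  from scale_G_last_cancel[OF this] z show ?thesis by auto
qed

lemma U_exact:
  assumes u: "chain n (U_basis n r) u" and d: "dU n u = (0 :: 'k::field U_chain)"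
    and n: "2 \<le> n" and r: "1 \<le> r"
  shows "\<exists>c. chain n (U_basis n (Suc r)) c \<and> dU n c = u"
proof -
  consider "r = 1" | "r = 2" | "3 \<le> r" using r by linarith
  then show ?thesis
  proof cases
    case 1
    then show ?thesis using U_exact_1[of n u] u d n by (simp add: numeral_2_eq_2)
  next
    case 2
    then have "u = 0" using U_exact_2[of n u] u d n by simp
    then have "chain n (U_basis n (Suc r)) 0 \<and> dU n 0 = u" by simp
    then show ?thesis by blast
  next
    case 3
    then have "u = 0" using u by (simp add: U_basis_ge_3 chain_empty)
    then have "chain n (U_basis n (Suc r)) 0 \<and> dU n 0 = u" by simp
    then show ?thesis by blast
  qed
qed


section \<open>The bar differential by recursion on the first letter\<close>

definition bar_words :: "nat \<Rightarrow> bar_word set"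
  where "bar_words n = {(as, u). set as \<subseteq> A_gens n \<and> u \<in> U_gens n}"

definition word_deg :: "bar_word \<Rightarrow> nat"
  where "word_deg = (\<lambda>(as, u). (\<Sum>g\<leftarrow>as. A_deg g) + U_deg u + length as)"

lemma bar_basis_eq: "bar_basis n r = {w \<in> bar_words n. word_deg w = r}"
  by (auto simp: bar_basis_def bar_words_def word_deg_def A_gens_def U_gens_def)

lemma bar_words_Nil [simp]: "([], u) \<in> bar_words n \<longleftrightarrow> u \<in> U_gens n"
  by (simp add: bar_words_def)

lemma bar_words_Cons [simp]: "(g # as, u) \<in> bar_words n \<longleftrightarrow> g \<in> A_gens n \<and> (as, u) \<in> bar_words n"
  by (auto simp: bar_words_def)

lemma word_deg_Nil [simp]: "word_deg ([], u) = U_deg u"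
  by (simp add: word_deg_def)

lemma word_deg_Cons [simp]: "word_deg (g # as, u) = A_deg g + word_deg (as, u) + 1"
  by (simp add: word_deg_def)

lemma bar_ideg_Nil [simp]: "bar_ideg n ([], u) = U_ideg n u"
  by (simp add: bar_ideg_def)

lemma bar_ideg_Cons [simp]: "bar_ideg n (g # as, u) = A_ideg n g + bar_ideg n (as, u)"
  by (simp add: bar_ideg_def)

definition word_cons :: "A_gen \<Rightarrow> bar_word \<Rightarrow> bar_word"
  where "word_cons g w = (g # fst w, snd w)"

abbreviation bar_cons :: "A_gen \<Rightarrow> 'k::field bar_chain \<Rightarrow> 'k bar_chain"
  where "bar_cons g \<equiv> relabel (word_cons g)"

abbreviation U_word :: "'k::field U_chain \<Rightarrow> 'k bar_chain"
  where "U_word \<equiv> relabel (Pair [])"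

text \<open>Multiplication of the first letter of a word, or of its module part if there are no letters,
  by \<open>g\<close> from the left.\<close>

primrec merge :: "nat \<Rightarrow> A_gen \<Rightarrow> A_gen list \<Rightarrow> U_gen \<Rightarrow> 'k::field bar_chain" where
  "merge n g [] u = U_word (act n g u)"
| "merge n g (h # as) u = relabel (\<lambda>h'. (h' # as, u)) (A_mult n g h)"

lemma relabel_add: "relabel f (x + y) = relabel f x + relabel f y"
  and relabel_diff: "relabel f (x - y) = relabel f x - relabel f y"
  and relabel_uminus: "relabel f (- x) = - relabel f x"
  and relabel_scale: "relabel f (q \<cdot> x) = q \<cdot> relabel f x"
  and relabel_sum: "relabel f (\<Sum>i\<in>A. X i) = (\<Sum>i\<in>A. relabel f (X i))"
  and relabel_0 [simp]: "relabel f 0 = 0"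
  and relabel_gen [simp]: "relabel f (gen g) = gen (f g)"
  by (simp_all add: relabel_lin lin_simps)

lemmas relabel_simps = relabel_add relabel_diff relabel_uminus relabel_scale relabel_sum

lemma relabel_relabel: "relabel f (relabel g x) = relabel (\<lambda>h. f (g h)) x"
  unfolding relabel_lin lin_lin by simp

lemma eps_Cons [simp]: "eps (g # as) (Suc m) = A_deg g + 1 + eps as m"
  by (simp add: eps_def)

lemma eps_0 [simp]: "eps as 0 = 0"
  by (simp add: eps_def)

lemma bar_diff_Nil: "bar_diff n ([], u) = U_word (U_diff n u)"
  by simp

text \<open>Every term of the differential either changes the first letter, multiplies it into what
  follows, or is a term of the differential of the tail, with the sign of the first letter in
  front.\<close>

lemma bar_diff_Cons:
  "bar_diff n (g # as, u) = relabel (\<lambda>h. (h # as, u)) (A_diff n g)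
    + (-1) ^ (A_deg g + 1) \<cdot> (merge n g as u + bar_cons g (bar_diff n (as, u)))"
proof -
  let ?s = "(-1) ^ (A_deg g + 1) :: 'a qpoly"
  have pow: "(-1) ^ (A_deg g + 1 + k) \<cdot> x = ?s \<cdot> (-1) ^ k \<cdot> x" for k and x :: "'a bar_chain"
    by (simp add: scale_scale power_add)
  have bc: "bar_cons g (relabel f x) = relabel (\<lambda>h. (g # fst (f h), snd (f h))) x" for f and x :: "'b \<Rightarrow>\<^sub>0 'a qpoly"
    unfolding relabel_relabel word_cons_def ..
  let ?T1 = "\<lambda>as m. (-1) ^ eps as m \<cdot> relabel (\<lambda>g. (as[m := g], u)) (A_diff n (as ! m)) :: 'a bar_chain"
  let ?T2 = "\<lambda>as m. (-1) ^ eps as (Suc m) \<cdot>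
       relabel (\<lambda>g. (take m as @ g # drop (m + 2) as, u)) (A_mult n (as ! m) (as ! Suc m)) :: 'a bar_chain"
  let ?T3 = "\<lambda>as. if as = [] then 0
     else (-1) ^ eps as (length as) \<cdot> relabel (\<lambda>g. (butlast as, g)) (act n (last as) u) :: 'a bar_chain"
  let ?T4 = "\<lambda>as. (-1) ^ eps as (length as) \<cdot> relabel (\<lambda>g. (as, g)) (U_diff n u) :: 'a bar_chain"
  have T1: "(\<Sum>m<length (g # as). ?T1 (g # as) m)
      = relabel (\<lambda>h. (h # as, u)) (A_diff n g) + ?s \<cdot> bar_cons g (\<Sum>m<length as. ?T1 as m)"
    unfolding length_Cons sum.lessThan_Suc_shift relabel_simps bc scale_sum_right
    by (simp add: pow del: power_Suc add_Suc_right add_Suc One_nat_def)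
  have T23: "(\<Sum>m<length (g # as) - 1. ?T2 (g # as) m) + ?T3 (g # as)
      = ?s \<cdot> (merge n g as u + bar_cons g ((\<Sum>m<length as - 1. ?T2 as m) + ?T3 as))"
  proof (cases as)
    case Nil
    then show ?thesis by (simp add: eps_def)
  next
    case (Cons h as')
    have "(\<Sum>m<length (g # as) - 1. ?T2 (g # as) m)
        = ?s \<cdot> merge n g as u + (\<Sum>m<length as'. ?T2 (g # as) (Suc m))"
      unfolding Cons by (simp add: sum.lessThan_Suc_shift del: sum.lessThan_Suc)
    also have "(\<Sum>m<length as'. ?T2 (g # as) (Suc m)) = ?s \<cdot> bar_cons g (\<Sum>m<length as - 1. ?T2 as m)"
      unfolding relabel_simps bc scale_sum_right Cons
      by (simp add: pow del: power_Suc add_Suc_right add_Suc One_nat_def)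
    finally have 2: "(\<Sum>m<length (g # as) - 1. ?T2 (g # as) m)
        = ?s \<cdot> merge n g as u + ?s \<cdot> bar_cons g (\<Sum>m<length as - 1. ?T2 as m)" .
    have 3: "?T3 (g # as) = ?s \<cdot> bar_cons g (?T3 as)"
    proof -
      have eps: "eps (g # as) (length (g # as)) = A_deg g + 1 + eps as (length as)"
        by (simp only: length_Cons eps_Cons)
      have ne: "as \<noteq> []" using Cons by simp
      show ?thesis
        by (simp only: ne list.distinct if_False eps pow relabel_scale bc butlast.simps last_ConsR[OF ne]
            fst_conv snd_conv)
    qed
    show ?thesis unfolding 2 3 scale_add_right relabel_add by (simp only: add.assoc)
  qed
  have T4: "?T4 (g # as) = ?s \<cdot> bar_cons g (?T4 as)"
    by (simp only: length_Cons eps_Cons pow relabel_scale bc fst_conv snd_conv)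
  show ?thesis
    unfolding bar_diff.simps[of n "g # as"] bar_diff.simps[of n as] add.assoc[of "sum _ _"]
    using T1 T23 T4 by (simp add: scale_add_right relabel_add algebra_simps del: power_Suc)
qed

lemma graded_merge:
  fixes n :: nat
  assumes n: "2 \<le> n" and w: "(g # as, u) \<in> bar_words n"
  shows "graded_chain n {w' \<in> bar_words n. word_deg w' + 1 = word_deg (g # as, u)}
    (\<lambda>w'. bar_ideg n (g # as, u) - bar_ideg n w') (merge n g as u :: 'k::field bar_chain)"
proof (cases as)
  case Nil
  show ?thesis unfolding Nil merge.simps
    by (rule graded_chain_relabel[OF graded_act[OF n]]) (use w Nil in auto)
next
  case (Cons h as')
  show ?thesis unfolding Cons merge.simps
    by (rule graded_chain_relabel[OF graded_A_mult[OF n]]) (use w Cons in auto)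
qed

lemma graded_bar_diff:
  fixes n :: nat
  assumes n: "2 \<le> n"
  shows "(as, u) \<in> bar_words n \<Longrightarrow> graded_chain n {w' \<in> bar_words n. word_deg w' + 1 = word_deg (as, u)}
    (\<lambda>w'. bar_ideg n (as, u) - bar_ideg n w') (bar_diff n (as, u) :: 'k::field bar_chain)"
proof (induction as)
  case Nil
  show ?case unfolding bar_diff_Nil
    by (rule graded_chain_relabel[OF graded_U_diff[OF n]]) (use Nil in auto)
next
  case (Cons g as)
  show ?case unfolding bar_diff_Cons
  proof (intro graded_chain_add graded_chain_sign)
    show "graded_chain n {w' \<in> bar_words n. word_deg w' + 1 = word_deg (g # as, u)}
      (\<lambda>w'. bar_ideg n (g # as, u) - bar_ideg n w') (relabel (\<lambda>h. (h # as, u)) (A_diff n g :: A_gen \<Rightarrow>\<^sub>0 'k qpoly))"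
      by (rule graded_chain_relabel[OF graded_A_diff]) (use Cons in auto)
    show "graded_chain n {w' \<in> bar_words n. word_deg w' + 1 = word_deg (g # as, u)}
      (\<lambda>w'. bar_ideg n (g # as, u) - bar_ideg n w') (merge n g as u :: 'k bar_chain)"
      by (rule graded_merge[OF n]) (use Cons in auto)
    show "graded_chain n {w' \<in> bar_words n. word_deg w' + 1 = word_deg (g # as, u)}
      (\<lambda>w'. bar_ideg n (g # as, u) - bar_ideg n w') (bar_cons g (bar_diff n (as, u) :: 'k bar_chain))"
      by (rule graded_chain_relabel[OF Cons.IH]) (use Cons.prems in \<open>auto simp: word_cons_def\<close>)
  qed
qed


section \<open>The curvature of the bar differential over \<open>Q\<close>\<close>

declare bar_diff.simps [simp del] merge.simps [simp del]

abbreviation bar_d :: "nat \<Rightarrow> 'k::field bar_chain \<Rightarrow> 'k bar_chain"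
  where "bar_d n \<equiv> lin (bar_diff n)"

definition merge_lin :: "nat \<Rightarrow> A_gen \<Rightarrow> 'k::field bar_chain \<Rightarrow> 'k bar_chain"
  where "merge_lin n g = lin (\<lambda>(as, u). merge n g as u)"

text \<open>The coefficient \<open>x\<^sup>g\<close> of the words with first letter \<open>g\<close>, with that letter removed.\<close>

definition strip :: "A_gen \<Rightarrow> 'k::field bar_chain \<Rightarrow> 'k bar_chain"
  where "strip g = lin (\<lambda>(as, u). case as of [] \<Rightarrow> 0 | h # as' \<Rightarrow> if h = g then gen (as', u) else 0)"

lemma strip_simps:
  "strip g (x + y) = strip g x + strip g y" "strip g (x - y) = strip g x - strip g y" "strip g (- x) = - strip g x"
  "strip g (q \<cdot> x) = q \<cdot> strip g x" "strip g (\<Sum>i\<in>A. X i) = (\<Sum>i\<in>A. strip g (X i))"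
  unfolding strip_def lin_simps by (rule refl)+

lemma merge_lin_simps:
  "merge_lin n g (x + y) = merge_lin n g x + merge_lin n g y"
  "merge_lin n g (x - y) = merge_lin n g x - merge_lin n g y" "merge_lin n g (- x) = - merge_lin n g x"
  "merge_lin n g (q \<cdot> x) = q \<cdot> merge_lin n g x"
  "merge_lin n g (\<Sum>i\<in>A. X i) = (\<Sum>i\<in>A. merge_lin n g (X i))"
  unfolding merge_lin_def lin_simps by (rule refl)+

lemma strip_0 [simp]: "strip g 0 = 0"
  by (simp add: strip_def)

lemma strip_gen: "strip g (gen (as, u)) = (case as of [] \<Rightarrow> 0 | h # as' \<Rightarrow> if h = g then gen (as', u) else 0)"
  by (simp add: strip_def)

lemma merge_lin_gen [simp]: "merge_lin n g (gen (as, u)) = merge n g as u"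
  by (simp add: merge_lin_def)

lemma strip_bar_cons: "strip g (bar_cons h x) = (if h = g then x else 0)"
  unfolding strip_def relabel_lin lin_lin by (simp add: word_cons_def case_prod_unfold)

lemma strip_U_word [simp]: "strip g (U_word x) = 0"
  unfolding strip_def relabel_lin lin_lin by simp

lemma relabel_Cons_sum:
  "relabel (\<lambda>h. (h # as, u)) (\<Sum>i\<in>A. q i \<cdot> gen (g i)) = (\<Sum>i\<in>A. q i \<cdot> bar_cons (g i) (gen (as, u)))"
  by (simp add: relabel_simps word_cons_def)

lemma merge_lin_U_word: "merge_lin n g (U_word x) = U_word (act_lin n g x)"
  unfolding merge_lin_def relabel_lin lin_lin by (simp add: relabel_lin merge.simps)

lemma merge_ee:
  assumes "i \<in> col_labels n" "j \<in> col_labels n"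
  shows "merge n (eA i) (eA j # as) u = (\<Sum>m\<in>row_labels n. H n m i j \<cdot> bar_cons (TA m) (gen (as, u)))"
  unfolding merge.simps A_mult_ee[OF assms] relabel_Cons_sum ..

lemma merge_lin_ee:
  assumes "i \<in> col_labels n" "j \<in> col_labels n"
  shows "merge_lin n (eA i) (bar_cons (eA j) x) = (\<Sum>m\<in>row_labels n. H n m i j \<cdot> bar_cons (TA m) x)"
  unfolding merge_lin_def relabel_lin lin_lin lin_fun_sum[symmetric] lin_fun_scale[symmetric]
  by (rule lin_cong) (simp add: word_cons_def case_prod_unfold merge_ee[OF assms])

lemma merge_T [simp]: "merge n g (TA j # as) u = 0" "merge n (TA j) (h # as) u = 0"
proof -
  show "merge n g (TA j # as) u = 0" by (cases g) (simp_all add: merge.simps)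
  show "merge n (TA j) (h # as) u = 0" by (cases h) (simp_all add: merge.simps)
qed

lemma merge_lin_T [simp]: "merge_lin n g (bar_cons (TA j) x) = 0" "merge_lin n (TA j) (bar_cons h x) = 0"
proof -
  show "merge_lin n g (bar_cons (TA j) x) = 0"
    unfolding merge_lin_def relabel_lin lin_lin word_cons_def by simp
  show "merge_lin n (TA j) (bar_cons h x) = 0"
    unfolding merge_lin_def relabel_lin lin_lin word_cons_def by simp
qed

lemma bar_diff_e:
  "bar_diff n (eA i # as, u) = merge n (eA i) as u + bar_cons (eA i) (bar_diff n (as, u))"
  unfolding bar_diff_Cons by simp

lemma bar_diff_T:
  "bar_diff n (TA j # as, u) = (\<Sum>l\<in>col_labels n. xvar j l \<cdot> bar_cons (eA l) (gen (as, u)))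
     - merge n (TA j) as u - bar_cons (TA j) (bar_diff n (as, u))"
  unfolding bar_diff_Cons A_diff_T relabel_Cons_sum by (simp add: scale_add_right)

lemma bar_d_cons_e: "bar_d n (bar_cons (eA i) x) = merge_lin n (eA i) x + bar_cons (eA i) (bar_d n x)"
proof -
  have "bar_d n (bar_cons (eA i) x) = lin (\<lambda>w. merge n (eA i) (fst w) (snd w) + bar_cons (eA i) (bar_diff n w)) x"
    unfolding relabel_lin lin_lin
    by (rule lin_cong) (simp add: word_cons_def bar_diff_e relabel_lin)
  then show ?thesis unfolding lin_fun_add merge_lin_def relabel_lin lin_lin case_prod_unfold .
qed

lemma bar_d_cons_T: "bar_d n (bar_cons (TA j) x) = (\<Sum>l\<in>col_labels n. xvar j l \<cdot> bar_cons (eA l) x)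
    - merge_lin n (TA j) x - bar_cons (TA j) (bar_d n x)"
proof -
  have "bar_d n (bar_cons (TA j) x) = lin (\<lambda>w. (\<Sum>l\<in>col_labels n. xvar j l \<cdot> bar_cons (eA l) (gen w))
     - merge n (TA j) (fst w) (snd w) - bar_cons (TA j) (bar_diff n w)) x"
    unfolding relabel_lin lin_lin
    by (rule lin_cong) (simp add: word_cons_def bar_diff_T relabel_lin)
  then show ?thesis
    unfolding lin_fun_diff lin_fun_sum lin_fun_scale merge_lin_def relabel_lin lin_lin case_prod_unfold by simp
qed

lemma bar_d_U_word: "bar_d n (U_word x) = U_word (dU n x)"
  unfolding relabel_lin lin_lin by (simp add: bar_diff_Nil relabel_lin)

lemma merge_assoc:
  assumes w: "(as, u) \<in> bar_words n" and i: "i \<in> col_labels n" and j: "j \<in> col_labels n" and n: "1 \<le> n"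
  shows "merge_lin n (eA i) (merge n (eA j) as u)
    = (\<Sum>m\<in>row_labels n. H n m i j \<cdot> merge n (TA m) as u :: 'k::field bar_chain)"
proof (cases as)
  case Nil
  then have u: "u \<in> U_gens n" using w by simp
  show ?thesis unfolding Nil merge.simps merge_lin_U_word e_assoc[OF u i j n] relabel_simps ..
next
  case (Cons h as')
  show ?thesis
  proof (cases h)
    case (eA k)
    then have k: "k \<in> col_labels n" using w Cons by simp
    show ?thesis unfolding Cons eA merge_ee[OF j k] merge_lin_simps merge_lin_T by simp
  next
    case (TA k)
    show ?thesis unfolding Cons TA merge_T merge_lin_def by simp
  qed
qed

lemma merge_T_zero:
  assumes w: "(as, u) \<in> bar_words n" and g: "g \<in> A_gens n" and n: "1 \<le> n"
  shows "merge_lin n g (merge n (TA j) as u) = (0 :: 'k::field bar_chain)"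
    "merge_lin n (TA j) (merge n g as u) = (0 :: 'k::field bar_chain)"
proof (atomize (full), cases as)
  case Nil
  then have u: "u \<in> U_gens n" using w by simp
  show "merge_lin n g (merge n (TA j) as u) = (0 :: 'k bar_chain) \<and>
    merge_lin n (TA j) (merge n g as u) = (0 :: 'k bar_chain)"
    unfolding Nil merge.simps merge_lin_U_word act_T_zero[OF u g n] by simp
next
  case (Cons h as')
  have 2: "merge_lin n (TA j) (merge n g as u) = (0 :: 'k bar_chain)"
  proof (cases g; cases h)
    fix i k assume e: "g = eA i" "h = eA k"
    then have ik: "i \<in> col_labels n" "k \<in> col_labels n" using w Cons g by simp_all
    show ?thesis unfolding Cons e merge_ee[OF ik] merge_lin_simps merge_lin_T by simp
  qed (simp_all add: Cons merge_lin_def)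
  then show "merge_lin n g (merge n (TA j) as u) = (0 :: 'k bar_chain) \<and>
    merge_lin n (TA j) (merge n g as u) = (0 :: 'k bar_chain)"
    unfolding Cons merge_T by (simp add: merge_lin_def)
qed

text \<open>The Leibniz rules of the action on \<open>\<U>\<close> propagate to the multiplication of the first letter.
  The correction term comes from the omitted \<open>\<partial> e\<^sub>k = G\<^sub>k\<close> in the product with a first letter
  \<open>e\<^sub>k\<close>.\<close>

lemma merge_leibniz_e:
  assumes w: "(as, u) \<in> bar_words n" and i: "i \<in> col_labels n" and n: "1 \<le> n"
  shows "bar_d n (merge n (eA i) as u) + merge_lin n (eA i) (bar_diff n (as, u))
      + (\<Sum>k\<in>col_labels n. G n k \<cdot> bar_cons (eA i) (strip (eA k) (gen (as, u))))
    = (G n i \<cdot> gen (as, u) :: 'k::field bar_chain)"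
proof (cases as)
  case Nil
  then have u: "u \<in> U_gens n" using w by simp
  show ?thesis
    unfolding Nil merge.simps bar_diff_Nil merge_lin_U_word bar_d_U_word relabel_simps[symmetric] e_leibniz[OF u i n]
    by (simp add: strip_gen relabel_scale)
next
  case (Cons h as')
  define y where "y = (gen (as', u) :: 'k bar_chain)"
  have w': "(as', u) \<in> bar_words n" and h: "h \<in> A_gens n" using w Cons by simp_all
  have gen_as: "gen (as, u) = bar_cons h y" by (simp add: Cons y_def word_cons_def)
  have d_as: "bar_diff n (as, u) = bar_d n (bar_cons h y)" by (simp add: gen_as[symmetric])
  show ?thesis
  proof (cases h)
    case (eA j)
    then have j: "j \<in> col_labels n" using h by simp
    have "bar_d n (merge n (eA i) as u) = (\<Sum>m\<in>row_labels n. H n m i j \<cdot>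
        ((\<Sum>l\<in>col_labels n. xvar m l \<cdot> bar_cons (eA l) y) - merge n (TA m) as' u - bar_cons (TA m) (bar_d n y)))"
      unfolding Cons eA merge_ee[OF i j] lin_simps y_def bar_d_cons_T merge_lin_gen ..
    also have "\<dots> = (\<Sum>m\<in>row_labels n. H n m i j \<cdot> (\<Sum>l\<in>col_labels n. xvar m l \<cdot> bar_cons (eA l) y))
        - (\<Sum>m\<in>row_labels n. H n m i j \<cdot> merge n (TA m) as' u)
        - (\<Sum>m\<in>row_labels n. H n m i j \<cdot> bar_cons (TA m) (bar_d n y))"
      by (simp add: scale_diff_right sum_subtractf)
    also have "(\<Sum>m\<in>row_labels n. H n m i j \<cdot> (\<Sum>l\<in>col_labels n. xvar m l \<cdot> bar_cons (eA l) y))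
        = (\<Sum>l\<in>col_labels n. (if l = j then G n i else 0) \<cdot> bar_cons (eA l) y - (if l = i then G n j else 0) \<cdot> bar_cons (eA l) y)"
      unfolding sum_scale_swap
      by (rule sum.cong[OF refl]) (simp add: sum_H_column[OF i j] scale_diff_left eq_commute)
    also have "\<dots> = G n i \<cdot> bar_cons (eA j) y - G n j \<cdot> bar_cons (eA i) y"
      unfolding sum_subtractf sum_delta_scale[OF finite_col_labels j] sum_delta_scale[OF finite_col_labels i] ..
    finally have 1: "bar_d n (merge n (eA i) as u) = G n i \<cdot> bar_cons (eA j) y - G n j \<cdot> bar_cons (eA i) y
        - (\<Sum>m\<in>row_labels n. H n m i j \<cdot> merge n (TA m) as' u)
        - (\<Sum>m\<in>row_labels n. H n m i j \<cdot> bar_cons (TA m) (bar_d n y))" .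
    have 2: "merge_lin n (eA i) (bar_diff n (as, u)) = (\<Sum>m\<in>row_labels n. H n m i j \<cdot> merge n (TA m) as' u)
        + (\<Sum>m\<in>row_labels n. H n m i j \<cdot> bar_cons (TA m) (bar_d n y))"
      unfolding d_as eA bar_d_cons_e merge_lin_simps merge_lin_ee[OF i j]
      unfolding y_def merge_lin_gen merge_assoc[OF w' i j n] ..
    have 3: "(\<Sum>k\<in>col_labels n. G n k \<cdot> bar_cons (eA i) (strip (eA k) (gen (as, u)))) = G n j \<cdot> bar_cons (eA i) y"
    proof -
      have "(\<Sum>k\<in>col_labels n. G n k \<cdot> bar_cons (eA i) (strip (eA k) (gen (as, u))))
         = (\<Sum>k\<in>col_labels n. (if k = j then G n k else 0) \<cdot> bar_cons (eA i) y)"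
        unfolding gen_as eA strip_bar_cons by (rule sum.cong[OF refl]) auto
      then show ?thesis unfolding sum_delta_scale[OF finite_col_labels j] .
    qed
    show ?thesis unfolding 1 2 3 by (simp add: gen_as eA)
  next
    case (TA j)
    then have j: "j \<in> row_labels n" using h by simp
    have "merge_lin n (eA i) (bar_diff n (as, u))
        = (\<Sum>l\<in>col_labels n. xvar j l \<cdot> (\<Sum>m\<in>row_labels n. H n m i l \<cdot> bar_cons (TA m) y))"
      unfolding d_as TA bar_d_cons_T merge_lin_simps merge_lin_T
      unfolding y_def merge_lin_gen merge_T_zero(1)[OF w' _ n, of "eA i", simplified, OF i]
      by (simp add: merge_lin_ee[OF i] del: relabel_gen)
    also have "\<dots> = (\<Sum>m\<in>row_labels n. (if m = j then G n i else 0) \<cdot> bar_cons (TA m) y)"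
      unfolding sum_scale_swap by (rule sum.cong[OF refl]) (simp only: sum_H_row[OF _ j])
    also have "\<dots> = G n i \<cdot> bar_cons (TA j) y" by (rule sum_delta_scale[OF finite_row_labels j])
    finally have 2: "merge_lin n (eA i) (bar_diff n (as, u)) = G n i \<cdot> bar_cons (TA j) y" .
    show ?thesis unfolding 2 by (simp add: Cons TA strip_gen y_def word_cons_def)
  qed
qed

lemma merge_leibniz_T:
  assumes w: "(as, u) \<in> bar_words n" and i: "i \<in> row_labels n" and n: "1 \<le> n"
  shows "(\<Sum>l\<in>col_labels n. xvar i l \<cdot> merge n (eA l) as u) - bar_d n (merge n (TA i) as u)
      + merge_lin n (TA i) (bar_diff n (as, u))
      + (\<Sum>k\<in>col_labels n. G n k \<cdot> bar_cons (TA i) (strip (eA k) (gen (as, u))))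
    = (0 :: 'k::field bar_chain)"
proof (cases as)
  case Nil
  then have u: "u \<in> U_gens n" using w by simp
  show ?thesis
    unfolding Nil merge.simps bar_diff_Nil merge_lin_U_word bar_d_U_word relabel_simps[symmetric] T_leibniz[OF u i]
    by (simp add: strip_gen)
next
  case (Cons h as')
  define y where "y = (gen (as', u) :: 'k bar_chain)"
  have w': "(as', u) \<in> bar_words n" and h: "h \<in> A_gens n" using w Cons by simp_all
  have gen_as: "gen (as, u) = bar_cons h y" by (simp add: Cons y_def word_cons_def)
  have d_as: "bar_diff n (as, u) = bar_d n (bar_cons h y)" by (simp add: gen_as[symmetric])
  have iA: "TA i \<in> A_gens n" using i by simp
  show ?thesis
  proof (cases h)
    case (eA j)
    then have j: "j \<in> col_labels n" using h by simp
    have "(\<Sum>l\<in>col_labels n. xvar i l \<cdot> merge n (eA l) as u)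
        = (\<Sum>l\<in>col_labels n. xvar i l \<cdot> (\<Sum>m\<in>row_labels n. H n m l j \<cdot> bar_cons (TA m) y))"
      unfolding Cons eA y_def by (rule sum.cong[OF refl]) (simp only: merge_ee[OF _ j])
    also have "\<dots> = (\<Sum>m\<in>row_labels n. (if m = i then - G n j else 0) \<cdot> bar_cons (TA m) y)"
      unfolding sum_scale_swap by (rule sum.cong[OF refl]) (simp only: sum_H_row_antisym[OF _ i j])
    also have "\<dots> = - (G n j \<cdot> bar_cons (TA i) y)"
      unfolding sum_delta_scale[OF finite_row_labels i] by simp
    finally have 1: "(\<Sum>l\<in>col_labels n. xvar i l \<cdot> merge n (eA l) as u) = - (G n j \<cdot> bar_cons (TA i) y)" .
    have 2: "merge_lin n (TA i) (bar_diff n (as, u)) = (0 :: 'k bar_chain)"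
      unfolding d_as eA bar_d_cons_e merge_lin_simps merge_lin_T
      unfolding y_def merge_lin_gen merge_T_zero(2)[OF w' h[unfolded eA] n] by simp
    have 3: "(\<Sum>k\<in>col_labels n. G n k \<cdot> bar_cons (TA i) (strip (eA k) (gen (as, u)))) = G n j \<cdot> bar_cons (TA i) y"
    proof -
      have "(\<Sum>k\<in>col_labels n. G n k \<cdot> bar_cons (TA i) (strip (eA k) (gen (as, u))))
         = (\<Sum>k\<in>col_labels n. (if k = j then G n k else 0) \<cdot> bar_cons (TA i) y)"
        unfolding gen_as eA strip_bar_cons by (rule sum.cong[OF refl]) auto
      then show ?thesis unfolding sum_delta_scale[OF finite_col_labels j] .
    qed
    show ?thesis unfolding 1 2 3 unfolding Cons merge_T by simp
  next
    case (TA j)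
    have 2: "merge_lin n (TA i) (bar_diff n (as, u)) = (0 :: 'k bar_chain)"
      unfolding d_as TA bar_d_cons_T merge_lin_simps merge_lin_T
      unfolding y_def merge_lin_gen merge_T_zero(1)[OF w' iA n] by simp
    show ?thesis unfolding 2 by (simp add: Cons TA strip_gen)
  qed
qed

text \<open>Dropping the component \<open>\<A>\<^sub>1 \<rightarrow> \<A>\<^sub>0\<close> spoils \<open>d\<^sup>2 = 0\<close> over \<open>Q\<close> in a controlled way, and \<open>d\<^sup>2\<close>
  vanishes modulo the minors.\<close>

lemma bar_diff_square:
  assumes n: "1 \<le> n"
  shows "(as, u) \<in> bar_words n \<Longrightarrow> bar_d n (bar_diff n (as, u))
    = (\<Sum>k\<in>col_labels n. G n k \<cdot> strip (eA k) (gen (as, u)) :: 'k::field bar_chain)"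
proof (induction as)
  case Nil
  then have "u \<in> U_gens n" by simp
  from U_diff_square[OF this, where ?'k = 'k] show ?case
    unfolding bar_diff_Nil bar_d_U_word by (simp add: strip_gen)
next
  case (Cons g as)
  have w: "(as, u) \<in> bar_words n" and g: "g \<in> A_gens n" using Cons.prems by simp_all
  note IH = Cons.IH[OF w]
  show ?case
  proof (cases g)
    case (eA i)
    then have i: "i \<in> col_labels n" using g by simp
    have "bar_d n (bar_diff n (g # as, u)) = (G n i \<cdot> gen (as, u) :: 'k bar_chain)"
      using merge_leibniz_e[OF w i n, where ?'k = 'k]
      unfolding eA bar_diff_e lin_simps bar_d_cons_e IH relabel_simps by (simp add: add.assoc)
    also have "\<dots> = (\<Sum>k\<in>col_labels n. (if k = i then G n k else 0) \<cdot> gen (as, u))"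
      by (rule sum_delta_scale[OF finite_col_labels i, symmetric])
    also have "\<dots> = (\<Sum>k\<in>col_labels n. G n k \<cdot> strip (eA k) (gen (g # as, u)))"
      by (rule sum.cong[OF refl]) (auto simp: strip_gen eA)
    finally show ?thesis .
  next
    case (TA i)
    then have i: "i \<in> row_labels n" using g by simp
    have "bar_d n (bar_diff n (g # as, u)) = (0 :: 'k bar_chain)"
      using merge_leibniz_T[OF w i n, where ?'k = 'k]
      unfolding TA bar_diff_T lin_simps bar_d_cons_e bar_d_cons_T IH relabel_simps merge_lin_gen lin_gen
      by (simp add: scale_add_right sum.distrib algebra_simps)
    then show ?thesis by (simp add: strip_gen TA)
  qed
qed

lemma bar_d_square:
  assumes x: "chain n (bar_words n) x" and n: "1 \<le> n"
  shows "bar_d n (bar_d n x) = (\<Sum>k\<in>col_labels n. G n k \<cdot> strip (eA k) x :: 'k::field bar_chain)"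
proof -
  have "bar_d n (bar_d n x) = lin (\<lambda>w. bar_d n (bar_diff n w)) x" by (rule lin_lin)
  also have "\<dots> = lin (\<lambda>w. \<Sum>k\<in>col_labels n. G n k \<cdot> strip (eA k) (gen w)) x"
  proof (rule lin_cong)
    fix w assume "w \<in> keys x"
    then have "(fst w, snd w) \<in> bar_words n" using x by (auto simp: chain_def)
    from bar_diff_square[OF n this]
    show "bar_d n (bar_diff n w) = (\<Sum>k\<in>col_labels n. G n k \<cdot> strip (eA k) (gen w :: 'k bar_chain))"
      by simp
  qed
  also have "\<dots> = (\<Sum>k\<in>col_labels n. G n k \<cdot> strip (eA k) x)"
    by (simp add: lin_fun_sum lin_fun_scale strip_def)
  finally show ?thesis .
qed


section \<open>Acyclicity of the bar complex\<close>

lemma strip_e_merge: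
  assumes "(as, u) \<in> bar_words n" "g \<in> A_gens n"
  shows "strip (eA k) (merge n g as u) = (0 :: 'k::field bar_chain)"
proof (cases as)
  case (Cons h as')
  show ?thesis
  proof (cases g; cases h)
    fix i j assume "g = eA i" "h = eA j"
    then have e: "g = eA i" "h = eA j" and ij: "i \<in> col_labels n" "j \<in> col_labels n"
      using assms Cons by simp_all
    show ?thesis unfolding Cons e merge_ee[OF ij] strip_simps strip_bar_cons by simp
  qed (simp_all add: Cons)
qed (simp add: merge.simps)

lemma strip_T_merge:
  assumes w: "(as, u) \<in> bar_words n" and i: "i \<in> col_labels n" and j: "j \<in> row_labels n"
  shows "strip (TA j) (merge n (eA i) as u)
    = (\<Sum>k\<in>col_labels n. H n j i k \<cdot> strip (eA k) (gen (as, u)) :: 'k::field bar_chain)"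
proof (cases as)
  case Nil
  then show ?thesis by (simp add: strip_gen merge.simps)
next
  case (Cons h as')
  show ?thesis
  proof (cases h)
    case (eA k)
    then have k: "k \<in> col_labels n" using w Cons by simp
    have "strip (TA j) (merge n (eA i) as u)
        = (\<Sum>m\<in>row_labels n. (if m = j then H n m i k else 0) \<cdot> gen (as', u))"
      unfolding Cons eA merge_ee[OF i k] strip_simps strip_bar_cons by (rule sum.cong[OF refl]) auto
    also have "\<dots> = H n j i k \<cdot> gen (as', u)" by (rule sum_delta_scale[OF finite_row_labels j])
    also have "\<dots> = (\<Sum>l\<in>col_labels n. (if l = k then H n j i l else 0) \<cdot> gen (as', u))"
      by (rule sum_delta_scale[OF finite_col_labels k, symmetric])
    also have "\<dots> = (\<Sum>l\<in>col_labels n. H n j i l \<cdot> strip (eA l) (gen (as, u)))"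
      by (rule sum.cong[OF refl]) (auto simp: strip_gen Cons eA)
    finally show ?thesis .
  next
    case (TA k)
    then show ?thesis by (simp add: Cons strip_gen)
  qed
qed

lemma strip_T_merge_T: "strip (TA j) (merge n (TA i) as u) = 0"
  by (cases as) (simp_all add: merge.simps)

text \<open>No product has a component in \<open>\<A>\<^sub>1\<close>, so a first letter \<open>e\<^sub>k\<close> of the boundary is either an old
  one or arises from \<open>\<partial> T\<^sub>j\<close>.\<close>

lemma strip_e_bar_diff:
  assumes w: "(as, u) \<in> bar_words n" and k: "k \<in> col_labels n"
  shows "strip (eA k) (bar_diff n (as, u)) = bar_d n (strip (eA k) (gen (as, u)))
    + (\<Sum>j\<in>row_labels n. xvar j k \<cdot> strip (TA j) (gen (as, u)) :: 'k::field bar_chain)"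
proof (cases as)
  case Nil
  show ?thesis unfolding Nil bar_diff_Nil by (simp add: strip_gen)
next
  case (Cons g as')
  have w': "(as', u) \<in> bar_words n" and g: "g \<in> A_gens n" using w Cons by simp_all
  show ?thesis
  proof (cases g)
    case (eA i)
    show ?thesis unfolding Cons eA bar_diff_e strip_simps strip_e_merge[OF w' g[unfolded eA]] strip_bar_cons
      by (simp add: strip_gen)
  next
    case (TA i)
    then have i: "i \<in> row_labels n" using g by simp
    have "strip (eA k) (bar_diff n (as, u)) = (\<Sum>l\<in>col_labels n. (if l = k then xvar i l else 0) \<cdot> gen (as', u))"
      unfolding Cons TA bar_diff_T strip_simps strip_e_merge[OF w' g[unfolded TA]] strip_bar_cons
      by (simp, rule sum.cong[OF refl]) auto
    also have "\<dots> = xvar i k \<cdot> gen (as', u)" by (rule sum_delta_scale[OF finite_col_labels k])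
    also have "\<dots> = (\<Sum>j\<in>row_labels n. (if j = i then xvar j k else 0) \<cdot> gen (as', u))"
      by (rule sum_delta_scale[OF finite_row_labels i, symmetric])
    also have "\<dots> = (\<Sum>j\<in>row_labels n. xvar j k \<cdot> strip (TA j) (gen (as, u)))"
      by (rule sum.cong[OF refl]) (auto simp: strip_gen Cons TA)
    finally show ?thesis by (simp add: strip_gen Cons TA)
  qed
qed

text \<open>A first letter \<open>T\<^sub>j\<close> of the boundary is either an old one or arises from a product of two
  letters \<open>e\<^sub>i e\<^sub>k\<close>.\<close>

lemma strip_T_bar_diff:
  assumes w: "(as, u) \<in> bar_words n" and j: "j \<in> row_labels n"
  shows "strip (TA j) (bar_diff n (as, u))
    = (\<Sum>i\<in>col_labels n. \<Sum>k\<in>col_labels n. H n j i k \<cdot> strip (eA k) (strip (eA i) (gen (as, u))))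
      - bar_d n (strip (TA j) (gen (as, u)) :: 'k::field bar_chain)"
proof (cases as)
  case Nil
  show ?thesis unfolding Nil bar_diff_Nil by (simp add: strip_gen)
next
  case (Cons g as')
  have w': "(as', u) \<in> bar_words n" and g: "g \<in> A_gens n" using w Cons by simp_all
  show ?thesis
  proof (cases g)
    case (eA i)
    then have i: "i \<in> col_labels n" using g by simp
    have "(\<Sum>l\<in>col_labels n. \<Sum>k\<in>col_labels n. H n j l k \<cdot> strip (eA k) (strip (eA l) (gen (as, u) :: 'k bar_chain)))
      = (\<Sum>l\<in>col_labels n. if l = i then \<Sum>k\<in>col_labels n. H n j i k \<cdot> strip (eA k) (gen (as', u)) else 0)"
      by (rule sum.cong[OF refl]) (auto simp: strip_gen Cons eA)
    also have "\<dots> = (\<Sum>k\<in>col_labels n. H n j i k \<cdot> strip (eA k) (gen (as', u)))" using i by simp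
    also have "\<dots> = strip (TA j) (bar_diff n (as, u))"
      unfolding Cons eA bar_diff_e strip_simps strip_T_merge[OF w' i j] strip_bar_cons by simp
    finally show ?thesis by (simp add: strip_gen Cons eA)
  next
    case (TA i)
    show ?thesis unfolding Cons TA bar_diff_T strip_simps strip_T_merge_T strip_bar_cons
      by (simp add: strip_gen)
  qed
qed

lemma strip_e_bar_d:
  assumes x: "chain n (bar_words n) x" and k: "k \<in> col_labels n"
  shows "strip (eA k) (bar_d n x) = bar_d n (strip (eA k) x)
    + (\<Sum>j\<in>row_labels n. xvar j k \<cdot> strip (TA j) x :: 'k::field bar_chain)"
proof -
  have "strip (eA k) (bar_d n x) = lin (\<lambda>w. strip (eA k) (bar_diff n w)) x"
    unfolding strip_def lin_lin ..
  also have "\<dots> = lin (\<lambda>w. bar_d n (strip (eA k) (gen w)) + (\<Sum>j\<in>row_labels n. xvar j k \<cdot> strip (TA j) (gen w))) x"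
  proof (rule lin_cong)
    fix w assume "w \<in> keys x"
    then have "(fst w, snd w) \<in> bar_words n" using x by (auto simp: chain_def)
    from strip_e_bar_diff[OF this k]
    show "strip (eA k) (bar_diff n w) = bar_d n (strip (eA k) (gen w))
      + (\<Sum>j\<in>row_labels n. xvar j k \<cdot> strip (TA j) (gen w :: 'k bar_chain))" by simp
  qed
  also have "\<dots> = bar_d n (strip (eA k) x) + (\<Sum>j\<in>row_labels n. xvar j k \<cdot> strip (TA j) x)"
    by (simp add: lin_fun_add lin_fun_sum lin_fun_scale strip_def lin_lin)
  finally show ?thesis .
qed

lemma strip_T_bar_d:
  assumes x: "chain n (bar_words n) x" and j: "j \<in> row_labels n"
  shows "strip (TA j) (bar_d n x)
    = (\<Sum>i\<in>col_labels n. \<Sum>k\<in>col_labels n. H n j i k \<cdot> strip (eA k) (strip (eA i) x))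
      - bar_d n (strip (TA j) x :: 'k::field bar_chain)"
proof -
  have "strip (TA j) (bar_d n x) = lin (\<lambda>w. strip (TA j) (bar_diff n w)) x"
    unfolding strip_def lin_lin ..
  also have "\<dots> = lin (\<lambda>w. (\<Sum>i\<in>col_labels n. \<Sum>k\<in>col_labels n. H n j i k \<cdot> strip (eA k) (strip (eA i) (gen w)))
      - bar_d n (strip (TA j) (gen w))) x"
  proof (rule lin_cong)
    fix w assume "w \<in> keys x"
    then have "(fst w, snd w) \<in> bar_words n" using x by (auto simp: chain_def)
    from strip_T_bar_diff[OF this j]
    show "strip (TA j) (bar_diff n w)
      = (\<Sum>i\<in>col_labels n. \<Sum>k\<in>col_labels n. H n j i k \<cdot> strip (eA k) (strip (eA i) (gen w)))
      - bar_d n (strip (TA j) (gen w :: 'k bar_chain))" by simp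
  qed
  also have "\<dots> = (\<Sum>i\<in>col_labels n. \<Sum>k\<in>col_labels n. H n j i k \<cdot> strip (eA k) (strip (eA i) x))
      - bar_d n (strip (TA j) x)"
    by (simp add: lin_fun_diff lin_fun_sum lin_fun_scale strip_def lin_lin)
  finally show ?thesis .
qed

lemma lookup_strip: "lookup (strip g x) (as, u) = lookup x (g # as, u)"
proof -
  have "lookup (strip g x) (as, u) = (\<Sum>w\<in>keys x. if w = (g # as, u) then lookup x w else 0)"
    unfolding strip_def lookup_lin
    by (rule sum.cong[OF refl]) (auto simp: lookup_gen split: list.splits if_splits)
  then show ?thesis by (simp add: in_keys_iff)
qed

lemma U_word_decomposition:
  assumes x: "chain n S x" and S: "S \<subseteq> bar_words n"
    and e: "\<And>k. k \<in> col_labels n \<Longrightarrow> strip (eA k) x = 0" and T: "\<And>j. j \<in> row_labels n \<Longrightarrow> strip (TA j) x = 0"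
  obtains u where "chain n {g. ([], g) \<in> S} u" "x = U_word u"
proof
  define u where "u = (\<Sum>g\<in>snd ` keys x. lookup x ([], g) \<cdot> gen g)"
  have u: "lookup u g = lookup x ([], g)" for g
  proof (cases "g \<in> snd ` keys x")
    case True
    then show ?thesis by (simp add: u_def lookup_sum_gen)
  next
    case False
    then have "([], g) \<notin> keys x" by force
    with False show ?thesis by (simp add: u_def lookup_sum_gen in_keys_iff)
  qed
  show "chain n {g. ([], g) \<in> S} u"
    unfolding chain_def u using x by (auto simp: chain_def in_keys_iff u)
  show "x = U_word u"
  proof (rule poly_mapping_eqI)
    fix w :: bar_word
    obtain as v where w: "w = (as, v)" by (cases w)
    have "lookup (U_word u) (as, v) = (\<Sum>g\<in>keys u. if g = v then (if as = [] then lookup u g else 0) else 0)"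
      unfolding relabel_lin lookup_lin by (rule sum.cong[OF refl]) (auto simp: lookup_gen)
    then have U: "lookup (U_word u) (as, v) = (if as = [] then lookup x ([], v) else 0)"
      using u[of v] by (simp add: in_keys_iff)
    show "lookup x w = lookup (U_word u) w"
    proof (cases as)
      case Nil
      then show ?thesis using U by (simp add: w)
    next
      case (Cons g as')
      have "lookup x (g # as', v) = 0"
      proof (cases "g \<in> A_gens n")
        case True
        then have "strip g x = 0" using e T by (cases g) auto
        then show ?thesis using lookup_strip[of g x as' v] by simp
      next
        case False
        then have "(g # as', v) \<notin> keys x" using x S by (auto simp: chain_def)
        then show ?thesis by (simp add: in_keys_iff)
      qed
      then show ?thesis using U by (simp add: w Cons)
    qed
  qed
qed

lemma U_word_inject: "U_word x = U_word y \<Longrightarrow> x = y"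
proof (rule poly_mapping_eqI)
  fix g assume *: "U_word x = U_word y"
  have "lookup (U_word z) ([], g) = lookup z g" for z :: "'a U_chain"
  proof -
    have "lookup (U_word z) ([], g) = (\<Sum>h\<in>keys z. if h = g then lookup z h else 0)"
      unfolding relabel_lin lookup_lin by (rule sum.cong[OF refl]) (auto simp: lookup_gen)
    then show ?thesis by (simp add: in_keys_iff)
  qed
  then show "lookup x g = lookup y g" using * by metis
qed

lemma chain_strip:
  assumes "chain n S x" "\<And>as u. (g # as, u) \<in> S \<Longrightarrow> (as, u) \<in> T"
  shows "chain n T (strip g x)"
  unfolding strip_def by (rule chain_lin[OF assms(1)]) (auto simp: assms(2) split: list.split)

lemma chain_relabel: "chain n S x \<Longrightarrow> (\<And>g. g \<in> S \<Longrightarrow> f g \<in> T) \<Longrightarrow> chain n T (relabel f x)"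
  unfolding relabel_lin by (rule chain_lin) auto

text \<open>The degree is an integer so that the set of words of degree \<open>r - 2\<close> is empty for \<open>r = 1\<close>.\<close>

definition words :: "nat \<Rightarrow> int \<Rightarrow> bar_word set"
  where "words n r = {w \<in> bar_words n. int (word_deg w) = r}"

lemma words_subset: "words n r \<subseteq> bar_words n"
  by (auto simp: words_def)

lemma chain_bar_d:
  assumes "chain n (words n r) x" "2 \<le> n" "r = s + 1" shows "chain n (words n s) (bar_d n x)"
proof (rule chain_lin[OF assms(1)])
  fix w assume "w \<in> words n r"
  then have w: "(fst w, snd w) \<in> bar_words n" and r: "int (word_deg w) = r" by (auto simp: words_def)
  have "chain n {w' \<in> bar_words n. word_deg w' + 1 = word_deg w} (bar_diff n w)"
    using graded_chain_chain[OF graded_bar_diff[OF assms(2) w]] by simp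
  then show "chain n (words n s) (bar_diff n w)"
    by (rule chain_mono) (use r assms(3) in \<open>auto simp: words_def\<close>)
qed

text \<open>A cycle modulo the minors is exhibited as a boundary by reading off, letter by letter, which
  combination of words can have it as boundary: the coefficients of \<open>[e\<^sub>i|\<dots>]\<close> are forced by \<open>d x\<close>
  itself, those of \<open>[T\<^sub>j|\<dots>]\<close> come from exactness of the Hilbert-Burch complex, and what is left is a
  cycle of \<open>\<U>\<close>.\<close>

theorem bar_acyclic:
  fixes x :: "'k::field bar_chain"
  assumes n: "2 \<le> n" and r: "1 \<le> r"
    and x: "chain n (words n r) x" and y: "\<And>i. i \<in> col_labels n \<Longrightarrow> chain n (words n (r - 1)) (y i)"
    and dx: "bar_d n x = (\<Sum>i\<in>col_labels n. G n i \<cdot> y i)"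
  shows "\<exists>z. chain n (words n (r + 1)) z \<and> bar_d n z = x"
proof -
  have n1: "1 \<le> n" using n by simp
  have xw: "chain n (bar_words n) x" by (rule chain_mono[OF x words_subset])
  have yw: "chain n (bar_words n) (y i)" if "i \<in> col_labels n" for i
    by (rule chain_mono[OF y[OF that] words_subset])
  have "(\<Sum>k\<in>col_labels n. G n k \<cdot> (strip (eA k) x - bar_d n (y k))) = 0"
    using bar_d_square[OF xw n1] unfolding dx lin_simps by (simp add: scale_diff_right sum_subtractf)
  moreover have "chain n (words n (r - 2)) (strip (eA k) x - bar_d n (y k))" if "k \<in> col_labels n" for k
    by (intro chain_diff chain_strip[OF x] chain_bar_d[OF y[OF that] n]) (auto simp: words_def)
  ultimately obtain t where t: "\<And>j. chain n (words n (r - 2)) (t j)"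
    "\<And>k. k \<in> col_labels n \<Longrightarrow> strip (eA k) x - bar_d n (y k) = (\<Sum>j\<in>row_labels n. xvar j k \<cdot> t j)"
    using Hilbert_Burch_exact_chain[of n "words n (r - 2)" "\<lambda>k. strip (eA k) x - bar_d n (y k)"] by blast
  define v where "v = (\<Sum>i\<in>col_labels n. bar_cons (eA i) (y i)) + (\<Sum>j\<in>row_labels n. bar_cons (TA j) (t j))"
  have v: "chain n (words n (r + 1)) v"
    unfolding v_def by (intro chain_add chain_sum chain_relabel[OF y] chain_relabel[OF t(1)])
      (auto simp: words_def word_cons_def)
  have vw: "chain n (bar_words n) v" by (rule chain_mono[OF v words_subset])
  have strip_v_e: "strip (eA k) v = y k" if "k \<in> col_labels n" for k
    using that unfolding v_def strip_simps strip_bar_cons by simp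
  have strip_v_T: "strip (TA j) v = t j" if "j \<in> row_labels n" for j
    using that unfolding v_def strip_simps strip_bar_cons by simp
  define x' where "x' = x - bar_d n v"
  have e0: "strip (eA k) x' = 0" if k: "k \<in> col_labels n" for k
  proof -
    have "(\<Sum>j\<in>row_labels n. xvar j k \<cdot> strip (TA j) v) = (\<Sum>j\<in>row_labels n. xvar j k \<cdot> t j)"
      by (rule sum.cong[OF refl]) (simp add: strip_v_T)
    then show ?thesis
      unfolding x'_def strip_simps strip_e_bar_d[OF vw k] strip_v_e[OF k] by (simp add: t(2)[OF k, symmetric])
  qed
  have T0: "strip (TA j) x' = 0" if j: "j \<in> row_labels n" for j
  proof (rule rows_independent_chain[where t = "\<lambda>j. strip (TA j) x'", OF _ j])
    fix k assume k: "k \<in> col_labels n"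
    \<comment> \<open>The columns of \<open>X\<close> turn all three contributions to the \<open>T\<close>-part of \<open>x - d v\<close> into
      expressions in the \<open>e\<close>-parts, where they cancel.\<close>
    define E where "E = (\<Sum>i\<in>col_labels n. G n i \<cdot> strip (eA k) (y i))"
    define F where "F = (\<Sum>i\<in>col_labels n. G n i \<cdot> strip (eA i) (y k))"
    have "E = strip (eA k) (bar_d n x)" by (simp add: dx strip_simps E_def)
    then have 1: "(\<Sum>j\<in>row_labels n. xvar j k \<cdot> strip (TA j) x) = E - bar_d n (strip (eA k) x)"
      unfolding strip_e_bar_d[OF xw k] by simp
    have "(\<Sum>j\<in>row_labels n. xvar j k \<cdot> (\<Sum>i\<in>col_labels n. \<Sum>l\<in>col_labels n. H n j i l \<cdot> strip (eA l) (y i)))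
        = (\<Sum>i\<in>col_labels n. \<Sum>j\<in>row_labels n. \<Sum>l\<in>col_labels n. (H n j i l * xvar j k) \<cdot> strip (eA l) (y i))"
      unfolding scale_sum_right scale_scale by (subst sum.swap) (simp only: mult.commute)
    also have "\<dots> = (\<Sum>i\<in>col_labels n. \<Sum>l\<in>col_labels n. \<Sum>j\<in>row_labels n. (H n j i l * xvar j k) \<cdot> strip (eA l) (y i))"
      by (rule sum.cong[OF refl], rule sum.swap)
    also have "\<dots> = (\<Sum>i\<in>col_labels n. \<Sum>l\<in>col_labels n. (if l = k then G n i \<cdot> strip (eA l) (y i) else 0)
        - (if i = k then G n l \<cdot> strip (eA l) (y i) else 0))"
      unfolding scale_sum_left[symmetric]
      by (intro sum.cong refl) (simp add: sum_H_column[OF _ _ k] scale_diff_left)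
    also have "\<dots> = E - (\<Sum>i\<in>col_labels n. if i = k then F else 0)"
    proof -
      have "(\<Sum>i\<in>col_labels n. \<Sum>l\<in>col_labels n. if i = k then G n l \<cdot> strip (eA l) (y i) else 0)
          = (\<Sum>i\<in>col_labels n. if i = k then F else 0)"
        by (rule sum.cong[OF refl]) (simp add: F_def)
      then show ?thesis unfolding sum_subtractf E_def using k by simp
    qed
    also have "\<dots> = E - F" using k by simp
    finally have 2: "(\<Sum>j\<in>row_labels n. xvar j k \<cdot> (\<Sum>i\<in>col_labels n. \<Sum>l\<in>col_labels n. H n j i l \<cdot> strip (eA l) (y i)))
        = E - F" .
    have "(\<Sum>j\<in>row_labels n. xvar j k \<cdot> bar_d n (t j)) = bar_d n (strip (eA k) x - bar_d n (y k))"
      unfolding t(2)[OF k] lin_simps ..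
    also have "\<dots> = bar_d n (strip (eA k) x) - F"
      unfolding lin_diff bar_d_square[OF yw[OF k] n1] F_def ..
    finally have 3: "(\<Sum>j\<in>row_labels n. xvar j k \<cdot> bar_d n (t j)) = bar_d n (strip (eA k) x) - F" .
    have "strip (TA j) x' = strip (TA j) x - ((\<Sum>i\<in>col_labels n. \<Sum>l\<in>col_labels n. H n j i l \<cdot> strip (eA l) (y i)) - bar_d n (t j))"
      if "j \<in> row_labels n" for j
      unfolding x'_def strip_simps strip_T_bar_d[OF vw that] strip_v_T[OF that] by (simp add: strip_v_e)
    then have "(\<Sum>j\<in>row_labels n. xvar j k \<cdot> strip (TA j) x') = (\<Sum>j\<in>row_labels n. xvar j k \<cdot>
       (strip (TA j) x - ((\<Sum>i\<in>col_labels n. \<Sum>l\<in>col_labels n. H n j i l \<cdot> strip (eA l) (y i)) - bar_d n (t j))))"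
      by simp
    also have "\<dots> = 0" unfolding scale_diff_right sum_subtractf 1 2 3 by simp
    finally show "(\<Sum>j\<in>row_labels n. xvar j k \<cdot> strip (TA j) x') = 0" .
  qed
  have x': "chain n (words n r) x'"
    unfolding x'_def by (intro chain_diff x chain_bar_d[OF v n]) simp
  obtain u where u: "chain n {g. ([], g) \<in> words n r} u" "x' = U_word u"
    using U_word_decomposition[OF x' words_subset e0 T0] by blast
  have "bar_d n x' = 0"
    unfolding x'_def lin_diff bar_d_square[OF vw n1] dx
    by (simp add: strip_v_e)
  then have "U_word (dU n u) = 0" unfolding u(2) bar_d_U_word .
  then have du: "dU n u = 0"
    by (metis (no_types, lifting) U_word_inject relabel_0)
  have "{g. ([], g) \<in> words n r} = U_basis n (nat r)"
    using r by (auto simp: words_def U_basis_eq)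
  then obtain c where c: "chain n (U_basis n (Suc (nat r))) c" "dU n c = u"
    using U_exact[of n "nat r" u] u(1) du n r by (auto simp: Suc_le_eq)
  have "chain n (words n (r + 1)) (U_word c)"
    by (rule chain_relabel[OF c(1)]) (use r in \<open>auto simp: words_def U_basis_eq\<close>)
  then have "chain n (words n (r + 1)) (v + U_word c) \<and> bar_d n (v + U_word c) = x"
    using v u(2) c(2) unfolding x'_def lin_add bar_d_U_word by (simp add: algebra_simps)
  then show ?thesis by blast
qed


section \<open>The quotient ring\<close>

lemma Q_ring_simps [simp]:
  "x \<otimes>\<^bsub>Q_ring n\<^esub> y = x * y" "x \<oplus>\<^bsub>Q_ring n\<^esub> y = x + y" "\<one>\<^bsub>Q_ring n\<^esub> = 1" "\<zero>\<^bsub>Q_ring n\<^esub> = 0"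
  by (simp_all add: Q_ring_def)

lemma cring_Q_ring: "cring (Q_ring n :: 'k::field qpoly ring)"
proof (intro cringI abelian_groupI comm_monoidI)
  fix x :: "'k qpoly" assume "x \<in> carrier (Q_ring n)"
  then show "\<exists>y\<in>carrier (Q_ring n). y \<oplus>\<^bsub>Q_ring n\<^esub> x = \<zero>\<^bsub>Q_ring n\<^esub>"
    by (intro bexI[of _ "- x"]) (simp_all add: carrier_Q_ring)
qed (simp_all add: carrier_Q_ring algebra_simps)

lemma Fmin_G_set: "Fmin n ` {1..n + 1} \<subseteq> carrier (Q_ring n)"
  unfolding col_labels_def[symmetric] by (auto simp: carrier_Q_ring Fmin_G)

lemma ideal_I: "ideal (I_ideal n) (Q_ring n :: 'k::field qpoly ring)"
  unfolding I_ideal_def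
  by (rule ring.genideal_ideal[OF cring.axioms(1)[OF cring_Q_ring] Fmin_G_set])

lemma G_Fmin: "i \<in> col_labels n \<Longrightarrow> G n i = (-1) ^ (i + 1) * (Fmin n i :: 'k::field qpoly)"
  by (simp only: Fmin_G sign_square)

lemma I_ideal_iff:
  "p \<in> I_ideal n \<longleftrightarrow> (\<exists>y. (\<forall>i. over_vars (vars n) (y i)) \<and> p = (\<Sum>i\<in>col_labels n. G n i * y i))"
  for p :: "'k::field qpoly"
proof -
  define J :: "'k qpoly set"
    where "J = {\<Sum>i\<in>col_labels n. G n i * y i | y. \<forall>i. over_vars (vars n) (y i)}"
  have JI: "(\<Sum>i\<in>col_labels n. G n i * y i) \<in> J" if "\<And>i. over_vars (vars n) (y i)" for y
    unfolding J_def using that by blast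
  interpret Q: cring "Q_ring n :: 'k qpoly ring" by (rule cring_Q_ring)
  interpret I: ideal "I_ideal n" "Q_ring n :: 'k qpoly ring" by (rule ideal_I)
  have gens: "Fmin n i \<in> (I_ideal n :: 'k qpoly set)" if "i \<in> col_labels n" for i
    unfolding I_ideal_def using Q.genideal_self[OF Fmin_G_set] that by (auto simp: col_labels_def)
  have "J \<subseteq> I_ideal n"
  proof
    fix p assume "p \<in> J"
    then obtain y where y: "\<And>i. over_vars (vars n) (y i)" and p: "p = (\<Sum>i\<in>col_labels n. G n i * y i)"
      by (auto simp: J_def)
    have gen_mult: "G n i * y i \<in> I_ideal n" if i: "i \<in> col_labels n" for i
    proof -
      have "((-1) ^ (i + 1) * y i) \<otimes>\<^bsub>Q_ring n\<^esub> Fmin n i \<in> I_ideal n"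
        by (rule I.I_l_closed[OF gens[OF i]]) (simp add: carrier_Q_ring y)
      then show ?thesis by (simp only: Q_ring_simps G_Fmin[OF i] ac_simps)
    qed
    have "A \<subseteq> col_labels n \<Longrightarrow> (\<Sum>i\<in>A. G n i * y i) \<in> I_ideal n" for A
    proof (induction A rule: infinite_finite_induct)
      case (insert i A)
      then show ?case using additive_subgroup.a_closed[OF I.additive_subgroup_axioms,
          of "G n i * y i" "\<Sum>i\<in>A. G n i * y i"] gen_mult by simp
    qed (use additive_subgroup.zero_closed[OF I.additive_subgroup_axioms] in simp_all)
    then show "p \<in> I_ideal n" using p by simp
  qed
  moreover have "I_ideal n \<subseteq> J"
    unfolding I_ideal_def
  proof (rule Q.genideal_minimal)
    show "ideal J (Q_ring n)"
    proof (rule idealI[OF Q.ring_axioms])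
      show "subgroup J (add_monoid (Q_ring n))"
      proof (rule Q.add.subgroupI)
        show "J \<subseteq> carrier (Q_ring n)" by (auto simp: J_def carrier_Q_ring intro!: over_vars_sum)
        have "0 \<in> J" using JI[of "\<lambda>_. 0"] by simp
        then show "J \<noteq> {}" by blast
        fix a b assume "a \<in> J"
        then obtain y where y: "\<And>i. over_vars (vars n) (y i)" "a = (\<Sum>i\<in>col_labels n. G n i * y i)"
          by (auto simp: J_def)
        have a: "a \<in> carrier (Q_ring n)" by (simp add: y carrier_Q_ring over_vars_sum)
        have "- a \<in> carrier (Q_ring n)" using a by (simp add: carrier_Q_ring)
        then have "\<ominus>\<^bsub>Q_ring n\<^esub> a = - a" using a Q.minus_equality[of "- a" a] by simp
        also have "\<dots> = (\<Sum>i\<in>col_labels n. G n i * (- y i))" by (simp add: y sum_negf)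
        finally have minus: "\<ominus>\<^bsub>Q_ring n\<^esub> a = (\<Sum>i\<in>col_labels n. G n i * (- y i))" .
        show "\<ominus>\<^bsub>Q_ring n\<^esub> a \<in> J" unfolding minus
          by (rule JI) (simp only: over_vars_uminus y(1))
        assume "b \<in> J"
        then obtain z where z: "\<And>i. over_vars (vars n) (z i)" "b = (\<Sum>i\<in>col_labels n. G n i * z i)"
          by (auto simp: J_def)
        have plus: "a + b = (\<Sum>i\<in>col_labels n. G n i * (y i + z i))" by (simp add: y z sum.distrib distrib_left)
        show "a \<oplus>\<^bsub>Q_ring n\<^esub> b \<in> J" unfolding Q_ring_simps plus
          by (rule JI) (intro over_vars_add y(1) z(1))
      qed
      fix a x :: "'k qpoly" assume "a \<in> J" and x: "x \<in> carrier (Q_ring n)"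
      then obtain y where y: "\<And>i. over_vars (vars n) (y i)" "a = (\<Sum>i\<in>col_labels n. G n i * y i)"
        by (auto simp: J_def)
      have mult: "x * a = (\<Sum>i\<in>col_labels n. G n i * (x * y i))" by (simp add: y sum_distrib_left ac_simps)
      have "x * a \<in> J" unfolding mult by (rule JI) (use x y(1) in \<open>simp add: carrier_Q_ring\<close>)
      then show "x \<otimes>\<^bsub>Q_ring n\<^esub> a \<in> J" "a \<otimes>\<^bsub>Q_ring n\<^esub> x \<in> J" by (simp_all add: mult.commute)
    qed
    show "Fmin n ` {1..n + 1} \<subseteq> J"
    proof
      fix p :: "'k qpoly" assume "p \<in> Fmin n ` {1..n + 1}"
      then obtain i where i: "i \<in> col_labels n" "p = Fmin n i" by (auto simp: col_labels_def)
      have p: "p = (\<Sum>j\<in>col_labels n. G n j * (if j = i then (-1) ^ (i + 1) else 0))"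
        using i by (simp add: Fmin_G if_distrib mult.commute cong: if_cong)
      show "p \<in> J" unfolding p by (rule JI) simp
    qed
  qed
  ultimately have "I_ideal n = J" by blast
  then show ?thesis unfolding J_def by blast
qed

lemma I_ideal_add: "p \<in> I_ideal n \<Longrightarrow> q \<in> I_ideal n \<Longrightarrow> p + q \<in> I_ideal n"
  for p q :: "'k::field qpoly"
  using additive_subgroup.a_closed[OF ideal.axioms(1)[OF ideal_I], of p n q] by simp

lemma I_ideal_0 [simp]: "0 \<in> (I_ideal n :: 'k::field qpoly set)"
proof -
  have "\<zero>\<^bsub>Q_ring n\<^esub> \<in> (I_ideal n :: 'k qpoly set)"
    by (rule additive_subgroup.zero_closed[OF ideal.axioms(1)[OF ideal_I]])
  then show ?thesis by simp
qed

lemma I_ideal_mult: "p \<in> I_ideal n \<Longrightarrow> over_vars (vars n) q \<Longrightarrow> q * p \<in> I_ideal n"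
  for p q :: "'k::field qpoly"
  using ideal.I_l_closed[OF ideal_I, of p n q] by (simp add: carrier_Q_ring)

lemma I_ideal_uminus: "p \<in> I_ideal n \<Longrightarrow> - p \<in> I_ideal n" for p :: "'k::field qpoly"
  using I_ideal_mult[of p n "- 1"] by simp

lemma I_ideal_diff: "p \<in> I_ideal n \<Longrightarrow> q \<in> I_ideal n \<Longrightarrow> p - q \<in> I_ideal n" for p q :: "'k::field qpoly"
  using I_ideal_add[of p n "- q"] I_ideal_uminus[of q n] by simp

lemma I_ideal_sum: "(\<And>i. i \<in> A \<Longrightarrow> f i \<in> I_ideal n) \<Longrightarrow> (\<Sum>i\<in>A. f i) \<in> I_ideal n"
  for f :: "'a \<Rightarrow> 'k::field qpoly"
  by (induction A rule: infinite_finite_induct) (auto intro: I_ideal_add)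

lemma I_ideal_over_vars: "p \<in> I_ideal n \<Longrightarrow> over_vars (vars n) p" for p :: "'k::field qpoly"
  unfolding I_ideal_iff by (auto intro!: over_vars_sum)

lemma cls_eq: "cls n p = {i + p | i. i \<in> I_ideal n}"
  by (auto simp: cls_def a_r_coset_def' )

lemma mem_cls: "q \<in> cls n p \<longleftrightarrow> q - p \<in> I_ideal n" for p q :: "'k::field qpoly"
  unfolding cls_eq by (auto intro: exI[of _ "q - p"])

lemma cls_eq_iff: "cls n p = cls n q \<longleftrightarrow> p - q \<in> I_ideal n" for p q :: "'k::field qpoly"
proof
  assume eq: "cls n p = cls n q"
  have "p \<in> cls n p" by (simp add: mem_cls)
  then have "p \<in> cls n q" unfolding eq .
  then show "p - q \<in> I_ideal n" by (simp add: mem_cls)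
next
  assume pq: "p - q \<in> I_ideal n"
  have "r - p \<in> I_ideal n \<longleftrightarrow> r - q \<in> I_ideal n" for r
    using I_ideal_add[OF pq, of "r - p"] I_ideal_diff[OF _ pq, of "r - q"] by auto
  then show "cls n p = cls n q" by (auto simp: mem_cls)
qed

lemma cring_R_ring: "cring (R_ring n :: 'k::field qpoly set ring)"
  unfolding R_ring_def by (rule ideal.quotient_is_cring[OF ideal_I cring_Q_ring])

lemma cls_ring_hom: "cls n \<in> Ring.ring_hom (Q_ring n) (R_ring n :: 'k::field qpoly set ring)"
  using ideal.rcos_ring_hom[OF ideal_I] unfolding R_ring_def cls_def[abs_def] .

lemma carrier_R_ring: "carrier (R_ring n) = cls n ` {p. over_vars (vars n) p}"
  by (auto simp: R_ring_def FactRing_def A_RCOSETS_def' cls_def carrier_Q_ring)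

lemma carrier_R_ringE:
  assumes "a \<in> carrier (R_ring n)" obtains p where "over_vars (vars n) p" "a = cls n p"
  using assms by (auto simp: carrier_R_ring)

lemma cls_closed [simp]: "over_vars (vars n) p \<Longrightarrow> cls n p \<in> carrier (R_ring n)"
  by (simp add: carrier_R_ring)

lemma cls_add: "over_vars (vars n) p \<Longrightarrow> over_vars (vars n) q \<Longrightarrow> cls n p \<oplus>\<^bsub>R_ring n\<^esub> cls n q = cls n (p + q)"
  using ring_hom_add[OF cls_ring_hom, of p n q] by (simp add: carrier_Q_ring)

lemma cls_mult: "over_vars (vars n) p \<Longrightarrow> over_vars (vars n) q \<Longrightarrow> cls n p \<otimes>\<^bsub>R_ring n\<^esub> cls n q = cls n (p * q)"
  using ring_hom_mult[OF cls_ring_hom, of p n q] by (simp add: carrier_Q_ring)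

lemma cls_one: "\<one>\<^bsub>R_ring n\<^esub> = cls n 1"
  unfolding ring_hom_one[OF cls_ring_hom, symmetric] Q_ring_simps ..

lemma cls_zero: "\<zero>\<^bsub>R_ring n\<^esub> = cls n (0 :: 'k::field qpoly)"
proof -
  have "cls n \<zero>\<^bsub>Q_ring n\<^esub> = (\<zero>\<^bsub>R_ring n\<^esub> :: 'k qpoly set)"
    by (rule ring_hom_zero[OF cls_ring_hom]) (simp_all add: cring.axioms(1) cring_Q_ring cring_R_ring)
  then show ?thesis by simp
qed

lemma cls_uminus:
  assumes "over_vars (vars n) p" shows "\<ominus>\<^bsub>R_ring n\<^esub> cls n p = cls n (- p :: 'k::field qpoly)"
proof -
  interpret R: cring "R_ring n :: 'k qpoly set ring" by (rule cring_R_ring)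
  show ?thesis by (rule R.minus_equality) (use assms in \<open>simp_all add: cls_add cls_zero\<close>)
qed

lemma cls_eq_0: "cls n p = cls n 0 \<longleftrightarrow> p \<in> I_ideal n" for p :: "'k::field qpoly"
  by (simp add: cls_eq_iff)

lemma cls_finsum:
  assumes "finite A" "\<And>i. i \<in> A \<Longrightarrow> over_vars (vars n) (f i)"
  shows "(\<Oplus>\<^bsub>R_ring n\<^esub>i\<in>A. cls n (f i)) = cls n (\<Sum>i\<in>A. f i :: 'k::field qpoly)"
proof -
  interpret R: cring "R_ring n :: 'k qpoly set ring" by (rule cring_R_ring)
  show ?thesis using assms
  proof (induction A rule: finite_induct)
    case (insert i A)
    then have "(\<Oplus>\<^bsub>R_ring n\<^esub>i\<in>insert i A. cls n (f i)) = cls n (f i) \<oplus>\<^bsub>R_ring n\<^esub> (\<Oplus>\<^bsub>R_ring n\<^esub>i\<in>A. cls n (f i))"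
      by (intro R.finsum_insert) auto
    also have "\<dots> = cls n (f i + (\<Sum>i\<in>A. f i))"
      using insert by (simp add: cls_add over_vars_sum)
    finally show ?case using insert by simp
  qed (simp add: cls_zero)
qed

lemma R_grade_cls: "over_vars (vars n) p \<Longrightarrow> homogeneous d p \<Longrightarrow> cls n p \<in> R_grade n d"
  by (auto simp: R_grade_def carrier_Q_ring)

lemma cls_R_max_ideal:
  assumes p: "over_vars (vars n) p" "lookup p 0 = 0"
  shows "cls n p \<in> (R_max_ideal n :: 'k::field qpoly set set)"
proof -
  interpret R: cring "R_ring n :: 'k qpoly set ring" by (rule cring_R_ring)
  let ?X = "(\<lambda>(i, j). cls n (xvar i j)) ` vars n :: 'k qpoly set set"
  have X: "?X \<subseteq> carrier (R_ring n)" by auto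
  interpret M: ideal "R_max_ideal n" "R_ring n :: 'k qpoly set ring"
    unfolding R_max_ideal_def by (rule R.genideal_ideal[OF X])
  have mono: "cls n (single m c) \<in> R_max_ideal n" if m: "keys m \<subseteq> vars n" "m \<noteq> 0" for m and c :: 'k
  proof -
    obtain v where v: "v \<in> keys m" using m(2) by (metis all_not_in_conv keys_eq_empty)
    obtain i j where ij: "v = (i, j)" by (cases v)
    have vv: "(i, j) \<in> vars n" using m(1) v ij by auto
    have "m = (m - single v 1) + single v 1"
      using v by (intro poly_mapping_eqI) (auto simp: lookup_add lookup_minus lookup_single when_def in_keys_iff)
    then have s: "single m c = single (m - single v 1) c * xvar i j"
      unfolding xvar_def mult_single ij[symmetric] by simp
    have o: "over_vars (vars n) (single (m - single v 1) c)"
      using m(1) by (auto simp: over_vars_def in_keys_iff lookup_minus split: if_splits)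
    have "cls n (xvar i j :: 'k qpoly) \<in> R_max_ideal n"
      unfolding R_max_ideal_def by (rule subsetD[OF R.genideal_self[OF X]]) (use vv in force)
    from M.I_l_closed[OF this cls_closed[OF o]] show ?thesis
      using o vv by (simp add: cls_mult s)
  qed
  have "finite A \<Longrightarrow> A \<subseteq> keys p \<Longrightarrow> cls n (\<Sum>m\<in>A. single m (lookup p m)) \<in> R_max_ideal n" for A
  proof (induction A rule: finite_induct)
    case empty
    show ?case using additive_subgroup.zero_closed[OF M.additive_subgroup_axioms] by (simp add: cls_zero)
  next
    case (insert m A)
    have ov: "over_vars (vars n) (single m (lookup p m))" if "m \<in> keys p" for m
      using p(1) that by (auto simp: over_vars_def)
    have "m \<in> keys p" using insert by simp
    then have m: "m \<noteq> 0" "keys m \<subseteq> vars n" "over_vars (vars n) (single m (lookup p m))"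
      using p ov by (auto simp: over_vars_def in_keys_iff)
    have A: "over_vars (vars n) (\<Sum>m\<in>A. single m (lookup p m))"
      by (rule over_vars_sum, rule ov) (use insert.prems in auto)
    have "cls n (\<Sum>m\<in>A. single m (lookup p m)) \<in> R_max_ideal n" using insert by simp
    from additive_subgroup.a_closed[OF M.additive_subgroup_axioms mono[OF m(2,1), of "lookup p m"] this]
    show ?case using insert.hyps by (simp add: cls_add[OF m(3) A])
  qed
  from this[OF finite_keys order_refl] show ?thesis
    using poly_mapping_sum_singles[of p] by simp
qed


section \<open>Vectors over the quotient ring\<close>

definition vec_cls :: "nat \<Rightarrow> 's set \<Rightarrow> ('s \<Rightarrow>\<^sub>0 'k::field qpoly) \<Rightarrow> 's \<Rightarrow> 'k qpoly set"
  where "vec_cls n S x = (\<lambda>s\<in>S. cls n (lookup x s))"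

lemma free_module_simps [simp]:
  "carrier (free_module R S) = (S \<rightarrow>\<^sub>E carrier R)"
  "v \<oplus>\<^bsub>free_module R S\<^esub> w = (\<lambda>s\<in>S. v s \<oplus>\<^bsub>R\<^esub> w s)"
  "\<zero>\<^bsub>free_module R S\<^esub> = (\<lambda>s\<in>S. \<zero>\<^bsub>R\<^esub>)"
  "r \<odot>\<^bsub>free_module R S\<^esub> v = (\<lambda>s\<in>S. r \<otimes>\<^bsub>R\<^esub> v s)"
  by (simp_all add: free_module_def)

lemma vec_cls_closed: "chain n S x \<Longrightarrow> vec_cls n S x \<in> S \<rightarrow>\<^sub>E carrier (R_ring n)"
  by (auto simp: vec_cls_def chain_def)

lemma vec_cls_cases:
  assumes "finite S" "v \<in> S \<rightarrow>\<^sub>E carrier (R_ring n)"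
  obtains x where "chain n S x" "v = vec_cls n S x"
proof -
  have "\<exists>p. over_vars (vars n) p \<and> (s \<in> S \<longrightarrow> v s = cls n p)" for s
  proof (cases "s \<in> S")
    case True
    then have "v s \<in> carrier (R_ring n)" using assms(2) by auto
    then show ?thesis by (auto elim: carrier_R_ringE)
  qed (use over_vars_0 in blast)
  then obtain f where f: "\<And>s. over_vars (vars n) (f s)" "\<And>s. s \<in> S \<Longrightarrow> v s = cls n (f s)" by metis
  let ?x = "\<Sum>s\<in>S. f s \<cdot> gen s"
  have "chain n S ?x" by (rule chain_of_lookups[OF assms(1) order_refl f(1)])
  moreover have "v = vec_cls n S ?x"
    using assms f(2) by (intro extensionalityI[of v S]) (auto simp: vec_cls_def lookup_sum_gen PiE_def)
  ultimately show ?thesis using that by blast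
qed

lemma vec_cls_add:
  assumes "chain n S x" "chain n S y"
  shows "vec_cls n S x \<oplus>\<^bsub>free_module (R_ring n) S\<^esub> vec_cls n S y = vec_cls n S (x + y)"
  using assms by (auto simp: vec_cls_def chain_def lookup_add cls_add fun_eq_iff)

lemma vec_cls_smult:
  assumes "chain n S x" "over_vars (vars n) p"
  shows "cls n p \<odot>\<^bsub>free_module (R_ring n) S\<^esub> vec_cls n S x = vec_cls n S (p \<cdot> x)"
  using assms by (auto simp: vec_cls_def chain_def cls_mult fun_eq_iff)

lemma vec_cls_eq_0:
  "vec_cls n S x = \<zero>\<^bsub>free_module (R_ring n) S\<^esub> \<longleftrightarrow> (\<forall>s\<in>S. lookup x s \<in> I_ideal n)"
proof -
  have "vec_cls n S x = \<zero>\<^bsub>free_module (R_ring n) S\<^esub> \<longleftrightarrow> (\<forall>s\<in>S. cls n (lookup x s) = cls n 0)"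
    by (auto simp: vec_cls_def cls_zero fun_eq_iff restrict_def)
  then show ?thesis by (simp add: cls_eq_0)
qed

lemma vec_cls_eq_0_iff:
  assumes x: "chain n S x"
  shows "vec_cls n S x = \<zero>\<^bsub>free_module (R_ring n) S\<^esub> \<longleftrightarrow>
    (\<exists>y. (\<forall>i\<in>col_labels n. chain n S (y i)) \<and> x = (\<Sum>i\<in>col_labels n. G n i \<cdot> y i))"
  (is "?L \<longleftrightarrow> ?R")
proof
  assume ?L
  then have "\<exists>y. (\<forall>i. over_vars (vars n) (y i)) \<and> (s \<in> S \<longrightarrow> lookup x s = (\<Sum>i\<in>col_labels n. G n i * y i))" for s
    unfolding vec_cls_eq_0 I_ideal_iff by (cases "s \<in> S") (auto intro: exI[of _ "\<lambda>_. 0"])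
  then obtain y where y: "\<And>s i. over_vars (vars n) (y s i)"
    "\<And>s. s \<in> S \<Longrightarrow> lookup x s = (\<Sum>i\<in>col_labels n. G n i * y s i)" by metis
  define z where "z i = (\<Sum>s\<in>keys x. y s i \<cdot> gen s)" for i
  have "chain n S (z i)" for i
    unfolding z_def by (rule chain_of_lookups[OF finite_keys _ y(1)]) (use x in \<open>simp add: chain_def\<close>)
  moreover have "x = (\<Sum>i\<in>col_labels n. G n i \<cdot> z i)"
  proof (rule poly_mapping_eqI)
    fix s
    have z: "lookup (z i) s = (if s \<in> keys x then y s i else 0)" for i
      unfolding z_def by (rule lookup_sum_gen[OF finite_keys])
    show "lookup x s = lookup (\<Sum>i\<in>col_labels n. G n i \<cdot> z i) s"
    proof (cases "s \<in> keys x")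
      case True
      then have "s \<in> S" using x by (auto simp: chain_def)
      then show ?thesis using True by (simp add: lookup_sum z y(2)[symmetric])
    next
      case False
      then show ?thesis by (simp add: lookup_sum z in_keys_iff)
    qed
  qed
  ultimately show ?R by (intro exI[of _ z]) simp
next
  assume ?R
  then obtain y where y: "\<And>i. i \<in> col_labels n \<Longrightarrow> chain n S (y i)" "x = (\<Sum>i\<in>col_labels n. G n i \<cdot> y i)" by blast
  have "lookup x s \<in> I_ideal n" for s
    unfolding I_ideal_iff
  proof (intro exI conjI allI)
    show "over_vars (vars n) (if i \<in> col_labels n then lookup (y i) s else 0)" for i
      using y(1) by (auto simp: chain_def)
    show "lookup x s = (\<Sum>i\<in>col_labels n. G n i * (if i \<in> col_labels n then lookup (y i) s else 0))"
      by (simp add: y(2) lookup_sum)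
  qed
  then show ?L unfolding vec_cls_eq_0 by blast
qed

lemma matrix_map_vec_cls:
  fixes x :: "'s \<Rightarrow>\<^sub>0 'k::field qpoly"
  assumes S: "finite S" and x: "chain n S x"
    and f: "\<And>s. s \<in> S \<Longrightarrow> chain n T (f s)" and D: "\<And>s t. s \<in> S \<Longrightarrow> t \<in> T \<Longrightarrow> D t s = cls n (lookup (f s) t)"
  shows "matrix_map (R_ring n) S T D (vec_cls n S x) = vec_cls n T (lin f x)"
proof -
  interpret R: cring "R_ring n :: 'k qpoly set ring" by (rule cring_R_ring)
  have "(\<Oplus>\<^bsub>R_ring n\<^esub>s\<in>S. D t s \<otimes>\<^bsub>R_ring n\<^esub> vec_cls n S x s) = cls n (lookup (lin f x) t)" if t: "t \<in> T" for t
  proof -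
    have ov: "over_vars (vars n) (lookup (f s) t * lookup x s)" if "s \<in> S" for s
      using f[OF that] x by (auto simp: chain_def)
    have "(\<Oplus>\<^bsub>R_ring n\<^esub>s\<in>S. D t s \<otimes>\<^bsub>R_ring n\<^esub> vec_cls n S x s)
        = (\<Oplus>\<^bsub>R_ring n\<^esub>s\<in>S. cls n (lookup (f s) t * lookup x s))"
    proof (rule R.finsum_cong')
      fix s assume s: "s \<in> S"
      show "D t s \<otimes>\<^bsub>R_ring n\<^esub> vec_cls n S x s = cls n (lookup (f s) t * lookup x s)"
        unfolding D[OF s t] vec_cls_def using s f[OF s] x by (auto simp: chain_def cls_mult)
    qed (use ov in auto)
    also have "\<dots> = cls n (\<Sum>s\<in>S. lookup (f s) t * lookup x s)" by (rule cls_finsum[OF S ov])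
    also have "(\<Sum>s\<in>S. lookup (f s) t * lookup x s) = lookup (lin f x) t"
      using lin_superset[OF S, of x f] x by (simp add: chain_def lookup_sum mult.commute)
    finally show ?thesis .
  qed
  then show ?thesis unfolding matrix_map_def vec_cls_def[of n T] by (intro restrict_ext)
qed


section \<open>Derivations of the quotient ring\<close>

lemma finite_vars [simp]: "finite (vars n)"
  by (simp add: vars_eq)

definition vector_field :: "nat \<Rightarrow> (nat \<times> nat \<Rightarrow>\<^sub>0 'k::field qpoly) \<Rightarrow> 'k qpoly \<Rightarrow> 'k qpoly"
  where "vector_field n a p = (\<Sum>v\<in>vars n. lookup a v * partial v p)"

lemma vector_field_add: "vector_field n a (p + q) = vector_field n a p + vector_field n a q"
  by (simp add: vector_field_def partial_add distrib_left sum.distrib)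

lemma vector_field_diff: "vector_field n a (p - q) = vector_field n a p - vector_field n a q"
  by (simp add: vector_field_def partial_diff right_diff_distrib sum_subtractf)

lemma vector_field_0 [simp]: "vector_field n a 0 = 0"
  by (simp add: vector_field_def)

lemma vector_field_sum: "vector_field n a (\<Sum>i\<in>A. f i) = (\<Sum>i\<in>A. vector_field n a (f i))"
  by (induction A rule: infinite_finite_induct) (simp_all add: vector_field_add)

lemma vector_field_mult: "vector_field n a (p * q) = vector_field n a p * q + p * vector_field n a q"
  by (simp add: vector_field_def partial_mult sum_distrib_left sum_distrib_right sum.distrib[symmetric] algebra_simps)

lemma vector_field_const [simp]: "vector_field n a (const c) = 0"
  by (simp add: vector_field_def)

lemma vector_field_1 [simp]: "vector_field n a 1 = 0"
  using vector_field_const[of n a 1] by (simp add: const_def)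

lemma vector_field_xvar: "(i, j) \<in> vars n \<Longrightarrow> vector_field n a (xvar i j) = lookup a (i, j)"
  by (simp add: vector_field_def partial_xvar if_distrib cong: if_cong del: mem_vars)

lemma over_vars_vector_field:
  "chain n (vars n) a \<Longrightarrow> over_vars (vars n) p \<Longrightarrow> over_vars (vars n) (vector_field n a p)"
  unfolding vector_field_def by (intro over_vars_sum over_vars_mult over_vars_partial chain_over_vars)

lemma vector_field_plus: "vector_field n (a + b) p = vector_field n a p + vector_field n b p"
  by (simp add: vector_field_def lookup_add distrib_right sum.distrib)

lemma vector_field_scale: "vector_field n (q \<cdot> a) p = q * vector_field n a p"
  by (simp add: vector_field_def sum_distrib_left mult.assoc)

definition Jacobian_column :: "nat \<Rightarrow> nat \<times> nat \<Rightarrow> nat \<Rightarrow>\<^sub>0 'k::field qpoly"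
  where "Jacobian_column n v = (\<Sum>i\<in>col_labels n. partial v (Fmin n i) \<cdot> gen i)"

lemma over_vars_Fmin: "i \<in> col_labels n \<Longrightarrow> over_vars (vars n) (Fmin n i)"
  by (simp add: Fmin_G)

lemma chain_Jacobian_column: "chain n (col_labels n) (Jacobian_column n v)"
  unfolding Jacobian_column_def
  by (intro chain_sum chain_scale chain_gen over_vars_partial over_vars_Fmin)

lemma lookup_Jacobian_column: "i \<in> col_labels n \<Longrightarrow> lookup (Jacobian_column n v) i = partial v (Fmin n i)"
  unfolding Jacobian_column_def by (subst lookup_sum_gen) simp_all

lemma lookup_Jacobian:
  assumes a: "chain n (vars n) a" and i: "i \<in> col_labels n"
  shows "lookup (lin (Jacobian_column n) a) i = vector_field n a (Fmin n i)"
  using lin_superset[OF finite_vars, of a n "Jacobian_column n"] a i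
  by (simp add: chain_def lookup_sum vector_field_def lookup_Jacobian_column)

text \<open>Vector fields that preserve the ideal of the minors; modulo that ideal their coefficients are
  the elements of \<open>ker J\<^sup>T\<^sub>R\<close>.\<close>

definition tangent :: "nat \<Rightarrow> (nat \<times> nat \<Rightarrow>\<^sub>0 'k::field qpoly) \<Rightarrow> bool"
  where "tangent n a \<longleftrightarrow> chain n (vars n) a \<and> (\<forall>i\<in>col_labels n. vector_field n a (Fmin n i) \<in> I_ideal n)"

lemma matrix_map_JT:
  assumes a: "chain n (vars n) a"
  shows "matrix_map (R_ring n) (vars n) {1..n + 1} (JT n) (vec_cls n (vars n) a)
    = vec_cls n (col_labels n) (lin (Jacobian_column n) a)"
  unfolding col_labels_def[symmetric]
  by (rule matrix_map_vec_cls[OF finite_vars a chain_Jacobian_column]) (simp add: JT_def lookup_Jacobian_column)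

lemma carrier_ker_JT:
  assumes a: "chain n (vars n) a"
  shows "vec_cls n (vars n) a \<in> carrier (ker_JT n) \<longleftrightarrow> tangent n a"
  using a vec_cls_closed[OF a] vec_cls_eq_0[of n "col_labels n" "lin (Jacobian_column n) a"]
  unfolding tangent_def ker_JT_def a_kernel_def' col_labels_def[symmetric]
  by (simp add: matrix_map_JT[OF a, folded col_labels_def] lookup_Jacobian[OF a])

lemma ker_JT_cases:
  assumes "\<alpha> \<in> carrier (ker_JT n)"
  obtains a where "tangent n a" "\<alpha> = vec_cls n (vars n) a"
proof -
  have "\<alpha> \<in> vars n \<rightarrow>\<^sub>E carrier (R_ring n)" using assms by (simp add: ker_JT_def a_kernel_def')
  then obtain a where "chain n (vars n) a" "\<alpha> = vec_cls n (vars n) a"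
    using vec_cls_cases[OF finite_vars] by blast
  then show ?thesis using that assms carrier_ker_JT by blast
qed

lemma ker_JT_simps [simp]:
  "\<alpha> \<oplus>\<^bsub>ker_JT n\<^esub> \<beta> = (\<lambda>s\<in>vars n. \<alpha> s \<oplus>\<^bsub>R_ring n\<^esub> \<beta> s)"
  "r \<odot>\<^bsub>ker_JT n\<^esub> \<alpha> = (\<lambda>s\<in>vars n. r \<otimes>\<^bsub>R_ring n\<^esub> \<alpha> s)"
  by (simp_all add: ker_JT_def free_module_def)

lemma tangent_ideal:
  assumes a: "tangent n a" and p: "p \<in> I_ideal n"
  shows "vector_field n a p \<in> I_ideal n"
proof -
  have ch: "chain n (vars n) a" using a by (simp add: tangent_def)
  obtain y where y: "\<And>i. over_vars (vars n) (y i)" "p = (\<Sum>i\<in>col_labels n. G n i * y i)"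
    using p unfolding I_ideal_iff by blast
  have "vector_field n a (G n i * y i) \<in> I_ideal n" if i: "i \<in> col_labels n" for i
  proof -
    have sign: "vector_field n a ((-1) ^ m * q) = (-1) ^ m * vector_field n a q" for m q
      by (cases "even m") (simp_all add: vector_field_def partial_uminus sum_negf)
    have "vector_field n a (Fmin n i) \<in> I_ideal n" using a i by (simp add: tangent_def)
    then have "((-1) ^ (i + 1) * y i) * vector_field n a (Fmin n i) \<in> I_ideal n"
      by (rule I_ideal_mult) (intro over_vars_mult over_vars_power y(1), simp)
    moreover have "(\<Sum>j\<in>col_labels n. G n j * (if j = i then vector_field n a (y i) else 0)) \<in> I_ideal n"
      unfolding I_ideal_iff
      by (intro exI[of _ "\<lambda>j. if j = i then vector_field n a (y i) else 0"])
         (simp add: over_vars_vector_field[OF ch y(1)])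
    then have "G n i * vector_field n a (y i) \<in> I_ideal n"
      using i by (simp add: if_distrib cong: if_cong)
    ultimately have "((-1) ^ (i + 1) * y i) * vector_field n a (Fmin n i) + G n i * vector_field n a (y i) \<in> I_ideal n"
      by (rule I_ideal_add)
    moreover have "vector_field n a (G n i) = (-1) ^ (i + 1) * vector_field n a (Fmin n i)"
      unfolding G_Fmin[OF i] sign ..
    ultimately show ?thesis unfolding vector_field_mult by (simp only: ac_simps)
  qed
  then show ?thesis unfolding y(2) vector_field_sum by (intro I_ideal_sum)
qed

lemma induced_derivation_cls:
  fixes a :: "nat \<times> nat \<Rightarrow>\<^sub>0 'k::field qpoly"
  assumes a: "tangent n a" and p: "over_vars (vars n) p"
  shows "induced_derivation n (vec_cls n (vars n) a) (cls n p) = cls n (vector_field n a p)"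
proof -
  interpret R: cring "R_ring n :: 'k qpoly set ring" by (rule cring_R_ring)
  have ch: "chain n (vars n) a" using a by (simp add: tangent_def)
  have val: "(\<Oplus>\<^bsub>R_ring n\<^esub>v\<in>vars n. vec_cls n (vars n) a v \<otimes>\<^bsub>R_ring n\<^esub> cls n (partial v q)) = cls n (vector_field n a p)"
    if q: "q \<in> cls n p" for q
  proof -
    have qp: "q - p \<in> I_ideal n" using q by (simp add: mem_cls)
    have "over_vars (vars n) ((q - p) + p)" by (rule over_vars_add[OF I_ideal_over_vars[OF qp] p])
    then have qv: "over_vars (vars n) q" by simp
    have ov: "over_vars (vars n) (lookup a v * partial v q)" for v
      by (intro over_vars_mult over_vars_partial chain_over_vars[OF ch] qv)
    have "(\<Oplus>\<^bsub>R_ring n\<^esub>v\<in>vars n. vec_cls n (vars n) a v \<otimes>\<^bsub>R_ring n\<^esub> cls n (partial v q))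
        = (\<Oplus>\<^bsub>R_ring n\<^esub>v\<in>vars n. cls n (lookup a v * partial v q))"
      by (rule R.finsum_cong')
         (use ov qv chain_over_vars[OF ch] in \<open>auto simp: vec_cls_def cls_mult simp del: mem_vars\<close>)
    also have "\<dots> = cls n (vector_field n a q)"
      unfolding vector_field_def by (rule cls_finsum[OF finite_vars ov])
    also have "\<dots> = cls n (vector_field n a p)"
      unfolding cls_eq_iff vector_field_diff[symmetric] by (rule tangent_ideal[OF a qp])
    finally show ?thesis .
  qed
  have "(THE b. \<forall>q\<in>cls n p. b = (\<Oplus>\<^bsub>R_ring n\<^esub>v\<in>vars n. vec_cls n (vars n) a v \<otimes>\<^bsub>R_ring n\<^esub> cls n (partial v q)))
      = cls n (vector_field n a p)"
  proof (rule the_equality)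
    fix b assume b: "\<forall>q\<in>cls n p. b = (\<Oplus>\<^bsub>R_ring n\<^esub>v\<in>vars n. vec_cls n (vars n) a v \<otimes>\<^bsub>R_ring n\<^esub> cls n (partial v q))"
    have "p \<in> cls n p" by (simp add: mem_cls)
    from trans[OF bspec[OF b this] val[OF this]] show "b = cls n (vector_field n a p)" .
  qed (simp add: val)
  then show ?thesis using p by (simp add: induced_derivation_def)
qed

lemma induced_derivation_extensional: "induced_derivation n \<alpha> \<in> extensional (carrier (R_ring n))"
  by (simp add: induced_derivation_def)

lemma carrier_Der:
  fixes n :: nat
  shows "\<delta> \<in> carrier (Der n) \<longleftrightarrow> \<delta> \<in> carrier (R_ring n) \<rightarrow>\<^sub>E carrier (R_ring n) \<and>
       (\<forall>a\<in>carrier (R_ring n). \<forall>b\<in>carrier (R_ring n). \<delta> (a \<oplus>\<^bsub>R_ring n\<^esub> b) = \<delta> a \<oplus>\<^bsub>R_ring n\<^esub> \<delta> b) \<and>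
       (\<forall>c. \<forall>a\<in>carrier (R_ring n). \<delta> (cls n (const c) \<otimes>\<^bsub>R_ring n\<^esub> a) = cls n (const c) \<otimes>\<^bsub>R_ring n\<^esub> \<delta> a) \<and>
       (\<forall>a\<in>carrier (R_ring n). \<forall>b\<in>carrier (R_ring n).
          \<delta> (a \<otimes>\<^bsub>R_ring n\<^esub> b) = (\<delta> a \<otimes>\<^bsub>R_ring n\<^esub> b) \<oplus>\<^bsub>R_ring n\<^esub> (a \<otimes>\<^bsub>R_ring n\<^esub> \<delta> b))"
  by (simp add: Der_def Let_def)

lemma
  assumes "\<delta> \<in> carrier (Der n)"
  shows Der_closed: "a \<in> carrier (R_ring n) \<Longrightarrow> \<delta> a \<in> carrier (R_ring n)"
    and Der_extensional: "\<delta> \<in> extensional (carrier (R_ring n))"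
  using assms[unfolded carrier_Der PiE_def, THEN conjunct1] by blast+

lemmas Der_add = carrier_Der[THEN iffD1, THEN conjunct2, THEN conjunct1, rule_format]

lemmas Der_const = carrier_Der[THEN iffD1, THEN conjunct2, THEN conjunct2, THEN conjunct1, rule_format]

lemmas Der_mult = carrier_Der[THEN iffD1, THEN conjunct2, THEN conjunct2, THEN conjunct2, rule_format]

lemma Der_simps [simp]:
  "\<zero>\<^bsub>Der n\<^esub> = (\<lambda>a\<in>carrier (R_ring n). \<zero>\<^bsub>R_ring n\<^esub>)"
  "\<delta> \<oplus>\<^bsub>Der n\<^esub> \<epsilon> = (\<lambda>a\<in>carrier (R_ring n). \<delta> a \<oplus>\<^bsub>R_ring n\<^esub> \<epsilon> a)"
  "r \<odot>\<^bsub>Der n\<^esub> \<delta> = (\<lambda>a\<in>carrier (R_ring n). r \<otimes>\<^bsub>R_ring n\<^esub> \<delta> a)"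
  by (simp_all add: Der_def Let_def)

lemma induced_derivation_Der:
  fixes a :: "nat \<times> nat \<Rightarrow>\<^sub>0 'k::field qpoly"
  assumes a: "tangent n a"
  shows "induced_derivation n (vec_cls n (vars n) a) \<in> carrier (Der n)"
proof -
  have ch: "chain n (vars n) a" using a by (simp add: tangent_def)
  note ov = over_vars_vector_field[OF ch]
  note ind = induced_derivation_cls[OF a]
  show ?thesis unfolding carrier_Der
  proof (intro conjI ballI allI)
    show "induced_derivation n (vec_cls n (vars n) a) \<in> carrier (R_ring n) \<rightarrow>\<^sub>E carrier (R_ring n)"
      using induced_derivation_extensional by (auto simp: PiE_def ind ov elim!: carrier_R_ringE)
  qed (auto simp: ind ov cls_add cls_mult vector_field_add vector_field_mult elim!: carrier_R_ringE)
qed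

text \<open>The polynomials on which two derivations agree form a \<open>k\<close>-subalgebra, and the variables
  generate.\<close>

lemma derivation_cls:
  fixes a :: "nat \<times> nat \<Rightarrow>\<^sub>0 'k::field qpoly"
  assumes d: "\<delta> \<in> carrier (Der n)" and ch: "chain n (vars n) a"
    and x: "\<And>i j. (i, j) \<in> vars n \<Longrightarrow> \<delta> (cls n (xvar i j)) = cls n (lookup a (i, j))"
    and p: "over_vars (vars n) p"
  shows "\<delta> (cls n p) = cls n (vector_field n a p)"
proof -
  note ov = over_vars_vector_field[OF ch]
  let ?V = "over_vars (vars n) :: 'k qpoly \<Rightarrow> bool" and ?P = "\<lambda>p. \<delta> (cls n p) = cls n (vector_field n a p)"
  have closed: "\<delta> (cls n p) \<in> carrier (R_ring n)" if "?V p" for p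
    by (rule Der_closed[OF d cls_closed[OF that]])
  have add: "?P (p + q)" if "?V p" "?V q" "?P p" "?P q" for p q
  proof -
    have "\<delta> (cls n p \<oplus>\<^bsub>R_ring n\<^esub> cls n q) = \<delta> (cls n p) \<oplus>\<^bsub>R_ring n\<^esub> \<delta> (cls n q)"
      by (rule Der_add[OF d that(1,2)[THEN cls_closed]])
    then show ?thesis using that by (simp add: cls_add vector_field_add ov)
  qed
  have mult: "?P (p * q)" if "?V p" "?V q" "?P p" "?P q" for p q
  proof -
    have "\<delta> (cls n p \<otimes>\<^bsub>R_ring n\<^esub> cls n q) = (\<delta> (cls n p) \<otimes>\<^bsub>R_ring n\<^esub> cls n q) \<oplus>\<^bsub>R_ring n\<^esub> (cls n p \<otimes>\<^bsub>R_ring n\<^esub> \<delta> (cls n q))"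
      by (rule Der_mult[OF d that(1,2)[THEN cls_closed]])
    then show ?thesis using that by (simp add: cls_add cls_mult vector_field_mult ov)
  qed
  have const: "?P (const c * p)" if "?V p" "?P p" for c p
  proof -
    have "\<delta> (cls n (const c) \<otimes>\<^bsub>R_ring n\<^esub> cls n p) = cls n (const c) \<otimes>\<^bsub>R_ring n\<^esub> \<delta> (cls n p)"
      by (rule Der_const[OF d cls_closed[OF that(1)]])
    then show ?thesis using that by (simp add: cls_mult vector_field_mult ov)
  qed
  have one: "?P 1"
  proof -
    obtain q where q: "?V q" "\<delta> (cls n 1) = cls n q" using closed[of 1] by (auto elim: carrier_R_ringE)
    have "\<delta> (cls n 1 \<otimes>\<^bsub>R_ring n\<^esub> cls n 1) = (\<delta> (cls n 1) \<otimes>\<^bsub>R_ring n\<^esub> cls n 1) \<oplus>\<^bsub>R_ring n\<^esub> (cls n 1 \<otimes>\<^bsub>R_ring n\<^esub> \<delta> (cls n 1))"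
      by (rule Der_mult[OF d over_vars_1[THEN cls_closed] over_vars_1[THEN cls_closed]])
    then have "cls n q = cls n (q + q)" using q by (simp add: cls_mult cls_add)
    then have "q \<in> I_ideal n" using I_ideal_uminus[of "q - (q + q)" n] by (simp add: cls_eq_iff)
    then show ?thesis by (simp add: q(2) cls_eq_0)
  qed
  have zero: "?P 0" using const[OF over_vars_1 one, of 0] by (simp add: const_def)
  have power: "?P (single (single v k) 1) \<and> ?V (single (single v k) 1)" if v: "v \<in> vars n" for v k
  proof (induction k)
    case 0
    show ?case using one by simp
  next
    case (Suc k)
    obtain i j where ij: "v = (i, j)" by (cases v)
    have "single (single v (Suc k)) 1 = single (single v k) 1 * (xvar i j :: 'k qpoly)"
      by (simp add: xvar_def mult_single ij single_add[symmetric])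
    moreover have "?P (xvar i j)" "?V (xvar i j)" using v ij by (simp_all add: x vector_field_xvar del: mem_vars)
    ultimately show ?case using Suc mult[of "single (single v k) 1" "xvar i j"] by simp
  qed
  have mono: "keys m \<subseteq> vars n \<Longrightarrow> ?P (single m 1)" for m
  proof (induction m rule: poly_mapping_additive_induct)
    case (single v k)
    show ?case
    proof (cases "k = 0")
      case True
      then show ?thesis using one by simp
    next
      case False
      then show ?thesis using single power by simp
    qed
  next
    case (add m m')
    have "keys m \<subseteq> keys (m + m')" "keys m' \<subseteq> keys (m + m')" by (auto simp: in_keys_iff lookup_add)
    then have m: "keys m \<subseteq> vars n" "keys m' \<subseteq> vars n" using add.prems by auto
    have "single (m + m') 1 = single m 1 * (single m' 1 :: 'k qpoly)" by (simp add: mult_single)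
    moreover have "?V (single m 1)" "?V (single m' 1)" using m by (simp_all add: over_vars_def)
    ultimately show ?case using mult add.IH m by simp
  qed (use one in simp)
  have monomial: "?P (single m (lookup p m)) \<and> ?V (single m (lookup p m))" if m: "m \<in> keys p" for m
  proof -
    have k: "keys m \<subseteq> vars n" using m p by (auto simp: over_vars_def)
    have "single m (lookup p m) = const (lookup p m) * single m 1" by (simp add: const_def mult_single)
    moreover have "?V (single m 1)" using k by (simp add: over_vars_def)
    ultimately show ?thesis using const[OF _ mono[OF k]] by simp
  qed
  have "finite A \<Longrightarrow> A \<subseteq> keys p \<Longrightarrow> ?P (\<Sum>m\<in>A. single m (lookup p m)) \<and> ?V (\<Sum>m\<in>A. single m (lookup p m))" for A
  proof (induction A rule: finite_induct)
    case (insert m A)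
    then show ?case using add[of "single m (lookup p m)" "\<Sum>m\<in>A. single m (lookup p m)"] monomial[of m] by simp
  qed (simp add: zero)
  from this[OF finite_keys order_refl] show ?thesis using poly_mapping_sum_singles[of p] by simp
qed

lemma Der_cases:
  fixes \<delta> :: "'k::field qpoly set \<Rightarrow> 'k qpoly set"
  assumes d: "\<delta> \<in> carrier (Der n)"
  obtains a where "tangent n a" "\<delta> = induced_derivation n (vec_cls n (vars n) a)"
proof -
  define \<alpha> where "\<alpha> = (\<lambda>(i, j)\<in>vars n. \<delta> (cls n (xvar i j)))"
  have "\<delta> (cls n (xvar i j)) \<in> carrier (R_ring n)" if "(i, j) \<in> vars n" for i j
    by (rule Der_closed[OF d cls_closed]) (use that in \<open>simp del: mem_vars\<close>)
  then have "\<alpha> \<in> vars n \<rightarrow>\<^sub>E carrier (R_ring n)" by (auto simp: \<alpha>_def simp del: mem_vars)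
  then obtain a where ch: "chain n (vars n) a" and a: "\<alpha> = vec_cls n (vars n) a"
    using vec_cls_cases[OF finite_vars] by blast
  have x: "\<delta> (cls n (xvar i j)) = cls n (lookup a (i, j))" if "(i, j) \<in> vars n" for i j
    using fun_cong[OF a, of "(i, j)"] that by (simp add: \<alpha>_def vec_cls_def del: mem_vars)
  have val: "\<delta> (cls n p) = cls n (vector_field n a p)" if "over_vars (vars n) p" for p
    by (rule derivation_cls[OF d ch _ that]) (rule x)
  have zero: "\<delta> (cls n 0) = cls n 0" using val[of 0] by (simp add: vector_field_def)
  have "vector_field n a (Fmin n i) \<in> I_ideal n" if i: "i \<in> col_labels n" for i
  proof -
    have "Fmin n i \<in> (I_ideal n :: 'k qpoly set)"
      unfolding I_ideal_iff
      by (intro exI[of _ "\<lambda>j. if j = i then (-1) ^ (i + 1) else 0"])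
         (use i in \<open>simp add: Fmin_G if_distrib mult.commute cong: if_cong\<close>)
    then have "cls n (Fmin n i) = cls n (0 :: 'k qpoly)" by (simp only: cls_eq_0)
    then have "cls n (vector_field n a (Fmin n i)) = cls n 0"
      using val[OF over_vars_Fmin[OF i]] zero by (simp only:)
    then show ?thesis by (simp only: cls_eq_0)
  qed
  then have t: "tangent n a" using ch by (simp add: tangent_def)
  have "\<delta> = induced_derivation n (vec_cls n (vars n) a)"
  proof (rule extensionalityI[of _ "carrier (R_ring n)"])
    show "\<delta> \<in> extensional (carrier (R_ring n))" by (rule Der_extensional[OF d])
    show "induced_derivation n (vec_cls n (vars n) a) \<in> extensional (carrier (R_ring n))"
      by (rule induced_derivation_extensional)
    fix b :: "'k qpoly set" assume "b \<in> carrier (R_ring n)"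
    then show "\<delta> b = induced_derivation n (vec_cls n (vars n) a) b"
      by (auto simp: val induced_derivation_cls[OF t] elim!: carrier_R_ringE)
  qed
  then show ?thesis using that t by blast
qed

lemma tangent_add: "tangent n a \<Longrightarrow> tangent n b \<Longrightarrow> tangent n (a + b)"
  by (simp add: tangent_def vector_field_plus I_ideal_add)

lemma tangent_scale: "over_vars (vars n) q \<Longrightarrow> tangent n a \<Longrightarrow> tangent n (q \<cdot> a)"
  by (simp add: tangent_def vector_field_scale I_ideal_mult)

lemma tangent_chain: "tangent n a \<Longrightarrow> chain n (vars n) a"
  by (simp add: tangent_def)

lemma induced_derivation_add:
  fixes a b :: "nat \<times> nat \<Rightarrow>\<^sub>0 'k::field qpoly"
  assumes "tangent n a" "tangent n b"
  shows "induced_derivation n (vec_cls n (vars n) (a + b))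
    = induced_derivation n (vec_cls n (vars n) a) \<oplus>\<^bsub>Der n\<^esub> induced_derivation n (vec_cls n (vars n) b)"
proof (rule extensionalityI[OF induced_derivation_extensional])
  fix c :: "'k qpoly set" assume "c \<in> carrier (R_ring n)"
  then obtain p where "over_vars (vars n) p" "c = cls n p" by (rule carrier_R_ringE)
  then show "induced_derivation n (vec_cls n (vars n) (a + b)) c
    = (induced_derivation n (vec_cls n (vars n) a) \<oplus>\<^bsub>Der n\<^esub> induced_derivation n (vec_cls n (vars n) b)) c"
    using assms by (simp add: induced_derivation_cls tangent_add cls_add over_vars_vector_field tangent_chain vector_field_plus)
qed simp

lemma induced_derivation_scale:
  fixes a :: "nat \<times> nat \<Rightarrow>\<^sub>0 'k::field qpoly"
  assumes "tangent n a" "over_vars (vars n) q"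
  shows "induced_derivation n (vec_cls n (vars n) (q \<cdot> a))
    = cls n q \<odot>\<^bsub>Der n\<^esub> induced_derivation n (vec_cls n (vars n) a)"
proof (rule extensionalityI[OF induced_derivation_extensional])
  fix c :: "'k qpoly set" assume "c \<in> carrier (R_ring n)"
  then obtain p where "over_vars (vars n) p" "c = cls n p" by (rule carrier_R_ringE)
  then show "induced_derivation n (vec_cls n (vars n) (q \<cdot> a)) c
    = (cls n q \<odot>\<^bsub>Der n\<^esub> induced_derivation n (vec_cls n (vars n) a)) c"
    using assms by (simp add: induced_derivation_cls tangent_scale cls_mult over_vars_vector_field tangent_chain vector_field_scale)
qed simp

lemma linear_map_induced_derivation:
  "linear_map (R_ring n :: 'k::field qpoly set ring) (ker_JT n) (Der n) (induced_derivation n)"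
  unfolding linear_map_def
proof (intro conjI ballI funcsetI)
  fix \<alpha> :: "nat \<times> nat \<Rightarrow> 'k qpoly set" assume "\<alpha> \<in> carrier (ker_JT n)"
  then obtain a where a: "tangent n a" "\<alpha> = vec_cls n (vars n) a" by (rule ker_JT_cases)
  show "induced_derivation n \<alpha> \<in> carrier (Der n)" unfolding a(2) by (rule induced_derivation_Der[OF a(1)])
next
  fix \<alpha> \<beta> :: "nat \<times> nat \<Rightarrow> 'k qpoly set" assume k: "\<alpha> \<in> carrier (ker_JT n)" "\<beta> \<in> carrier (ker_JT n)"
  obtain a where a: "tangent n a" "\<alpha> = vec_cls n (vars n) a" using k(1) by (rule ker_JT_cases)
  obtain b where b: "tangent n b" "\<beta> = vec_cls n (vars n) b" using k(2) by (rule ker_JT_cases)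
  note ab = a b
  have "\<alpha> \<oplus>\<^bsub>ker_JT n\<^esub> \<beta> = vec_cls n (vars n) (a + b)"
    using vec_cls_add[OF ab(1,3)[THEN tangent_chain]] by (simp add: ab)
  then show "induced_derivation n (\<alpha> \<oplus>\<^bsub>ker_JT n\<^esub> \<beta>) = induced_derivation n \<alpha> \<oplus>\<^bsub>Der n\<^esub> induced_derivation n \<beta>"
    unfolding ab(2,4) by (simp only: induced_derivation_add[OF ab(1,3)])
next
  fix r :: "'k qpoly set" and \<alpha> :: "nat \<times> nat \<Rightarrow> 'k qpoly set" assume r: "r \<in> carrier (R_ring n)" and k: "\<alpha> \<in> carrier (ker_JT n)"
  obtain a where a: "tangent n a" "\<alpha> = vec_cls n (vars n) a" using k by (rule ker_JT_cases)
  obtain q where q: "over_vars (vars n) q" "r = cls n q" using r by (rule carrier_R_ringE)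
  have "r \<odot>\<^bsub>ker_JT n\<^esub> \<alpha> = vec_cls n (vars n) (q \<cdot> a)"
    using vec_cls_smult[OF tangent_chain[OF a(1)] q(1)] by (simp add: a q)
  then show "induced_derivation n (r \<odot>\<^bsub>ker_JT n\<^esub> \<alpha>) = r \<odot>\<^bsub>Der n\<^esub> induced_derivation n \<alpha>"
    unfolding a(2) q(2) by (simp only: induced_derivation_scale[OF a(1) q(1)])
qed

lemma bij_betw_induced_derivation:
  "bij_betw (induced_derivation n) (carrier (ker_JT n))
    (carrier (Der n :: 'k::field Der_module))"
  unfolding bij_betw_def
proof
  show "inj_on (induced_derivation n) (carrier (ker_JT n :: ('k qpoly set, _) module))"
  proof (rule inj_onI)
    fix \<alpha> \<beta> :: "nat \<times> nat \<Rightarrow> 'k qpoly set" assume k: "\<alpha> \<in> carrier (ker_JT n)" "\<beta> \<in> carrier (ker_JT n)"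
      and eq: "induced_derivation n \<alpha> = induced_derivation n \<beta>"
    obtain a where a: "tangent n a" "\<alpha> = vec_cls n (vars n) a" using k(1) by (rule ker_JT_cases)
    obtain b where b: "tangent n b" "\<beta> = vec_cls n (vars n) b" using k(2) by (rule ker_JT_cases)
    note ab = a b
    have "cls n (lookup a (i, j)) = cls n (lookup b (i, j))" if v: "(i, j) \<in> vars n" for i j
      using fun_cong[OF eq, of "cls n (xvar i j)"] v unfolding ab(2,4)
      by (simp add: induced_derivation_cls[OF ab(1)] induced_derivation_cls[OF ab(3)] vector_field_xvar del: mem_vars)
    then show "\<alpha> = \<beta>" unfolding ab(2,4) vec_cls_def by (intro restrict_ext) auto
  qed
  show "induced_derivation n ` carrier (ker_JT n :: ('k qpoly set, _) module) = carrier (Der n)"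
  proof
    show "induced_derivation n ` carrier (ker_JT n :: ('k qpoly set, _) module) \<subseteq> carrier (Der n)"
      using linear_map_induced_derivation unfolding linear_map_def by blast
    show "carrier (Der n) \<subseteq> induced_derivation n ` carrier (ker_JT n :: ('k qpoly set, _) module)"
    proof
      fix \<delta> :: "'k qpoly set \<Rightarrow> 'k qpoly set" assume "\<delta> \<in> carrier (Der n)"
      then obtain a where "tangent n a" "\<delta> = induced_derivation n (vec_cls n (vars n) a)" by (rule Der_cases)
      then show "\<delta> \<in> induced_derivation n ` carrier (ker_JT n)"
        using carrier_ker_JT[OF tangent_chain] by blast
    qed
  qed
qed

lemma module_Der: "module (R_ring n) (Der n :: 'k::field Der_module)"
proof -
  interpret R: cring "R_ring n :: 'k qpoly set ring" by (rule cring_R_ring)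
  have closed: "\<delta> a \<in> carrier (R_ring n)" if "\<delta> \<in> carrier (Der n)" "a \<in> carrier (R_ring n)"
    for \<delta> and a :: "'k qpoly set" using that by (rule Der_closed)
  have ext: "\<delta> \<in> extensional (carrier (R_ring n))" if "\<delta> \<in> carrier (Der n)"
    for \<delta> :: "'k qpoly set \<Rightarrow> 'k qpoly set" using that by (rule Der_extensional)
  have eqI: "\<delta> = \<epsilon>" if "\<delta> \<in> extensional (carrier (R_ring n))" "\<epsilon> \<in> extensional (carrier (R_ring n))"
    "\<And>a. a \<in> carrier (R_ring n) \<Longrightarrow> \<delta> a = \<epsilon> a" for \<delta> \<epsilon> :: "'k qpoly set \<Rightarrow> 'k qpoly set"
    using that by (rule extensionalityI)
  have smult: "r \<odot>\<^bsub>Der n\<^esub> \<delta> \<in> carrier (Der n)"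
    if r: "r \<in> carrier (R_ring n)" and \<delta>: "\<delta> \<in> carrier (Der n)" for r and \<delta> :: "'k qpoly set \<Rightarrow> 'k qpoly set"
  proof -
    obtain a where a: "tangent n a" "\<delta> = induced_derivation n (vec_cls n (vars n) a)"
      using \<delta> by (rule Der_cases)
    obtain q where q: "over_vars (vars n) q" "r = cls n q" using r by (rule carrier_R_ringE)
    show ?thesis unfolding a(2) q(2) induced_derivation_scale[OF a(1) q(1), symmetric]
      by (rule induced_derivation_Der[OF tangent_scale[OF q(1) a(1)]])
  qed
  have add: "\<delta> \<oplus>\<^bsub>Der n\<^esub> \<epsilon> \<in> carrier (Der n)"
    if \<delta>: "\<delta> \<in> carrier (Der n)" and \<epsilon>: "\<epsilon> \<in> carrier (Der n)" for \<delta> \<epsilon> :: "'k qpoly set \<Rightarrow> 'k qpoly set"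
  proof -
    obtain a where a: "tangent n a" "\<delta> = induced_derivation n (vec_cls n (vars n) a)"
      using \<delta> by (rule Der_cases)
    obtain b where b: "tangent n b" "\<epsilon> = induced_derivation n (vec_cls n (vars n) b)"
      using \<epsilon> by (rule Der_cases)
    show ?thesis unfolding a(2) b(2) induced_derivation_add[OF a(1) b(1), symmetric]
      by (rule induced_derivation_Der[OF tangent_add[OF a(1) b(1)]])
  qed
  have zero: "\<zero>\<^bsub>Der n\<^esub> \<in> carrier (Der n :: 'k Der_module)"
    by (auto simp: carrier_Der)
  have "abelian_group (Der n :: 'k Der_module)"
  proof (rule abelian_groupI)
    fix \<delta> \<epsilon> \<eta> :: "'k qpoly set \<Rightarrow> 'k qpoly set"
    assume d: "\<delta> \<in> carrier (Der n)"
    show "\<zero>\<^bsub>Der n\<^esub> \<oplus>\<^bsub>Der n\<^esub> \<delta> = \<delta>" by (rule eqI) (use d closed ext in simp_all)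
    have "(\<ominus>\<^bsub>R_ring n\<^esub> \<one>\<^bsub>R_ring n\<^esub>) \<odot>\<^bsub>Der n\<^esub> \<delta> \<oplus>\<^bsub>Der n\<^esub> \<delta> = \<zero>\<^bsub>Der n\<^esub>"
      by (rule eqI) (use d closed in \<open>simp_all add: R.l_minus R.l_neg\<close>)
    then show "\<exists>\<epsilon>\<in>carrier (Der n). \<epsilon> \<oplus>\<^bsub>Der n\<^esub> \<delta> = \<zero>\<^bsub>Der n\<^esub>"
      using smult[OF _ d, of "\<ominus>\<^bsub>R_ring n\<^esub> \<one>\<^bsub>R_ring n\<^esub>"] by blast
    assume e: "\<epsilon> \<in> carrier (Der n)"
    show "\<delta> \<oplus>\<^bsub>Der n\<^esub> \<epsilon> \<in> carrier (Der n)" by (rule add[OF d e])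
    show "\<delta> \<oplus>\<^bsub>Der n\<^esub> \<epsilon> = \<epsilon> \<oplus>\<^bsub>Der n\<^esub> \<delta>"
      by (rule eqI) (use d e closed in \<open>simp_all add: R.a_comm\<close>)
    assume f: "\<eta> \<in> carrier (Der n)"
    show "\<delta> \<oplus>\<^bsub>Der n\<^esub> \<epsilon> \<oplus>\<^bsub>Der n\<^esub> \<eta> = \<delta> \<oplus>\<^bsub>Der n\<^esub> (\<epsilon> \<oplus>\<^bsub>Der n\<^esub> \<eta>)"
      by (rule eqI) (use d e f closed in \<open>simp_all add: R.a_assoc\<close>)
  qed (rule zero)
  then show ?thesis
  proof (rule moduleI[OF R.cring_axioms])
    fix r s :: "'k qpoly set" and \<delta> \<epsilon> :: "'k qpoly set \<Rightarrow> 'k qpoly set"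
    assume d: "\<delta> \<in> carrier (Der n)"
    show "\<one>\<^bsub>R_ring n\<^esub> \<odot>\<^bsub>Der n\<^esub> \<delta> = \<delta>" by (rule eqI) (use d closed ext in simp_all)
    assume r: "r \<in> carrier (R_ring n)"
    show "r \<odot>\<^bsub>Der n\<^esub> \<delta> \<in> carrier (Der n)" by (rule smult[OF r d])
    show "r \<odot>\<^bsub>Der n\<^esub> (\<delta> \<oplus>\<^bsub>Der n\<^esub> \<epsilon>) = r \<odot>\<^bsub>Der n\<^esub> \<delta> \<oplus>\<^bsub>Der n\<^esub> r \<odot>\<^bsub>Der n\<^esub> \<epsilon>"
      if "\<epsilon> \<in> carrier (Der n)"
      by (rule eqI) (use d r that closed in \<open>simp_all add: R.r_distr\<close>)
    assume s: "s \<in> carrier (R_ring n)"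
    show "(r \<oplus>\<^bsub>R_ring n\<^esub> s) \<odot>\<^bsub>Der n\<^esub> \<delta> = r \<odot>\<^bsub>Der n\<^esub> \<delta> \<oplus>\<^bsub>Der n\<^esub> s \<odot>\<^bsub>Der n\<^esub> \<delta>"
      by (rule eqI) (use d r s closed in \<open>simp_all add: R.l_distr\<close>)
    show "(r \<otimes>\<^bsub>R_ring n\<^esub> s) \<odot>\<^bsub>Der n\<^esub> \<delta> = r \<odot>\<^bsub>Der n\<^esub> (s \<odot>\<^bsub>Der n\<^esub> \<delta>)"
      by (rule eqI) (use d r s closed in \<open>simp_all add: R.m_assoc\<close>)
  qed
qed


section \<open>The bar resolution over the quotient ring\<close>

lemma bar_basis_words: "bar_basis n r = words n (int r)"
  by (auto simp: bar_basis_eq words_def)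

lemma finite_U_gens: "finite (U_gens n)"
  unfolding U_gens_def U_basis_0 U_basis_1 U_basis_2 by simp

lemma finite_A_gens: "finite (A_gens n)"
  unfolding A_gens_def A_basis_1 A_basis_2 by simp

lemma finite_bar_basis [simp]: "finite (bar_basis n r)"
proof (rule finite_subset)
  show "bar_basis n r \<subseteq> {as. set as \<subseteq> A_gens n \<and> length as \<le> r} \<times> U_gens n"
    by (auto simp: bar_basis_eq bar_words_def word_deg_def)
  show "finite ({as. set as \<subseteq> A_gens n \<and> length as \<le> r} \<times> U_gens n)"
    by (simp add: finite_lists_length_le finite_A_gens finite_U_gens)
qed

lemma A_deg_pos: "1 \<le> A_deg g"
  by (cases g) simp_all

lemma graded_bar_diff_basis:
  assumes n: "2 \<le> n" and w: "w \<in> bar_basis n (Suc r)"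
  shows "graded_chain n (bar_basis n r) (\<lambda>t. bar_ideg n w - bar_ideg n t) (bar_diff n w :: 'k::field bar_chain)"
proof -
  have "(fst w, snd w) \<in> bar_words n" using w by (simp add: bar_basis_eq)
  from graded_bar_diff[OF n this] have "graded_chain n {w' \<in> bar_words n. word_deg w' + 1 = word_deg w}
    (\<lambda>t. bar_ideg n w - bar_ideg n t) (bar_diff n w :: 'k bar_chain)" by simp
  moreover have "{w' \<in> bar_words n. word_deg w' + 1 = word_deg w} = bar_basis n r"
    using w by (auto simp: bar_basis_eq)
  ultimately show ?thesis by simp
qed

lemma matrix_map_bar:
  assumes n: "2 \<le> n" and x: "chain n (bar_basis n (Suc r)) x"
  shows "matrix_map (R_ring n) (bar_basis n (Suc r)) (bar_basis n r) (bar_matrix n) (vec_cls n (bar_basis n (Suc r)) x)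
    = vec_cls n (bar_basis n r) (bar_d n x)"
  by (rule matrix_map_vec_cls[OF finite_bar_basis x graded_chain_chain[OF graded_bar_diff_basis[OF n]]])
     (simp_all add: bar_matrix_def)

lemma chain_bar_d_basis:
  assumes "2 \<le> n" "chain n (bar_basis n (Suc r)) x" shows "chain n (bar_basis n r) (bar_d n x)"
  using chain_bar_d[of n "int (Suc r)" x "int r"] assms by (simp add: bar_basis_words)

lemma bar_d_square_ideal:
  assumes n: "2 \<le> n" and x: "chain n (bar_basis n r) x"
  shows "lookup (bar_d n (bar_d n x)) t \<in> I_ideal n"
proof -
  have w: "chain n (bar_words n) x" by (rule chain_mono[OF x]) (auto simp: bar_basis_eq)
  have "chain n (bar_words n) (strip (eA k) x)" for k
    by (rule chain_strip[OF w]) auto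
  then have "over_vars (vars n) (lookup (strip (eA k) x) t)" for k by (rule chain_over_vars)
  then show ?thesis
    unfolding bar_d_square[OF w order.trans[OF one_le_numeral n]] I_ideal_iff
    by (intro exI[of _ "\<lambda>k. lookup (strip (eA k) x) t"]) (simp add: lookup_sum)
qed

text \<open>The boundary hits the lift \<open>x\<close> itself and not just its class: the error \<open>\<Sum>\<^sub>i G\<^sub>i y\<^sub>i\<close> in
  \<open>d x\<close> is produced by the words \<open>[e\<^sub>i|y\<^sub>i]\<close> through the curvature.\<close>

lemma bar_acyclic_mod_I:
  fixes x :: "'k::field bar_chain"
  assumes n: "2 \<le> n" and x: "chain n (bar_basis n (Suc r)) x"
    and dx: "\<And>t. t \<in> bar_basis n r \<Longrightarrow> lookup (bar_d n x) t \<in> I_ideal n"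
  shows "\<exists>z. chain n (bar_basis n (Suc (Suc r))) z \<and> bar_d n z = x"
proof -
  have "vec_cls n (bar_basis n r) (bar_d n x) = \<zero>\<^bsub>free_module (R_ring n) (bar_basis n r)\<^esub>"
    unfolding vec_cls_eq_0 using dx by blast
  then obtain y where y: "\<And>i. i \<in> col_labels n \<Longrightarrow> chain n (bar_basis n r) (y i)"
    "bar_d n x = (\<Sum>i\<in>col_labels n. G n i \<cdot> y i)"
    unfolding vec_cls_eq_0_iff[OF chain_bar_d_basis[OF n x]] by blast
  have "\<exists>z. chain n (words n (int (Suc r) + 1)) z \<and> bar_d n z = x"
    by (rule bar_acyclic[OF n _ _ _ y(2)]) (use x y(1) in \<open>simp_all add: bar_basis_words\<close>)
  then show ?thesis by (simp add: bar_basis_words add.commute)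
qed

lemma bar_exact:
  fixes n :: nat
  assumes n: "2 \<le> n"
  defines "F \<equiv> \<lambda>r. free_module (R_ring n :: 'k::field qpoly set ring) (bar_basis n r)"
  shows "a_kernel (F (Suc r)) (F r) (matrix_map (R_ring n) (bar_basis n (Suc r)) (bar_basis n r) (bar_matrix n))
    = matrix_map (R_ring n) (bar_basis n (Suc (Suc r))) (bar_basis n (Suc r)) (bar_matrix n) ` carrier (F (Suc (Suc r)))"
    (is "?L = ?R")
proof
  show "?L \<subseteq> ?R"
  proof
    fix v assume v: "v \<in> ?L"
    then have "v \<in> bar_basis n (Suc r) \<rightarrow>\<^sub>E carrier (R_ring n)" by (simp add: F_def a_kernel_def')
    then obtain x where x: "chain n (bar_basis n (Suc r)) x" "v = vec_cls n (bar_basis n (Suc r)) x"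
      using vec_cls_cases[OF finite_bar_basis] by blast
    have "vec_cls n (bar_basis n r) (bar_d n x) = \<zero>\<^bsub>F r\<^esub>"
      using v by (simp add: a_kernel_def' x(2) matrix_map_bar[OF n x(1)])
    then obtain z where z: "chain n (bar_basis n (Suc (Suc r))) z" "bar_d n z = x"
      using bar_acyclic_mod_I[OF n x(1)] unfolding F_def vec_cls_eq_0 by blast
    have "v = matrix_map (R_ring n) (bar_basis n (Suc (Suc r))) (bar_basis n (Suc r)) (bar_matrix n)
        (vec_cls n (bar_basis n (Suc (Suc r))) z)"
      unfolding matrix_map_bar[OF n z(1)] z(2) x(2) ..
    moreover have "vec_cls n (bar_basis n (Suc (Suc r))) z \<in> carrier (F (Suc (Suc r)))"
      using vec_cls_closed[OF z(1)] by (simp add: F_def)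
    ultimately show "v \<in> ?R" by blast
  qed
  show "?R \<subseteq> ?L"
  proof
    fix v assume "v \<in> ?R"
    then obtain w where w: "w \<in> bar_basis n (Suc (Suc r)) \<rightarrow>\<^sub>E carrier (R_ring n)"
      and v: "v = matrix_map (R_ring n) (bar_basis n (Suc (Suc r))) (bar_basis n (Suc r)) (bar_matrix n) w"
      by (auto simp: F_def)
    obtain z where z: "chain n (bar_basis n (Suc (Suc r))) z" "w = vec_cls n (bar_basis n (Suc (Suc r))) z"
      using vec_cls_cases[OF finite_bar_basis w] by blast
    note dz = chain_bar_d_basis[OF n z(1)]
    have v': "v = vec_cls n (bar_basis n (Suc r)) (bar_d n z)"
      unfolding v z(2) by (rule matrix_map_bar[OF n z(1)])
    have "vec_cls n (bar_basis n r) (bar_d n (bar_d n z)) = \<zero>\<^bsub>F r\<^esub>"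
      unfolding F_def vec_cls_eq_0 using bar_d_square_ideal[OF n z(1)] by blast
    then show "v \<in> ?L"
      unfolding a_kernel_def' v' using matrix_map_bar[OF n dz] vec_cls_closed[OF dz] by (simp add: F_def)
  qed
qed


section \<open>The augmentation onto the derivations\<close>

lemma bar_basis_1: "bar_basis n 1 = (\<lambda>v. ([], bU v)) ` vars n"
proof -
  have "w \<in> bar_basis n 1 \<longleftrightarrow> w \<in> (\<lambda>v. ([], bU v)) ` vars n" for w
  proof (cases w)
    case (Pair as u)
    show ?thesis
    proof (cases as)
      case Nil
      then show ?thesis unfolding Pair
        by (cases u) (auto simp: bar_basis_eq image_iff)
    next
      case (Cons g as')
      then show ?thesis unfolding Pair using A_deg_pos[of g] by (auto simp: bar_basis_eq)
    qed
  qed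
  then show ?thesis by blast
qed

lemma bar_basis_0: "bar_basis n 0 = (\<lambda>i. ([], aU i)) ` col_labels n"
proof -
  have "w \<in> bar_basis n 0 \<longleftrightarrow> w \<in> (\<lambda>i. ([], aU i)) ` col_labels n" for w
  proof (cases w)
    case (Pair as u)
    show ?thesis
    proof (cases as)
      case Nil
      then show ?thesis unfolding Pair
        by (cases u) (auto simp: bar_basis_eq image_iff)
    next
      case (Cons g as')
      then show ?thesis unfolding Pair by (auto simp: bar_basis_eq)
    qed
  qed
  then show ?thesis by blast
qed

lemma lookup_relabel_inj: "inj f \<Longrightarrow> lookup (relabel f a) (f v) = lookup a v"
proof -
  assume f: "inj f"
  have "lookup (relabel f a) (f v) = (\<Sum>g\<in>keys a. if g = v then lookup a g else 0)"
    unfolding relabel_lin lookup_lin by (rule sum.cong[OF refl]) (auto simp: lookup_gen injD[OF f])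
  then show ?thesis by (simp add: in_keys_iff)
qed

abbreviation vars_word :: "nat \<times> nat \<Rightarrow> bar_word" where "vars_word v \<equiv> ([], bU v)"

lemma inj_vars_word: "inj vars_word"
  by (rule injI) simp

text \<open>A lift of the map \<open>B\<^sub>2 \<rightarrow> B\<^sub>1\<close> followed by the identification of the basis \<open>b\<^sub>v\<close> of \<open>B\<^sub>1\<close> with
  the variables \<open>x\<^sub>v\<close>.\<close>

definition coordinates :: "nat \<Rightarrow> 'k::field bar_chain \<Rightarrow> nat \<times> nat \<Rightarrow>\<^sub>0 'k qpoly"
  where "coordinates n x = lin (\<lambda>w. gen (b_index (snd w))) (bar_d n x)"

lemma coordinates_add: "coordinates n (x + y) = coordinates n x + coordinates n y"
  and coordinates_scale: "coordinates n (q \<cdot> x) = q \<cdot> coordinates n x"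
  by (simp_all add: coordinates_def lin_simps)

lemma chain_on_vars:
  assumes "chain n (bar_basis n 1) b"
  shows "chain n (vars n) (lin (\<lambda>w. gen (b_index (snd w))) b)"
    and "relabel vars_word (lin (\<lambda>w. gen (b_index (snd w))) b) = b"
proof -
  show "chain n (vars n) (lin (\<lambda>w. gen (b_index (snd w))) b)"
    by (rule chain_lin[OF assms]) (auto simp: bar_basis_1 simp del: mem_vars One_nat_def)
  have "relabel vars_word (lin (\<lambda>w. gen (b_index (snd w))) b) = lin gen b"
    unfolding relabel_lin lin_lin lin_gen
  proof (rule lin_cong)
    fix w assume "w \<in> keys b"
    then have "w \<in> bar_basis n 1" using assms by (auto simp: chain_def)
    then show "(gen (vars_word (b_index (snd w))) :: 'a bar_chain) = gen w"
      unfolding bar_basis_1 by auto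
  qed
  then show "relabel vars_word (lin (\<lambda>w. gen (b_index (snd w))) b) = b" by simp
qed

lemma chain_coordinates:
  assumes "2 \<le> n" "chain n (bar_basis n 2) x"
  shows "chain n (vars n) (coordinates n x)" "bar_d n x = relabel vars_word (coordinates n x)"
proof -
  have "chain n (bar_basis n 1) (bar_d n x)"
    using chain_bar_d_basis[of n 1 x] assms by (simp add: numeral_2_eq_2)
  from chain_on_vars[OF this] show "chain n (vars n) (coordinates n x)"
    "bar_d n x = relabel vars_word (coordinates n x)" by (simp_all add: coordinates_def)
qed

lemma bar_d_vars_word:
  "bar_d n (relabel vars_word a) = relabel (\<lambda>i. ([], aU i)) (lin (Jacobian_column n) a)"
  unfolding relabel_lin lin_lin
proof (rule lin_cong)
  fix v :: "nat \<times> nat"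
  obtain i j where v: "v = (i, j)" by (cases v)
  show "bar_d n (gen (vars_word v)) = lin (\<lambda>g. gen ([], aU g)) (Jacobian_column n v :: nat \<Rightarrow>\<^sub>0 'a qpoly)"
    unfolding lin_gen v bar_diff_Nil U_diff.simps col_labels_def[symmetric] Jacobian_column_def
    by (simp add: lin_simps relabel_simps)
qed

lemma lookup_bar_d_vars_word:
  assumes "chain n (vars n) a" "i \<in> col_labels n"
  shows "lookup (bar_d n (relabel vars_word a)) ([], aU i) = vector_field n a (Fmin n i)"
proof -
  have inj: "inj (\<lambda>i. ([] :: A_gen list, aU i))" by (rule injI) simp
  show ?thesis
    unfolding bar_d_vars_word lookup_relabel_inj[OF inj] by (rule lookup_Jacobian[OF assms])
qed

lemma tangent_coordinates:
  assumes n: "2 \<le> n" and x: "chain n (bar_basis n 2) x"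
  shows "tangent n (coordinates n x)"
  unfolding tangent_def
proof (intro conjI ballI)
  show ch: "chain n (vars n) (coordinates n x)" by (rule chain_coordinates(1)[OF n x])
  fix i assume i: "i \<in> col_labels n"
  show "vector_field n (coordinates n x) (Fmin n i) \<in> I_ideal n"
    using bar_d_square_ideal[OF n x, of "([], aU i)"]
    unfolding chain_coordinates(2)[OF n x] lookup_bar_d_vars_word[OF ch i] .
qed

lemma B2_to_coordinates_vec:
  assumes n: "2 \<le> n" and x: "chain n (bar_basis n 2) x"
  shows "B2_to_coordinates n (vec_cls n (bar_basis n 2) x) = vec_cls n (vars n) (coordinates n x)"
proof -
  have "matrix_map (R_ring n) (bar_basis n 2) (bar_basis n 1) (bar_matrix n) (vec_cls n (bar_basis n 2) x)
      = vec_cls n (bar_basis n 1) (bar_d n x)"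
    using matrix_map_bar[of n 1 x] n x by (simp add: numeral_2_eq_2)
  moreover have "vec_cls n (bar_basis n 1) (bar_d n x) (vars_word v) = cls n (lookup (coordinates n x) v)"
    if "v \<in> vars n" for v
    using that lookup_relabel_inj[OF inj_vars_word, of "coordinates n x" v]
    by (auto simp: vec_cls_def bar_basis_1 chain_coordinates(2)[OF n x] simp del: One_nat_def)
  ultimately show ?thesis
    unfolding B2_to_coordinates_def vec_cls_def[of n "vars n"] by (intro restrict_ext) simp
qed

lemma B2_to_Der_vec:
  assumes n: "2 \<le> n" and x: "chain n (bar_basis n 2) x"
  shows "B2_to_Der n (vec_cls n (bar_basis n 2) x) = induced_derivation n (vec_cls n (vars n) (coordinates n x))"
  unfolding B2_to_Der_def B2_to_coordinates_vec[OF n x] ..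

text \<open>Exactness at \<open>B\<^sub>1\<close>, which makes the augmentation surjective.\<close>

lemma tangent_coordinates_cases:
  fixes a :: "nat \<times> nat \<Rightarrow>\<^sub>0 'k::field qpoly"
  assumes n: "2 \<le> n" and a: "tangent n a"
  obtains x where "chain n (bar_basis n 2) x" "coordinates n x = a"
proof -
  have ch: "chain n (vars n) a" by (rule tangent_chain[OF a])
  have "chain n (bar_basis n (Suc 0)) (relabel vars_word a)"
    using chain_relabel[OF ch, of vars_word "bar_basis n 1"] by (simp add: bar_basis_1[unfolded One_nat_def])
  moreover have "lookup (bar_d n (relabel vars_word a)) t \<in> I_ideal n" if "t \<in> bar_basis n 0" for t
    using that a unfolding bar_basis_0 tangent_def by (auto simp: lookup_bar_d_vars_word[OF ch])
  ultimately obtain x where x: "chain n (bar_basis n 2) x" "bar_d n x = relabel vars_word a"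
    using bar_acyclic_mod_I[OF n, of 0 "relabel vars_word a"] by (auto simp: numeral_2_eq_2)
  have "coordinates n x = a"
    unfolding coordinates_def x(2) relabel_lin lin_lin by simp
  with x(1) show ?thesis by (rule that)
qed

lemma B2_to_Der_linear:
  fixes n :: nat
  assumes n: "2 \<le> n"
  shows "linear_map (R_ring n) (free_module (R_ring n) (bar_basis n 2))
    (Der n :: 'k::field Der_module) (B2_to_Der n)"
  unfolding linear_map_def
proof (intro conjI ballI funcsetI)
  fix v :: "bar_word \<Rightarrow> 'k qpoly set" assume "v \<in> carrier (free_module (R_ring n) (bar_basis n 2))"
  then have "v \<in> bar_basis n 2 \<rightarrow>\<^sub>E carrier (R_ring n)" by simp
  then obtain x where x: "chain n (bar_basis n 2) x" "v = vec_cls n (bar_basis n 2) x"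
    by (rule vec_cls_cases[OF finite_bar_basis])
  show "B2_to_Der n v \<in> carrier (Der n)"
    unfolding x(2) B2_to_Der_vec[OF n x(1)] by (rule induced_derivation_Der[OF tangent_coordinates[OF n x(1)]])
next
  fix v w :: "bar_word \<Rightarrow> 'k qpoly set"
  assume "v \<in> carrier (free_module (R_ring n) (bar_basis n 2))" "w \<in> carrier (free_module (R_ring n) (bar_basis n 2))"
  then have vw: "v \<in> bar_basis n 2 \<rightarrow>\<^sub>E carrier (R_ring n)" "w \<in> bar_basis n 2 \<rightarrow>\<^sub>E carrier (R_ring n)" by simp_all
  obtain x where x: "chain n (bar_basis n 2) x" "v = vec_cls n (bar_basis n 2) x"
    using vw(1) by (rule vec_cls_cases[OF finite_bar_basis])
  obtain y where y: "chain n (bar_basis n 2) y" "w = vec_cls n (bar_basis n 2) y"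
    using vw(2) by (rule vec_cls_cases[OF finite_bar_basis])
  show "B2_to_Der n (v \<oplus>\<^bsub>free_module (R_ring n) (bar_basis n 2)\<^esub> w) = B2_to_Der n v \<oplus>\<^bsub>Der n\<^esub> B2_to_Der n w"
    unfolding x(2) y(2) vec_cls_add[OF x(1) y(1)] B2_to_Der_vec[OF n x(1)] B2_to_Der_vec[OF n y(1)]
      B2_to_Der_vec[OF n chain_add[OF x(1) y(1)]] coordinates_add
    by (rule induced_derivation_add[OF tangent_coordinates[OF n x(1)] tangent_coordinates[OF n y(1)]])
next
  fix r :: "'k qpoly set" and v :: "bar_word \<Rightarrow> 'k qpoly set"
  assume r: "r \<in> carrier (R_ring n)" and "v \<in> carrier (free_module (R_ring n) (bar_basis n 2))"
  then have v: "v \<in> bar_basis n 2 \<rightarrow>\<^sub>E carrier (R_ring n)" by simp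
  obtain x where x: "chain n (bar_basis n 2) x" "v = vec_cls n (bar_basis n 2) x"
    using v by (rule vec_cls_cases[OF finite_bar_basis])
  obtain q where q: "over_vars (vars n) q" "r = cls n q" using r by (rule carrier_R_ringE)
  show "B2_to_Der n (r \<odot>\<^bsub>free_module (R_ring n) (bar_basis n 2)\<^esub> v) = r \<odot>\<^bsub>Der n\<^esub> B2_to_Der n v"
    unfolding x(2) q(2) vec_cls_smult[OF x(1) q(1)] B2_to_Der_vec[OF n x(1)]
      B2_to_Der_vec[OF n chain_scale[OF q(1) x(1)]] coordinates_scale
    by (rule induced_derivation_scale[OF tangent_coordinates[OF n x(1)] q(1)])
qed

lemma B2_to_Der_image:
  fixes n :: nat
  assumes n: "2 \<le> n"
  shows "B2_to_Der n ` carrier (free_module (R_ring n) (bar_basis n 2))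
    = carrier (Der n :: 'k::field Der_module)"
proof
  show "B2_to_Der n ` carrier (free_module (R_ring n) (bar_basis n 2))
    \<subseteq> carrier (Der n :: 'k Der_module)"
    using B2_to_Der_linear[OF n, where ?'k = 'k] unfolding linear_map_def by blast
  show "carrier (Der n :: 'k Der_module)
    \<subseteq> B2_to_Der n ` carrier (free_module (R_ring n) (bar_basis n 2))"
  proof
    fix \<delta> :: "'k qpoly set \<Rightarrow> 'k qpoly set" assume "\<delta> \<in> carrier (Der n)"
    then obtain a where a: "tangent n a" "\<delta> = induced_derivation n (vec_cls n (vars n) a)" by (rule Der_cases)
    obtain x where x: "chain n (bar_basis n 2) x" "coordinates n x = a"
      using tangent_coordinates_cases[OF n a(1)] by blast
    have "\<delta> = B2_to_Der n (vec_cls n (bar_basis n 2) x)" unfolding a(2) B2_to_Der_vec[OF n x(1)] x(2) ..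
    then show "\<delta> \<in> B2_to_Der n ` carrier (free_module (R_ring n) (bar_basis n 2))"
      using vec_cls_closed[OF x(1)] by simp
  qed
qed

lemma tangent_0: "tangent n 0"
  by (simp add: tangent_def vector_field_def)

lemma zero_Der: "\<zero>\<^bsub>Der n\<^esub> = induced_derivation n (vec_cls n (vars n) (0 :: nat \<times> nat \<Rightarrow>\<^sub>0 'k::field qpoly))"
proof (rule extensionalityI[OF _ induced_derivation_extensional])
  fix c :: "'k qpoly set" assume "c \<in> carrier (R_ring n)"
  then obtain p where "over_vars (vars n) p" "c = cls n p" by (rule carrier_R_ringE)
  then show "\<zero>\<^bsub>Der n\<^esub> c = induced_derivation n (vec_cls n (vars n) 0) c"
    by (simp add: induced_derivation_cls tangent_0 vector_field_def cls_zero)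
qed simp

text \<open>Since \<open>ker J\<^sup>T\<^sub>R\<close> embeds into the derivations, the augmentation has the same kernel as
  \<open>B\<^sub>2 \<rightarrow> B\<^sub>1\<close>, and exactness at \<open>B\<^sub>2\<close> applies.\<close>

lemma B2_to_Der_kernel:
  fixes n :: nat
  assumes n: "2 \<le> n"
  shows "a_kernel (free_module (R_ring n) (bar_basis n 2))
      (Der n :: 'k::field Der_module) (B2_to_Der n)
    = matrix_map (R_ring n) (bar_basis n 3) (bar_basis n 2) (bar_matrix n) ` carrier (free_module (R_ring n) (bar_basis n 3))"
proof -
  have "B2_to_Der n v = \<zero>\<^bsub>Der n\<^esub> \<longleftrightarrow>
    matrix_map (R_ring n) (bar_basis n 2) (bar_basis n 1) (bar_matrix n) v = \<zero>\<^bsub>free_module (R_ring n) (bar_basis n 1)\<^esub>"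
    if v: "v \<in> bar_basis n 2 \<rightarrow>\<^sub>E carrier (R_ring n)" for v :: "bar_word \<Rightarrow> 'k qpoly set"
  proof -
    obtain x where x: "chain n (bar_basis n 2) x" "v = vec_cls n (bar_basis n 2) x"
      using v by (rule vec_cls_cases[OF finite_bar_basis])
    note t = tangent_coordinates[OF n x(1)]
    have "B2_to_Der n v = \<zero>\<^bsub>Der n\<^esub> \<longleftrightarrow> vec_cls n (vars n) (coordinates n x) = vec_cls n (vars n) 0"
      unfolding x(2) B2_to_Der_vec[OF n x(1)] zero_Der
    proof (rule inj_on_eq_iff[OF bij_betw_imp_inj_on[OF bij_betw_induced_derivation]])
      show "vec_cls n (vars n) (coordinates n x) \<in> carrier (ker_JT n)"
        using t by (simp add: carrier_ker_JT tangent_chain)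
      show "vec_cls n (vars n) 0 \<in> carrier (ker_JT n)" by (simp add: carrier_ker_JT tangent_0)
    qed
    also have "vec_cls n (vars n) (0 :: nat \<times> nat \<Rightarrow>\<^sub>0 'k qpoly) = \<zero>\<^bsub>free_module (R_ring n) (vars n)\<^esub>"
      unfolding vec_cls_eq_0 by simp
    also have "vec_cls n (vars n) (coordinates n x) = \<zero>\<^bsub>free_module (R_ring n) (vars n)\<^esub> \<longleftrightarrow>
        (\<forall>w\<in>bar_basis n 1. lookup (bar_d n x) w \<in> I_ideal n)"
      unfolding vec_cls_eq_0 bar_basis_1 chain_coordinates(2)[OF n x(1)]
      by (simp add: lookup_relabel_inj[OF inj_vars_word])
    also have "\<dots> \<longleftrightarrow> vec_cls n (bar_basis n 1) (bar_d n x) = \<zero>\<^bsub>free_module (R_ring n) (bar_basis n 1)\<^esub>"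
      unfolding vec_cls_eq_0 ..
    also have "vec_cls n (bar_basis n 1) (bar_d n x)
        = matrix_map (R_ring n) (bar_basis n 2) (bar_basis n 1) (bar_matrix n) v"
      using matrix_map_bar[of n 1 x] n x by (simp add: numeral_2_eq_2)
    finally show ?thesis .
  qed
  then have "a_kernel (free_module (R_ring n) (bar_basis n 2))
      (Der n :: 'k Der_module) (B2_to_Der n)
    = a_kernel (free_module (R_ring n) (bar_basis n 2)) (free_module (R_ring n) (bar_basis n 1))
        (matrix_map (R_ring n) (bar_basis n 2) (bar_basis n 1) (bar_matrix n))"
    unfolding a_kernel_def' by auto
  also have "\<dots> = matrix_map (R_ring n) (bar_basis n 3) (bar_basis n 2) (bar_matrix n) ` carrier (free_module (R_ring n) (bar_basis n 3))"
    using bar_exact[OF n, of 1] by (simp add: numeral_2_eq_2 numeral_3_eq_3)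
  finally show ?thesis .
qed

lemma unit_vector_vec: "unit_vector (R_ring n) S s = vec_cls n S (gen s :: 's \<Rightarrow>\<^sub>0 'k::field qpoly)"
  unfolding unit_vector_def vec_cls_def by (rule restrict_ext) (auto simp: lookup_gen cls_one cls_zero)

text \<open>The coordinates of the image of a basis element of degree \<open>d\<close> are homogeneous of degree
  \<open>d + 1\<close>, since \<open>b\<^sub>v\<close> has the degree \<open>-1\<close>; the partial derivative takes the \<open>1\<close> back.\<close>

lemma B2_to_Der_grade:
  fixes n :: nat
  assumes n: "2 \<le> n" and s: "s \<in> bar_basis n 2"
  shows "B2_to_Der n (unit_vector (R_ring n) (bar_basis n 2) s)
    \<in> (Der_grade n (bar_ideg n s) :: ('k::field qpoly set \<Rightarrow> 'k qpoly set) set)"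
proof -
  define a where "a = coordinates n (gen s :: 'k bar_chain)"
  have x: "chain n (bar_basis n 2) (gen s :: 'k bar_chain)" using s by simp
  have t: "tangent n a" unfolding a_def by (rule tangent_coordinates[OF n x])
  have D: "B2_to_Der n (unit_vector (R_ring n) (bar_basis n 2) s) = induced_derivation n (vec_cls n (vars n) a)"
    unfolding unit_vector_vec a_def by (rule B2_to_Der_vec[OF n x])
  have hom: "homogeneous (bar_ideg n s + 1) (lookup a v)" for v
  proof -
    have "lookup a v = lookup (bar_diff n s) (vars_word v)"
      using lookup_relabel_inj[OF inj_vars_word, of a v] chain_coordinates(2)[OF n x] by (simp add: a_def)
    then show ?thesis
      using graded_bar_diff_basis[OF n, of s 1, where ?'k = 'k] s
      by (simp add: graded_chain_def numeral_2_eq_2) (metis U_ideg.simps(2) bar_ideg_Nil diff_minus_eq_add)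
  qed
  have "induced_derivation n (vec_cls n (vars n) a) ` R_grade n e \<subseteq> R_grade n (e + bar_ideg n s)" for e
  proof
    fix c assume "c \<in> induced_derivation n (vec_cls n (vars n) a) ` R_grade n e"
    then obtain p where p: "over_vars (vars n) p" "homogeneous e p" "c = induced_derivation n (vec_cls n (vars n) a) (cls n p)"
      by (auto simp: R_grade_def carrier_Q_ring)
    have "homogeneous ((bar_ideg n s + 1) + (e - 1)) (vector_field n a p)"
      unfolding vector_field_def by (intro homogeneous_sum homogeneous_mult hom homogeneous_partial p(2))
    then have "homogeneous (e + bar_ideg n s) (vector_field n a p)" by (simp add: add.commute)
    then show "c \<in> R_grade n (e + bar_ideg n s)"
      unfolding p(3) induced_derivation_cls[OF t p(1)]
      by (intro R_grade_cls over_vars_vector_field tangent_chain t p(1))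
  qed
  then show ?thesis unfolding D Der_grade_def using induced_derivation_Der[OF t] by blast
qed

lemma bar_minimal_resolution:
  fixes n :: nat
  assumes n: "2 \<le> n"
  shows "minimal_graded_free_resolution (R_ring n) (R_grade n) (R_max_ideal n)
    (Der n :: 'k::field Der_module) (Der_grade n)
    (\<lambda>i. bar_basis n (i + 2)) (\<lambda>i. bar_ideg n) (\<lambda>i. bar_matrix n) (B2_to_Der n)"
  unfolding minimal_graded_free_resolution_def
proof (intro conjI allI ballI)
  show "cring (R_ring n :: 'k qpoly set ring)" by (rule cring_R_ring)
  show "module (R_ring n) (Der n :: 'k Der_module)" by (rule module_Der)
  show "finite (bar_basis n (i + 2))" for i by simp
  fix i t s assume "s \<in> bar_basis n (Suc i + 2)"
  then have s: "s \<in> bar_basis n (Suc (i + 2))" by simp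
  note g = graded_bar_diff_basis[OF n s, where ?'k = 'k, unfolded graded_chain_def]
  show "(bar_matrix n t s :: 'k qpoly set) \<in> R_grade n (bar_ideg n s - bar_ideg n t)"
    unfolding bar_matrix_def by (rule R_grade_cls) (use g in \<open>simp_all add: chain_def del: split_paired_All\<close>)
  show "(bar_matrix n t s :: 'k qpoly set) \<in> R_max_ideal n"
    unfolding bar_matrix_def by (rule cls_R_max_ideal) (use g in \<open>simp_all add: chain_def del: split_paired_All\<close>)
next
  show "linear_map (R_ring n) (free_module (R_ring n) (bar_basis n (0 + 2)))
    (Der n :: 'k Der_module) (B2_to_Der n)"
    using B2_to_Der_linear[OF n] by (simp add: numeral_2_eq_2)
  show "B2_to_Der n (unit_vector (R_ring n) (bar_basis n (0 + 2)) s)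
      \<in> (Der_grade n (bar_ideg n s) :: ('k qpoly set \<Rightarrow> 'k qpoly set) set)"
    if "s \<in> bar_basis n (0 + 2)" for s using B2_to_Der_grade[OF n] that by (simp add: numeral_2_eq_2)
  show "B2_to_Der n ` carrier (free_module (R_ring n) (bar_basis n (0 + 2)))
    = carrier (Der n :: 'k Der_module)"
    using B2_to_Der_image[OF n] by (simp add: numeral_2_eq_2)
  show "a_kernel (free_module (R_ring n) (bar_basis n (0 + 2)))
      (Der n :: 'k Der_module) (B2_to_Der n)
    = matrix_map (R_ring n) (bar_basis n (Suc 0 + 2)) (bar_basis n (0 + 2)) (bar_matrix n) `
        carrier (free_module (R_ring n) (bar_basis n (Suc 0 + 2)))"
    using B2_to_Der_kernel[OF n] by (simp add: numeral_3_eq_3 numeral_2_eq_2)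
  show "a_kernel (free_module (R_ring n :: 'k qpoly set ring) (bar_basis n (Suc i + 2)))
      (free_module (R_ring n) (bar_basis n (i + 2)))
      (matrix_map (R_ring n) (bar_basis n (Suc i + 2)) (bar_basis n (i + 2)) (bar_matrix n))
    = matrix_map (R_ring n) (bar_basis n (Suc (Suc i) + 2)) (bar_basis n (Suc i + 2)) (bar_matrix n) `
        carrier (free_module (R_ring n) (bar_basis n (Suc (Suc i) + 2)))" for i
    using bar_exact[OF n, of "i + 2", where ?'k = 'k] by simp
qed


section \<open>The first two matrices\<close>

lemma B2_word_bij: "bij_betw B2_word (B2_index n) (bar_basis n 2)"
proof -
  have "w \<in> B2_word ` B2_index n" if w: "w \<in> bar_basis n 2" for w
  proof -
    obtain as u where w_eq: "w = (as, u)" by (cases w)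
    show ?thesis
    proof (cases as)
      case Nil
      then have "B2_word (Inl u) = w" "u \<in> U_basis n 2" using w w_eq
        by (auto simp: B2_word_def bar_basis_eq U_basis_eq)
      then show ?thesis unfolding B2_index_def by force
    next
      case (Cons g as')
      have "as' = []"
        using w A_deg_pos[of g] A_deg_pos[of "hd as'"] unfolding w_eq Cons
        by (cases as') (auto simp: bar_basis_eq)
      then have "B2_word (Inr (g, u)) = w" "g \<in> A_basis n 1" "u \<in> U_basis n 0"
        using w A_deg_pos[of g] unfolding w_eq Cons by (auto simp: B2_word_def bar_basis_eq U_basis_eq A_basis_eq)
      then show ?thesis unfolding B2_index_def by force
    qed
  qed
  moreover have "B2_word i \<in> bar_basis n 2" if "i \<in> B2_index n" for i
    using that by (auto simp: B2_index_def B2_word_def bar_basis_eq U_basis_eq A_basis_eq)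
  moreover have "inj B2_word" by (rule injI) (auto simp: B2_word_def split: sum.splits)
  ultimately show ?thesis unfolding bij_betw_def using inj_on_subset[of B2_word UNIV] by blast
qed

lemma B3_word_bij: "bij_betw B3_word (B3_index n) (bar_basis n 3)"
proof -
  have "w \<in> B3_word ` B3_index n" if w: "w \<in> bar_basis n 3" for w
  proof -
    obtain as u where w_eq: "w = (as, u)" by (cases w)
    show ?thesis
    proof (cases as)
      case Nil
      then show ?thesis using w unfolding w_eq by (cases u) (auto simp: bar_basis_eq)
    next
      case (Cons g as')
      have nil: "as' = []"
        using w A_deg_pos[of g] A_deg_pos[of "hd as'"] unfolding w_eq Cons
        by (cases as') (auto simp: bar_basis_eq)
      show ?thesis
      proof (cases g)
        case (eA i)
        then have "B3_word (Inl (g, u)) = w" "g \<in> A_basis n 1" "u \<in> U_basis n 1"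
          using w unfolding w_eq Cons nil by (auto simp: B3_word_def bar_basis_eq U_basis_eq A_basis_eq)
        then show ?thesis unfolding B3_index_def by force
      next
        case (TA i)
        then have "B3_word (Inr (g, u)) = w" "g \<in> A_basis n 2" "u \<in> U_basis n 0"
          using w unfolding w_eq Cons nil by (auto simp: B3_word_def bar_basis_eq U_basis_eq A_basis_eq)
        then show ?thesis unfolding B3_index_def by force
      qed
    qed
  qed
  moreover have "B3_word i \<in> bar_basis n 3" if "i \<in> B3_index n" for i
    using that by (auto simp: B3_index_def B3_word_def bar_basis_eq U_basis_eq A_basis_eq)
  moreover have "inj_on B3_word (B3_index n)"
    by (rule inj_onI) (auto simp: B3_word_def B3_index_def A_basis_eq split: sum.splits)
  ultimately show ?thesis unfolding bij_betw_def by blast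
qed

lemma card_bases:
  "card (U_basis n 0) = n + 1" "card (U_basis n 1) = n * (n + 1)" "card (U_basis n 2) = n * n - 1"
  "card (A_basis n 1) = n + 1" "card (A_basis n 2) = n" if "1 \<le> n"
proof -
  have inj: "inj_on aU S" "inj_on bU T" "inj_on cU T" "inj_on eA S" "inj_on TA S" for S T
    by (auto intro: inj_onI)
  have card: "card (col_labels n) = n + 1" "card (row_labels n) = n"
    by (simp_all add: col_labels_def row_labels_def)
  have "(1, 1) \<in> row_labels n \<times> row_labels n" using that by (simp add: row_labels_def)
  then have "card (row_labels n \<times> row_labels n - {(1, 1)}) = n * n - 1"
    by (simp add: card_cartesian_product card)
  then show "card (U_basis n 2) = n * n - 1" unfolding U_basis_2 by (simp only: card_image[OF inj(3)])
  show "card (U_basis n 0) = n + 1" unfolding U_basis_0 by (simp only: card_image[OF inj(1)] card)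
  show "card (U_basis n 1) = n * (n + 1)"
    unfolding U_basis_1 vars_eq by (simp only: card_image[OF inj(2)] card card_cartesian_product)
  show "card (A_basis n 1) = n + 1" unfolding A_basis_1 by (simp only: card_image[OF inj(4)] card)
  show "card (A_basis n 2) = n" unfolding A_basis_2 by (simp only: card_image[OF inj(5)] card)
qed

lemma finite_bases: "finite (U_basis n d)" "finite (A_basis n d)"
  by (auto simp: U_basis_def A_basis_def vars_def)

lemma card_bar_basis_2:
  assumes "1 \<le> n" shows "card (bar_basis n 2) = 2 * n * (n + 1)"
proof -
  have "card (bar_basis n 2) = card (B2_index n)" by (rule bij_betw_same_card[OF B2_word_bij, symmetric])
  also have "\<dots> = card (U_basis n 2) + card (A_basis n 1) * card (U_basis n 0)"
    unfolding B2_index_def Plus_def[symmetric]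
    by (simp only: card_Plus finite_bases finite_cartesian_product card_cartesian_product)
  also have "\<dots> = n * n - 1 + (n + 1) * (n + 1)" by (simp only: card_bases[OF assms])
  also have "\<dots> = 2 * n * (n + 1)"
  proof -
    have "1 \<le> n * n" using assms by simp
    then show ?thesis by (simp add: algebra_simps)
  qed
  finally show ?thesis .
qed

lemma card_bar_basis_3:
  assumes "1 \<le> n" shows "card (bar_basis n 3) = n * (n + 1) * (n + 2)"
proof -
  have "card (bar_basis n 3) = card (B3_index n)" by (rule bij_betw_same_card[OF B3_word_bij, symmetric])
  also have "\<dots> = card (A_basis n 1) * card (U_basis n 1) + card (A_basis n 2) * card (U_basis n 0)"
    unfolding B3_index_def Plus_def[symmetric]
    by (simp only: card_Plus finite_bases finite_cartesian_product card_cartesian_product)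
  also have "\<dots> = n * (n + 1) * (n + 2)" by (simp only: card_bases[OF assms]) (simp add: algebra_simps)
  finally show ?thesis .
qed

lemma lookup_U_word: "lookup (U_word x) (as, u) = (if as = [] then lookup x u else 0)"
proof -
  have "lookup (U_word x) (as, u) = (\<Sum>g\<in>keys x. if g = u then (if as = [] then lookup x g else 0) else 0)"
    unfolding relabel_lin lookup_lin by (rule sum.cong[OF refl]) (auto simp: lookup_gen)
  then show ?thesis by (simp add: in_keys_iff)
qed

lemma lookup_bar_cons:
  "lookup (bar_cons g x) (as, u) = (case as of [] \<Rightarrow> 0 | h # as' \<Rightarrow> if h = g then lookup x (as', u) else 0)"
proof (cases as)
  case Nil
  then show ?thesis unfolding relabel_lin lookup_lin
    by (auto simp: lookup_gen word_cons_def intro!: sum.neutral)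
next
  case (Cons h as')
  then show ?thesis using lookup_strip[of h "bar_cons g x" as' u]
    by (cases "h = g") (simp_all add: strip_bar_cons)
qed

lemma B2_matrix:
  assumes t: "t \<in> U_basis n 1" and s: "s \<in> B2_index n"
  shows "(bar_matrix n ([], t) (B2_word s) :: 'k::field qpoly set) = B2_display_matrix n t s"
proof (cases s)
  case (Inl c)
  then show ?thesis
    by (simp add: bar_matrix_def B2_word_def B2_display_matrix_def block_row_def partial2_matrix_def
        bar_diff_Nil lookup_U_word)
next
  case (Inr gu)
  then obtain i j where "gu = (eA i, aU j)" using s
    by (auto simp: B2_index_def A_basis_1 U_basis_0 simp del: One_nat_def)
  then show ?thesis using Inr
    by (simp add: bar_matrix_def B2_word_def B2_display_matrix_def block_row_def M_matrix_def
        bar_diff_e bar_diff_Nil merge.simps lookup_U_word del: act.simps)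
qed

lemma B3_matrix:
  assumes n: "2 \<le> n" and t: "t \<in> B2_index n" and s: "s \<in> B3_index n"
  shows "(bar_matrix n (B2_word t) (B3_word s) :: 'k::field qpoly set) = B3_display_matrix n t s"
proof -
  interpret R: cring "R_ring n :: 'k qpoly set ring" by (rule cring_R_ring)
  have ov_act: "over_vars (vars n) (lookup (act n g u) t :: 'k qpoly)" if "g \<in> A_gens n" "u \<in> U_gens n" for g u t
    by (rule chain_over_vars[OF graded_chain_chain[OF graded_act[OF n that]]])
  from s consider i k l where "i \<in> col_labels n" "k \<in> row_labels n" "l \<in> col_labels n" "s = Inl (eA i, bU (k, l))"
    | j q where "j \<in> row_labels n" "q \<in> col_labels n" "s = Inr (TA j, aU q)"
    by (auto simp: B3_index_def A_basis_1 A_basis_2 U_basis_0 U_basis_1 simp del: One_nat_def)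
  then show ?thesis
  proof cases
    case 1
    have d: "bar_diff n (B3_word s) = U_word (act n (eA i) (bU (k, l))) + bar_cons (eA i) (U_word (U_diff n (bU (k, l))))"
      using 1(4) by (simp add: B3_word_def bar_diff_e bar_diff_Nil merge.simps del: act.simps U_diff.simps)
    from t consider u where "t = Inl u" | p q where "p \<in> col_labels n" "q \<in> col_labels n" "t = Inr (eA p, aU q)"
      by (auto simp: B2_index_def A_basis_1 U_basis_0 simp del: One_nat_def)
    then show ?thesis
    proof cases
      case (1 u)
      then show ?thesis unfolding bar_matrix_def d using \<open>s = _\<close>
        by (simp add: B2_word_def lookup_add lookup_U_word lookup_bar_cons B3_display_matrix_def block_matrix_def
            M_matrix_def del: act.simps U_diff.simps)
    next
      case (2 p q)
      have U: "lookup (U_diff n (bU (k, l))) (aU q) = (partial (k, l) (Fmin n q) :: 'k qpoly)"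
        unfolding U_diff.simps col_labels_def[symmetric] using 2(2)
        by (simp add: lookup_sum lookup_gen if_distrib cong: if_cong)
      have "JT n q (k, l) \<in> carrier (R_ring n :: 'k qpoly set ring)"
        unfolding JT_def using 2(2) by (intro cls_closed over_vars_partial over_vars_Fmin)
      then show ?thesis unfolding bar_matrix_def d using \<open>s = _\<close> 2
        by (auto simp: B2_word_def lookup_add lookup_U_word lookup_bar_cons B3_display_matrix_def block_matrix_def
            kronecker_def id_matrix_def JT_def U cls_zero[symmetric] simp del: act.simps U_diff.simps)
    qed
  next
    case 2
    have d: "bar_diff n (B3_word s) = (\<Sum>l\<in>col_labels n. xvar j l \<cdot> bar_cons (eA l) (gen ([], aU q)))
        - U_word (act n (TA j) (aU q))"
      using 2(3) by (simp add: B3_word_def bar_diff_T bar_diff_Nil merge.simps del: act.simps)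
    from t consider u where "t = Inl u" | p r where "p \<in> col_labels n" "r \<in> col_labels n" "t = Inr (eA p, aU r)"
      by (auto simp: B2_index_def A_basis_1 U_basis_0 simp del: One_nat_def)
    then show ?thesis
    proof cases
      case (1 u)
      have "over_vars (vars n) (lookup (act n (TA j) (aU q)) u :: 'k qpoly)"
        by (rule ov_act) (use 2 in simp_all)
      then show ?thesis unfolding bar_matrix_def d using \<open>s = _\<close> 1
        by (simp add: B2_word_def lookup_minus lookup_sum lookup_U_word lookup_bar_cons B3_display_matrix_def block_matrix_def
            M_matrix_def cls_uminus del: act.simps relabel_gen)
    next
      case (2 p r)
      have "cls n (xvar j p) \<in> carrier (R_ring n :: 'k qpoly set ring)" using 2 \<open>j \<in> _\<close> by (intro cls_closed) simp
      moreover have "lookup (\<Sum>l\<in>col_labels n. xvar j l \<cdot> bar_cons (eA l) (gen ([], aU q))) ([eA p], aU r)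
          = (if q = r then xvar j p else 0 :: 'k qpoly)"
        unfolding lookup_sum lookup_scale lookup_bar_cons using 2(1)
        by (simp add: lookup_gen if_distrib cong: if_cong)
      ultimately show ?thesis unfolding bar_matrix_def d using \<open>s = _\<close> 2
        by (auto simp: B2_word_def lookup_minus lookup_U_word B3_display_matrix_def block_matrix_def
            kronecker_def id_matrix_def phi2_matrix_def cls_zero[symmetric] simp del: act.simps relabel_gen)
    qed
  qed
qed

theorem theorem6p3:
  fixes n :: nat
    and R :: "'k::field qpoly set ring"
    and DerR :: "('k qpoly set, 'k qpoly set \<Rightarrow> 'k qpoly set) module"
    and K :: "('k qpoly set, nat \<times> nat \<Rightarrow> 'k qpoly set) module"
  assumes n: "n \<ge> 2"
    and R: "R = R_ring n"
    and DerR: "DerR = Der n"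
    and K: "K = ker_JT n"
  shows
    "linear_map R K DerR (induced_derivation n) \<and>
     bij_betw (induced_derivation n) (carrier K) (carrier DerR) \<and>
     minimal_graded_free_resolution R (R_grade n) (R_max_ideal n) DerR (Der_grade n)
       (\<lambda>i. bar_basis n (i + 2)) (\<lambda>i. bar_ideg n) (\<lambda>i. bar_matrix n) (B2_to_Der n) \<and>
     bij_betw B2_word (B2_index n) (bar_basis n 2) \<and>
     card (bar_basis n 2) = 2 * n * (n + 1) \<and>
     bij_betw B3_word (B3_index n) (bar_basis n 3) \<and>
     card (bar_basis n 3) = n * (n + 1) * (n + 2) \<and>
     (\<forall>t\<in>U_basis n 1. \<forall>s\<in>B2_index n.
       (bar_matrix n ([], t) (B2_word s) :: 'k qpoly set) = B2_display_matrix n t s) \<and>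
     (\<forall>t\<in>B2_index n. \<forall>s\<in>B3_index n.
       (bar_matrix n (B2_word t) (B3_word s) :: 'k qpoly set) = B3_display_matrix n t s)"
proof -
  have n1: "1 \<le> n" using n by simp
  show ?thesis
    unfolding R DerR K
    by (intro conjI ballI linear_map_induced_derivation bij_betw_induced_derivation
        bar_minimal_resolution[OF n] B2_word_bij card_bar_basis_2[OF n1] B3_word_bij
        card_bar_basis_3[OF n1] B2_matrix B3_matrix[OF n])
qed


end
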